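(* Let $G=G_{226}$ be the catalogue graph of row 226, $\Pi^*=\Pi_{\mathrm{opp}}(G)$, and let $\Pi_0$ and $\Pi_{50}$ be the members with indices $k=0$ and $k=50$ of the deterministic SHA-256 control family of row 226. Then $$\mathsf H(G,\Pi^* )=1,\qquad \mathsf H(G,\Pi_0)=1,\qquad \mathsf H(G,\Pi_{50})=0 .$$ Both $\Pi_0$ and $\Pi_{50}$ are different from $\Pi^*$ and have the same profile as $\Pi^*$. Moreover, the relation semigroup $S(\Pi_{50})$ has exactly 885 elements, and there is no write-preserve-use certificate for $(G,\Pi_{50})$.
   Context: **Edge partitions.** $G=(V,E)$ is a finite loopless directed graph without parallel edges. An edge partition is an unlabelled collection of nonempty pairwise disjoint subsets (blocks) of $E$ with union $E$; its profile is the multiset of block sizes. A directed two-step diamond pattern is a quadruple of distinct vertices $(x,a,b,y)$ with $(x,a),(x,b),(a,y),(b,y)\in E$ (additional arcs allowed). Its opposite pairs are $\{(x,a),(b,y)\}$ and $\{(x,b),(a,y)\}$. $\Omega(G)$ is the undirected graph on vertex set $E$ joining two edges that form an opposite pair of some pattern. $\Pi_{\mathrm{opp}}(G)$ is the set of connected components of $\Omega(G)$. **Catalogue graph $G_{226}$.** Terms are generated by $\mathcal T::=\mathtt A\mid\mathtt V\mid \mathtt P(\mathcal T,\mathcal T)\mid \mathtt R(\mathcal T,\mathcal T)$, with size $|\mathtt A|=|\mathtt V|=1$, $|\mathtt P(s,t)|=|\mathtt R(s,t)|=1+|s|+|t|$. The symbol $\mathtt V$ is a single consistently bound wildcard (placeholder):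 repeated occurrences in a pattern must match the same term. A state is a finite multiset of terms (components), written canonically as an ASCII string with its components sorted lexicographically, separated by semicolons and enclosed in braces. In a state, any component of the form $\mathtt R(p,q)$ (a represented rule) may be applied to any nonplaceholder occurrence (a subterm occurrence other than $\mathtt V$ itself) matching $p$ in any component; the occurrence is replaced by the corresponding instance of $q$ under the same binding of $\mathtt V$, and the components are sorted again. A state is valid when every non-rule component (outermost symbol not $\mathtt R$) is closed (contains no $\mathtt V$) and no rule contains $\mathtt V$ on its right without $\mathtt V$ on its left. Retain the rewrites leading to valid states whose changed component has size at most 255, and, starting from the seed $\sigma_{226}=\mathtt{\{A;R(A,R(A,A));R(V,A)\}}$, explore all transitions whose source is at distance less than 3 from the seed. The rule signature of a canonical state is the ordered tuple of its components with outermost symbol $\mathtt R$; its data signature is the ordered tuple of the remaining components. A qualifying recurrent core is a cyclic strongly connected component of the explored transition graph with at least two distinct rule signatures, at least two distinct data signatures, and an internal transition changing the rule signature. The selected core is the unique largest qualifying core. The vertices of $G_{226}$ are the states of that core, numbered $0,1,2,\dots$ in lexicographic order of canonical state strings; the directed edges are the distinct ordered pairs of distinct core states joined by at least one internal one-step rewrite. ($|V|=20$, $|E|=55$.) **Control family.** For $k\in\{0,\dots,63\}$, rank the edges $e=(u,v)\in E$ by the SHA-256 digest (increasing) of the canonical compact UTF-8 JSON serialization of the tuple $(\texttt{v616-profile-null},\sigma_{226},k,u,v)$, where the first two entries are strings and $u,v$ are vertex numbers; break ties lexicographically by $(u,v)$. Sort the block sizes of $\Pi^*$ in nonincreasing order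 and cut the ranked edge list into consecutive blocks of those sizes. The resulting unlabelled partition is $\Pi_k$. **Relations.** Let $\Pi$ be an edge partition of $G$. For a relation $R\subseteq V\times V$ write $R(v)=\{w:(v,w)\in R\}$; composition is $(R\circ S)(v)=\bigcup_{w\in R(v)}S(w)$ ($R$ first). For a block $C\in\Pi$ let $T_C=C$ viewed as a relation on $V$, and for a nonempty word $w=C_1\cdots C_k$ in blocks let $T_w=T_{C_1}\circ\cdots\circ T_{C_k}$. The relation semigroup $S(\Pi)$ is the set of distinct relations $T_w$, $w$ a nonempty word. The empty word $\varepsilon$, with $T_\varepsilon=\operatorname{Id}_V$, is admitted only as an offload word. **Behavioural quotient.** $Q_0$ is the indiscrete equivalence on $V$; $u,v$ are $Q_{t+1}$-equivalent iff for every $C\in\Pi$ the sets $\{[w]_{Q_t}:w\in T_C(u)\}$ and $\{[w]_{Q_t}:w\in T_C(v)\}$ agree. $Q$ is the stable equivalence and $\kappa_Q(v)$ the class of $v$. **Write-preserve-use (WPU) certificate.** It consists of: (W1, fork) a state $s\in V$, channels $A,B\in\Pi$ (possibly equal), $\ell\in T_A(s)$, $r\in T_B(s)$ with $\kappa_Q(\ell)\ne\kappa_Q(r)$; (W2–W3, offload) a word $o$, possibly $\varepsilon$, with $T_o(\ell)=\{p\}$, $T_o(r)=\{q\}$, $p\ne q$, $\kappa_Q(p)\neq\kappa_Q(q)$, and for each $C\in\{A,B\}$: $T_C(p)\ne\varnothing\iff T_C(q)\ne\varnothing$; (W4, persistent orbit) a nonempty word $z$ with $T_z\ne\operatorname{Id}_V$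 such that, for the partial map $T_z^{(2)}(u,v)=(u',v')$ defined when $T_z(u)=\{u'\}$ and $T_z(v)=\{v'\}$, all iterates from $(p,q)$ are defined, the two entries always lie in different $Q$-classes, and at least one iterate differs from its predecessor (the resulting eventually periodic sequence is the persistent pair orbit); (W5, use) a nonempty word $u$ with $T_u\neq\operatorname{Id}_V$ such that, with $\beta_u(v)=\{\kappa_Q(w):w\in T_u(v)\}$, $\beta_u(p)\neq\beta_u(q)$ and $(\beta_u(p),\beta_u(q))\ne(\{\kappa_Q(p)\},\{\kappa_Q(q)\})$. **Record systems (W6).** A WPU certificate has class pair $\{\kappa_Q(p),\kappa_Q(q)\}$ and operational support equal to the set of all states occurring in its persistent pair orbit. A record system is a nonempty finite family of certificates with one common class pair $K$; its support is the union of their operational supports; its representatives in class $k\in K$ are the support states belonging to $k$, and both representative sets must be nonempty. **Translations.** Let $X,Y$ be distinct record systems with class pairs presented as ordered pairs $(x_0,x_1)$, $(y_0,y_1)$. A nonempty word $t$ induces a translation $X\to Y$ when for each $i\in\{0,1\}$, $T_t$ is single-valued on every representative of $x_i$, all images lie in the support of $Y$, and all have one common class $y_{\pi(i)}$, where $\pi$ is a permutation of $\{0,1\}$. Its gain in $\mathbb Z_2$ is the parity of $\pi$. **The property $\mathsf H$.** $\mathsf H(G,\Pi)=1$ iff there is a finite family of record systems such that: (E1) at least two record systems are present; (E2) some unordered pair $X,Y$ has translations in both directions; (E3) some two supports are strictly nested or have nonempty proper overlap (disjoint or equal supports do not qualify); (E4) there are distinct record systems $X,Y$, a certificate in $X$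 whose persistent pair orbit has eventual period $m>1$, a coordinate $j\in\{0,1\}$ and a nonempty word $r$ such that, writing $(p_h,q_h)$, $0\le h<m$, for the periodic part and $x_h=p_h$ if $j=0$, $x_h=q_h$ if $j=1$, for every $h$ one has $T_r(x_h)=\{y_h\}$ with $y_h$ in the support of $Y$ and $\kappa_Q(y_h)$ in its class pair, and $(\kappa_Q(y_h))_{h=0}^{m-1}$ is nonconstant; (E5) the directed multigraph whose vertices are the record systems and whose arcs are translations labelled by gains has a closed directed walk of odd total gain. Otherwise $\mathsf H(G,\Pi)=0$. *)

theory Defs
  imports
    "HOL-Library.Multiset"
    "HOL-Library.Char_ord"
    "HOL-Library.List_Lexorder"
    "HOL-Library.Product_Lexorder"
    "HOL-Library.Word"
    "HOL-Library.Z2"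
    "HOL-Combinatorics.Permutations"
    "Graph_Theory.Digraph_Component"
begin

unbundle bit_operations_syntax

text \<open>
  A directed graph without parallel arcs is a \<^typ>\<open>'v pair_pre_digraph\<close>; its edges are pairs of
  vertices. An edge partition is a set of blocks, each block being a relation on the vertices.
  Strings and lists are compared lexicographically, characters by their ASCII codes.
\<close>

section \<open>Edge partitions\<close>

definition profile :: "'v rel set \<Rightarrow> nat multiset" where
  "profile \<P> = image_mset card (mset_set \<P>)"

definition diamond_pattern :: "'v pair_pre_digraph \<Rightarrow> 'v \<Rightarrow> 'v \<Rightarrow> 'v \<Rightarrow> 'v \<Rightarrow> bool" where
  "diamond_pattern G x a b y \<longleftrightarrow>
     distinct [x, a, b, y] \<and> {(x, a), (x, b), (a, y), (b, y)} \<subseteq> parcs G"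

definition opposite_pairs :: "'v \<Rightarrow> 'v \<Rightarrow> 'v \<Rightarrow> 'v \<Rightarrow> ('v \<times> 'v) set set" where
  "opposite_pairs x a b y = {{(x, a), (b, y)}, {(x, b), (a, y)}}"

text \<open>The adjacency relation of \<open>\<Omega>(G)\<close>; it is symmetric because opposite pairs are unordered.\<close>

definition Omega_adj :: "'v pair_pre_digraph \<Rightarrow> ('v \<times> 'v) rel" where
  "Omega_adj G =
     {(e, f). \<exists>x a b y. diamond_pattern G x a b y \<and> {e, f} \<in> opposite_pairs x a b y}"

definition opp_partition :: "'v pair_pre_digraph \<Rightarrow> 'v rel set" where
  "opp_partition G = parcs G // {(e, f) \<in> parcs G \<times> parcs G. (e, f) \<in> (Omega_adj G)\<^sup>*}"

section \<open>Relations, words and the behavioural quotient\<close>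

text \<open>
  \<open>(O)\<close> composes left to right. On a nonempty word of blocks the final factor \<open>Id_on\<close> is neutral,
  since the blocks are relations on the vertex set.
\<close>

primrec word_rel :: "'v pair_pre_digraph \<Rightarrow> 'v rel list \<Rightarrow> 'v rel" where
  "word_rel G [] = Id_on (pverts G)"
| "word_rel G (C # w) = C O word_rel G w"

definition nonempty_word :: "'v rel set \<Rightarrow> 'v rel list \<Rightarrow> bool" where
  "nonempty_word \<P> w \<longleftrightarrow> w \<in> lists \<P> \<and> w \<noteq> []"

definition relation_semigroup :: "'v pair_pre_digraph \<Rightarrow> 'v rel set \<Rightarrow> 'v rel set" where
  "relation_semigroup G \<P> = {word_rel G w | w. nonempty_word \<P> w}"

primrec quot :: "'v pair_pre_digraph \<Rightarrow> 'v rel set \<Rightarrow> nat \<Rightarrow> 'v rel" where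
  "quot G \<P> 0 = pverts G \<times> pverts G"
| "quot G \<P> (Suc t) =
     {(u, v) \<in> pverts G \<times> pverts G.
        \<forall>C\<in>\<P>. (\<lambda>w. quot G \<P> t `` {w}) ` (C `` {u}) = (\<lambda>w. quot G \<P> t `` {w}) ` (C `` {v})}"

definition stable_quot :: "'v pair_pre_digraph \<Rightarrow> 'v rel set \<Rightarrow> 'v rel" where
  "stable_quot G \<P> = quot G \<P> (LEAST t. quot G \<P> (Suc t) = quot G \<P> t)"

definition kap :: "'v pair_pre_digraph \<Rightarrow> 'v rel set \<Rightarrow> 'v \<Rightarrow> 'v set" where
  "kap G \<P> v = stable_quot G \<P> `` {v}"

section \<open>Write-preserve-use certificates\<close>

fun pair_step :: "'v rel \<Rightarrow> 'v \<times> 'v \<Rightarrow> ('v \<times> 'v) option" where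
  "pair_step T (u, v) =
     (if is_singleton (T `` {u}) \<and> is_singleton (T `` {v})
      then Some (the_elem (T `` {u}), the_elem (T `` {v})) else None)"

primrec pair_iter :: "'v rel \<Rightarrow> 'v \<times> 'v \<Rightarrow> nat \<Rightarrow> ('v \<times> 'v) option" where
  "pair_iter T x 0 = Some x"
| "pair_iter T x (Suc n) = Option.bind (pair_iter T x n) (pair_step T)"

definition beta :: "'v pair_pre_digraph \<Rightarrow> 'v rel set \<Rightarrow> 'v rel list \<Rightarrow> 'v \<Rightarrow> 'v set set" where
  "beta G \<P> u v = kap G \<P> ` (word_rel G u `` {v})"

record 'v certificate =
  c_s :: 'v
  c_A :: "'v rel"
  c_B :: "'v rel"
  c_l :: 'v
  c_r :: 'v
  c_o :: "'v rel list"
  c_p :: 'v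
  c_q :: 'v
  c_z :: "'v rel list"
  c_u :: "'v rel list"

definition fork :: "'v pair_pre_digraph \<Rightarrow> 'v rel set \<Rightarrow> 'v certificate \<Rightarrow> bool" where
  "fork G \<P> c \<longleftrightarrow>
     c_s c \<in> pverts G \<and> c_A c \<in> \<P> \<and> c_B c \<in> \<P> \<and>
     c_l c \<in> c_A c `` {c_s c} \<and> c_r c \<in> c_B c `` {c_s c} \<and>
     kap G \<P> (c_l c) \<noteq> kap G \<P> (c_r c)"

definition offload :: "'v pair_pre_digraph \<Rightarrow> 'v rel set \<Rightarrow> 'v certificate \<Rightarrow> bool" where
  "offload G \<P> c \<longleftrightarrow>
     c_o c \<in> lists \<P> \<and>
     word_rel G (c_o c) `` {c_l c} = {c_p c} \<and> word_rel G (c_o c) `` {c_r c} = {c_q c} \<and>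
     c_p c \<noteq> c_q c \<and> kap G \<P> (c_p c) \<noteq> kap G \<P> (c_q c) \<and>
     (\<forall>C\<in>{c_A c, c_B c}. C `` {c_p c} \<noteq> {} \<longleftrightarrow> C `` {c_q c} \<noteq> {})"

definition persistent :: "'v pair_pre_digraph \<Rightarrow> 'v rel set \<Rightarrow> 'v certificate \<Rightarrow> bool" where
  "persistent G \<P> c \<longleftrightarrow>
     nonempty_word \<P> (c_z c) \<and> word_rel G (c_z c) \<noteq> Id_on (pverts G) \<and>
     (let x = pair_iter (word_rel G (c_z c)) (c_p c, c_q c) in
        (\<forall>n. \<exists>a b. x n = Some (a, b) \<and> kap G \<P> a \<noteq> kap G \<P> b) \<and>
        (\<exists>n. x (Suc n) \<noteq> x n))"

definition usable :: "'v pair_pre_digraph \<Rightarrow> 'v rel set \<Rightarrow> 'v certificate \<Rightarrow> bool" where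
  "usable G \<P> c \<longleftrightarrow>
     nonempty_word \<P> (c_u c) \<and> word_rel G (c_u c) \<noteq> Id_on (pverts G) \<and>
     beta G \<P> (c_u c) (c_p c) \<noteq> beta G \<P> (c_u c) (c_q c) \<and>
     (beta G \<P> (c_u c) (c_p c), beta G \<P> (c_u c) (c_q c))
       \<noteq> ({kap G \<P> (c_p c)}, {kap G \<P> (c_q c)})"

definition wpu_certificate :: "'v pair_pre_digraph \<Rightarrow> 'v rel set \<Rightarrow> 'v certificate \<Rightarrow> bool" where
  "wpu_certificate G \<P> c \<longleftrightarrow> fork G \<P> c \<and> offload G \<P> c \<and> persistent G \<P> c \<and> usable G \<P> c"

definition pair_orbit :: "'v pair_pre_digraph \<Rightarrow> 'v certificate \<Rightarrow> nat \<Rightarrow> 'v \<times> 'v" where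
  "pair_orbit G c n = the (pair_iter (word_rel G (c_z c)) (c_p c, c_q c) n)"

definition eventual_period :: "(nat \<Rightarrow> 'b) \<Rightarrow> nat" where
  "eventual_period f = (LEAST m. 0 < m \<and> (\<exists>N. \<forall>i\<ge>N. f (i + m) = f i))"

definition preperiod :: "(nat \<Rightarrow> 'b) \<Rightarrow> nat" where
  "preperiod f = (LEAST N. \<forall>i\<ge>N. f (i + eventual_period f) = f i)"

section \<open>Record systems and translations\<close>

type_synonym 'v rsystem = "'v certificate set"

definition class_pair :: "'v pair_pre_digraph \<Rightarrow> 'v rel set \<Rightarrow> 'v certificate \<Rightarrow> 'v set set" where
  "class_pair G \<P> c = {kap G \<P> (c_p c), kap G \<P> (c_q c)}"

definition op_support :: "'v pair_pre_digraph \<Rightarrow> 'v certificate \<Rightarrow> 'v set" where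
  "op_support G c = (\<Union>n. {fst (pair_orbit G c n), snd (pair_orbit G c n)})"

definition sys_support :: "'v pair_pre_digraph \<Rightarrow> 'v rsystem \<Rightarrow> 'v set" where
  "sys_support G X = (\<Union>c\<in>X. op_support G c)"

definition representatives :: "'v pair_pre_digraph \<Rightarrow> 'v rsystem \<Rightarrow> 'v set \<Rightarrow> 'v set" where
  "representatives G X k = sys_support G X \<inter> k"

definition record_system ::
  "'v pair_pre_digraph \<Rightarrow> 'v rel set \<Rightarrow> 'v rsystem \<Rightarrow> 'v set set \<Rightarrow> bool" where
  "record_system G \<P> X K \<longleftrightarrow>
     finite X \<and> X \<noteq> {} \<and>
     (\<forall>c\<in>X. wpu_certificate G \<P> c \<and> class_pair G \<P> c = K) \<and>
     (\<forall>k\<in>K. representatives G X k \<noteq> {})"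

text \<open>
  In what follows \<open>pr\<close> presents class pairs as ordered pairs: the class pair of the record
  system \<open>X\<close> is \<open>(pr X 0, pr X 1)\<close>.
\<close>

definition translation ::
  "'v pair_pre_digraph \<Rightarrow> 'v rel set \<Rightarrow> ('v rsystem \<Rightarrow> nat \<Rightarrow> 'v set) \<Rightarrow>
   'v rsystem \<Rightarrow> 'v rel list \<Rightarrow> (nat \<Rightarrow> nat) \<Rightarrow> 'v rsystem \<Rightarrow> bool" where
  "translation G \<P> pr X t \<pi> Y \<longleftrightarrow>
     X \<noteq> Y \<and> nonempty_word \<P> t \<and> \<pi> permutes {0, 1} \<and>
     (\<forall>i\<in>{0, 1}. \<forall>v\<in>representatives G X (pr X i).
        \<exists>w. word_rel G t `` {v} = {w} \<and> w \<in> sys_support G Y \<and> kap G \<P> w = pr Y (\<pi> i))"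

text \<open>The gain takes values in \<open>\<int>\<^sub>2\<close>, represented by the two-element field \<^typ>\<open>bit\<close>.\<close>

definition gain :: "(nat \<Rightarrow> nat) \<Rightarrow> bit" where
  "gain \<pi> = (if evenperm \<pi> then 0 else 1)"

type_synonym 'v tarc = "'v rsystem \<times> 'v rel list \<times> (nat \<Rightarrow> nat) \<times> 'v rsystem"

definition translation_graph ::
  "'v pair_pre_digraph \<Rightarrow> 'v rel set \<Rightarrow> ('v rsystem \<Rightarrow> nat \<Rightarrow> 'v set) \<Rightarrow> 'v rsystem set \<Rightarrow>
   ('v rsystem, 'v tarc) pre_digraph" where
  "translation_graph G \<P> pr F =
     \<lparr> verts = F,
       arcs = {(X, t, \<pi>, Y). X \<in> F \<and> Y \<in> F \<and> translation G \<P> pr X t \<pi> Y},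
       tail = (\<lambda>(X, t, \<pi>, Y). X),
       head = (\<lambda>(X, t, \<pi>, Y). Y) \<rparr>"

fun arc_gain :: "'v tarc \<Rightarrow> bit" where
  "arc_gain (X, t, \<pi>, Y) = gain \<pi>"

section \<open>The property H\<close>

definition strictly_nested :: "'v set \<Rightarrow> 'v set \<Rightarrow> bool" where
  "strictly_nested S T \<longleftrightarrow> S \<subset> T \<or> T \<subset> S"

definition proper_overlap :: "'v set \<Rightarrow> 'v set \<Rightarrow> bool" where
  "proper_overlap S T \<longleftrightarrow> S \<inter> T \<noteq> {} \<and> \<not> S \<subseteq> T \<and> \<not> T \<subseteq> S"

definition E1 :: "'v rsystem set \<Rightarrow> bool" where
  "E1 F \<longleftrightarrow> 2 \<le> card F"

definition E2 ::
  "'v pair_pre_digraph \<Rightarrow> 'v rel set \<Rightarrow> ('v rsystem \<Rightarrow> nat \<Rightarrow> 'v set) \<Rightarrow> 'v rsystem set \<Rightarrow> bool" where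
  "E2 G \<P> pr F \<longleftrightarrow>
     (\<exists>X\<in>F. \<exists>Y\<in>F. (\<exists>t \<pi>. translation G \<P> pr X t \<pi> Y) \<and> (\<exists>t \<pi>. translation G \<P> pr Y t \<pi> X))"

definition E3 :: "'v pair_pre_digraph \<Rightarrow> 'v rsystem set \<Rightarrow> bool" where
  "E3 G F \<longleftrightarrow>
     (\<exists>X\<in>F. \<exists>Y\<in>F. strictly_nested (sys_support G X) (sys_support G Y) \<or>
                   proper_overlap (sys_support G X) (sys_support G Y))"

definition E4 ::
  "'v pair_pre_digraph \<Rightarrow> 'v rel set \<Rightarrow> ('v rsystem \<Rightarrow> nat \<Rightarrow> 'v set) \<Rightarrow> 'v rsystem set \<Rightarrow> bool" where
  "E4 G \<P> pr F \<longleftrightarrow>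
     (\<exists>X\<in>F. \<exists>Y\<in>F. X \<noteq> Y \<and>
       (\<exists>c\<in>X. let m = eventual_period (pair_orbit G c); N = preperiod (pair_orbit G c) in
         m > 1 \<and>
         (\<exists>coord\<in>{fst, snd}. \<exists>r y. nonempty_word \<P> r \<and>
           (\<forall>h<m. word_rel G r `` {coord (pair_orbit G c (N + h))} = {y h} \<and>
                  y h \<in> sys_support G Y \<and> kap G \<P> (y h) \<in> {pr Y 0, pr Y 1}) \<and>
           (\<exists>h<m. \<exists>h'<m. kap G \<P> (y h) \<noteq> kap G \<P> (y h')))))"

definition E5 ::
  "'v pair_pre_digraph \<Rightarrow> 'v rel set \<Rightarrow> ('v rsystem \<Rightarrow> nat \<Rightarrow> 'v set) \<Rightarrow> 'v rsystem set \<Rightarrow> bool" where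
  "E5 G \<P> pr F \<longleftrightarrow>
     (\<exists>X w. pre_digraph.awalk (translation_graph G \<P> pr F) X w X \<and> sum_list (map arc_gain w) = 1)"

text \<open>
  Changing the presentation of class pairs changes gains by a coboundary, so \<open>E5\<close> does not depend
  on \<open>pr\<close>; the presentation is therefore simply chosen together with the family.
\<close>

definition H :: "'v pair_pre_digraph \<Rightarrow> 'v rel set \<Rightarrow> nat" where
  "H G \<P> = of_bool (\<exists>F pr.
     finite F \<and> (\<forall>X\<in>F. record_system G \<P> X {pr X 0, pr X 1}) \<and>
     E1 F \<and> E2 G \<P> pr F \<and> E3 G F \<and> E4 G \<P> pr F \<and> E5 G \<P> pr F)"

section \<open>The catalogue graph of row 226\<close>

datatype trm = TA | TV | TP trm trm | TR trm trm

primrec tsize :: "trm \<Rightarrow> nat" where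
  "tsize TA = 1"
| "tsize TV = 1"
| "tsize (TP s t) = 1 + tsize s + tsize t"
| "tsize (TR s t) = 1 + tsize s + tsize t"

primrec has_V :: "trm \<Rightarrow> bool" where
  "has_V TA = False"
| "has_V TV = True"
| "has_V (TP s t) = (has_V s \<or> has_V t)"
| "has_V (TR s t) = (has_V s \<or> has_V t)"

primrec inst :: "trm \<Rightarrow> trm \<Rightarrow> trm" where
  "inst x TA = TA"
| "inst x TV = x"
| "inst x (TP s t) = TP (inst x s) (inst x t)"
| "inst x (TR s t) = TR (inst x s) (inst x t)"

text \<open>
  One application of the rule with left side \<open>p\<close> and right side \<open>q\<close> at an occurrence of a subterm
  other than the placeholder. If \<open>p\<close> does not contain the placeholder then, in a valid state,
  neither does \<open>q\<close>, and the choice of \<open>x\<close> is immaterial.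
\<close>

inductive rewrite :: "trm \<Rightarrow> trm \<Rightarrow> trm \<Rightarrow> trm \<Rightarrow> bool" for p q where
  root: "inst x p \<noteq> TV \<Longrightarrow> rewrite p q (inst x p) (inst x q)"
| P_left: "rewrite p q s s' \<Longrightarrow> rewrite p q (TP s t) (TP s' t)"
| P_right: "rewrite p q t t' \<Longrightarrow> rewrite p q (TP s t) (TP s t')"
| R_left: "rewrite p q s s' \<Longrightarrow> rewrite p q (TR s t) (TR s' t)"
| R_right: "rewrite p q t t' \<Longrightarrow> rewrite p q (TR s t) (TR s t')"

type_synonym state = "trm multiset"

fun is_rule :: "trm \<Rightarrow> bool" where
  "is_rule (TR p q) = True"
| "is_rule _ = False"

fun valid_component :: "trm \<Rightarrow> bool" where
  "valid_component (TR p q) = (has_V q \<longrightarrow> has_V p)"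
| "valid_component t = (\<not> has_V t)"

definition valid_state :: "state \<Rightarrow> bool" where
  "valid_state S \<longleftrightarrow> (\<forall>c\<in>#S. valid_component c)"

text \<open>
  The size bound concerns the changed component after the rewrite.
  The rule \<open>TR p q\<close> and the rewritten component \<open>c\<close> may be the same component.
\<close>

definition transition :: "state rel" where
  "transition = {(S, S'). \<exists>p q c c'.
     TR p q \<in># S \<and> c \<in># S \<and> rewrite p q c c' \<and> tsize c' \<le> 255 \<and>
     S' = add_mset c' (S - {#c#}) \<and> valid_state S'}"

primrec show_trm :: "trm \<Rightarrow> string" where
  "show_trm TA = ''A''"
| "show_trm TV = ''V''"
| "show_trm (TP s t) = ''P('' @ show_trm s @ '','' @ show_trm t @ '')''"
| "show_trm (TR s t) = ''R('' @ show_trm s @ '','' @ show_trm t @ '')''"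

fun join :: "string \<Rightarrow> string list \<Rightarrow> string" where
  "join sep [] = []"
| "join sep [s] = s"
| "join sep (s # s' # ss) = s @ sep @ join sep (s' # ss)"

definition sorted_components :: "state \<Rightarrow> string list" where
  "sorted_components S = sorted_list_of_multiset (image_mset show_trm S)"

definition canonical :: "state \<Rightarrow> string" where
  "canonical S = ''{'' @ join '';'' (sorted_components S) @ ''}''"

definition rule_signature :: "state \<Rightarrow> string list" where
  "rule_signature S = sorted_components (filter_mset is_rule S)"

definition data_signature :: "state \<Rightarrow> string list" where
  "data_signature S = sorted_components (filter_mset (\<lambda>c. \<not> is_rule c) S)"

definition seed226 :: state where
  "seed226 = {#TA, TR TA (TR TA TA), TR TV TA#}"

definition sigma226 :: string where
  "sigma226 = ''{A;R(A,R(A,A));R(V,A)}''"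

lemma canonical_seed226: "canonical seed226 = sigma226"
  by code_simp

definition explored_transitions :: "state rel" where
  "explored_transitions =
     {(S, S') \<in> transition. \<exists>n<3. (seed226, S) \<in> transition ^^ n}"

definition explored_graph :: "state pair_pre_digraph" where
  "explored_graph =
     \<lparr> pverts = insert seed226 (Field explored_transitions), parcs = explored_transitions \<rparr>"

definition qualifying_core :: "state set \<Rightarrow> bool" where
  "qualifying_core C \<longleftrightarrow>
     C \<in> pre_digraph.sccs_verts (with_proj explored_graph) \<and>
     (\<exists>S\<in>C. S \<rightarrow>\<^sup>+\<^bsub>with_proj explored_graph\<^esub> S) \<and>
     card (rule_signature ` C) \<ge> 2 \<and> card (data_signature ` C) \<ge> 2 \<and>
     (\<exists>S\<in>C. \<exists>S'\<in>C. (S, S') \<in> explored_transitions \<and> rule_signature S \<noteq> rule_signature S')"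

definition core226 :: "state set" where
  "core226 = (THE C. qualifying_core C \<and> (\<forall>D. qualifying_core D \<and> D \<noteq> C \<longrightarrow> card D < card C))"

definition vertex_number :: "state \<Rightarrow> nat" where
  "vertex_number S = card {S' \<in> core226. canonical S' < canonical S}"

definition G226 :: "nat pair_pre_digraph" where
  "G226 =
     \<lparr> pverts = vertex_number ` core226,
       parcs = {(vertex_number S, vertex_number S') | S S'.
                  S \<in> core226 \<and> S' \<in> core226 \<and> S \<noteq> S' \<and> (S, S') \<in> explored_transitions} \<rparr>"

section \<open>SHA-256\<close>

text \<open>FIPS 180-4, on messages given as lists of bytes (natural numbers below 256).\<close>

type_synonym word32 = "32 word"

definition sha_ch :: "word32 \<Rightarrow> word32 \<Rightarrow> word32 \<Rightarrow> word32" where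
  "sha_ch x y z = (x AND y) XOR (NOT x AND z)"

definition sha_maj :: "word32 \<Rightarrow> word32 \<Rightarrow> word32 \<Rightarrow> word32" where
  "sha_maj x y z = (x AND y) XOR (x AND z) XOR (y AND z)"

definition sha_Sigma0 :: "word32 \<Rightarrow> word32" where
  "sha_Sigma0 x = word_rotr 2 x XOR word_rotr 13 x XOR word_rotr 22 x"

definition sha_Sigma1 :: "word32 \<Rightarrow> word32" where
  "sha_Sigma1 x = word_rotr 6 x XOR word_rotr 11 x XOR word_rotr 25 x"

definition sha_sigma0 :: "word32 \<Rightarrow> word32" where
  "sha_sigma0 x = word_rotr 7 x XOR word_rotr 18 x XOR drop_bit 3 x"

definition sha_sigma1 :: "word32 \<Rightarrow> word32" where
  "sha_sigma1 x = word_rotr 17 x XOR word_rotr 19 x XOR drop_bit 10 x"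

definition sha_K :: "word32 list" where
  "sha_K = [
     0x428a2f98, 0x71374491, 0xb5c0fbcf, 0xe9b5dba5, 0x3956c25b, 0x59f111f1, 0x923f82a4, 0xab1c5ed5,
     0xd807aa98, 0x12835b01, 0x243185be, 0x550c7dc3, 0x72be5d74, 0x80deb1fe, 0x9bdc06a7, 0xc19bf174,
     0xe49b69c1, 0xefbe4786, 0x0fc19dc6, 0x240ca1cc, 0x2de92c6f, 0x4a7484aa, 0x5cb0a9dc, 0x76f988da,
     0x983e5152, 0xa831c66d, 0xb00327c8, 0xbf597fc7, 0xc6e00bf3, 0xd5a79147, 0x06ca6351, 0x14292967,
     0x27b70a85, 0x2e1b2138, 0x4d2c6dfc, 0x53380d13, 0x650a7354, 0x766a0abb, 0x81c2c92e, 0x92722c85,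
     0xa2bfe8a1, 0xa81a664b, 0xc24b8b70, 0xc76c51a3, 0xd192e819, 0xd6990624, 0xf40e3585, 0x106aa070,
     0x19a4c116, 0x1e376c08, 0x2748774c, 0x34b0bcb5, 0x391c0cb3, 0x4ed8aa4a, 0x5b9cca4f, 0x682e6ff3,
     0x748f82ee, 0x78a5636f, 0x84c87814, 0x8cc70208, 0x90befffa, 0xa4506ceb, 0xbef9a3f7, 0xc67178f2]"

type_synonym sha_state =
  "word32 \<times> word32 \<times> word32 \<times> word32 \<times> word32 \<times> word32 \<times> word32 \<times> word32"

definition sha_init :: sha_state where
  "sha_init = (
     0x6a09e667, 0xbb67ae85, 0x3c6ef372, 0xa54ff53a, 0x510e527f, 0x9b05688c, 0x1f83d9ab, 0x5be0cd19)"

definition sha_pad :: "nat list \<Rightarrow> nat list" where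
  "sha_pad m =
     m @ [0x80] @ replicate ((119 - length m mod 64) mod 64) 0 @
     map (\<lambda>i. 8 * length m div 256 ^ (7 - i) mod 256) [0..<8]"

fun sha_words :: "nat list \<Rightarrow> word32 list" where
  "sha_words (a # b # c # d # bs) =
     word_of_nat (((a * 256 + b) * 256 + c) * 256 + d) # sha_words bs"
| "sha_words _ = []"

definition sha_blocks :: "word32 list \<Rightarrow> word32 list list" where
  "sha_blocks ws = map (\<lambda>j. take 16 (drop (16 * j) ws)) [0..<length ws div 16]"

definition sha_schedule :: "word32 list \<Rightarrow> word32 list" where
  "sha_schedule block =
     fold (\<lambda>t W. W @ [sha_sigma1 (W ! (t - 2)) + W ! (t - 7) + sha_sigma0 (W ! (t - 15)) + W ! (t - 16)])
       [16..<64] block"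

fun sha_round :: "word32 \<times> word32 \<Rightarrow> sha_state \<Rightarrow> sha_state" where
  "sha_round (k, w) (a, b, c, d, e, f, g, h) =
     (let T1 = h + sha_Sigma1 e + sha_ch e f g + k + w;
          T2 = sha_Sigma0 a + sha_maj a b c
      in (T1 + T2, a, b, c, d + T1, e, f, g))"

fun sha_add :: "sha_state \<Rightarrow> sha_state \<Rightarrow> sha_state" where
  "sha_add (a, b, c, d, e, f, g, h) (a', b', c', d', e', f', g', h') =
     (a + a', b + b', c + c', d + d', e + e', f + f', g + g', h + h')"

definition sha_compress :: "word32 list \<Rightarrow> sha_state \<Rightarrow> sha_state" where
  "sha_compress block st = sha_add st (fold sha_round (zip sha_K (sha_schedule block)) st)"

text \<open>
  The digest consists of the eight state words, each read as four big-endian bytes. Hence the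
  lexicographic order on \<^typ>\<open>sha_state\<close> is the lexicographic order on 32-byte digests.
\<close>

definition sha256 :: "nat list \<Rightarrow> sha_state" where
  "sha256 m = fold sha_compress (sha_blocks (sha_words (sha_pad m))) sha_init"

section \<open>The control family of row 226\<close>

fun show_nat :: "nat \<Rightarrow> string" where
  "show_nat n = (if n < 10 then [] else show_nat (n div 10)) @ [char_of (48 + n mod 10)]"

declare show_nat.simps [simp del]

text \<open>
  JSON string literal (\<open>CHR 0x22\<close> is the double quote). The strings serialized below contain no
  characters that JSON escapes.
\<close>

definition json_string :: "string \<Rightarrow> string" where
  "json_string s = CHR 0x22 # s @ [CHR 0x22]"

definition control_message :: "nat \<Rightarrow> nat \<times> nat \<Rightarrow> string" where
  "control_message k e =
     ''['' @ join '',''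
       [json_string ''v616-profile-null'', json_string sigma226,
        show_nat k, show_nat (fst e), show_nat (snd e)] @ '']''"

definition edge_digest :: "nat \<Rightarrow> nat \<times> nat \<Rightarrow> sha_state" where
  "edge_digest k e = sha256 (map of_char (control_message k e))"

definition ranked_edges :: "nat \<Rightarrow> (nat \<times> nat) set \<Rightarrow> (nat \<times> nat) list" where
  "ranked_edges k E = sort_key (\<lambda>e. (edge_digest k e, e)) (sorted_list_of_set E)"

fun cut :: "nat list \<Rightarrow> 'b list \<Rightarrow> 'b set list" where
  "cut [] xs = []"
| "cut (n # ns) xs = set (take n xs) # cut ns (drop n xs)"

definition Pi_star :: "nat rel set" where
  "Pi_star = opp_partition G226"

definition control_partition :: "nat \<Rightarrow> nat rel set" where
  "control_partition k =
     set (cut (rev (sorted_list_of_multiset (profile Pi_star))) (ranked_edges k (parcs G226)))"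

end

theory Submission
  imports Defs "HOL-Library.Code_Binary_Nat"
begin

text \<open>
  The core is found by exploring 41 sources, of which 20 form the core; no transition leads back
  into the core from outside, and two of the remaining 21 sources have no successor among the
  sources, so every other qualifying core has fewer than 20 states.

  For \<open>\<Pi>\<^sup>*\<close> and \<open>\<Pi>\<^sub>0\<close> one word exchanges the states \<open>0\<close> and \<open>12\<close>, which lie in different classes. The
  certificate on \<open>(0, 12)\<close>, its mirror image on \<open>(12, 0)\<close> and a third certificate whose orbit enters
  this 2-cycle from a new state give three record systems with the required properties; the odd
  closed walk is the exchanging word followed by its square.

  The semigroup of \<open>\<Pi>\<^sub>5\<^sub>0\<close> consists of the empty relation, all rectangles \<open>D \<times> R\<close> with 31 choices for
  \<open>D\<close> and 27 for \<open>R\<close>, and 47 further relations. A persistent pair orbit is eventually periodic, so a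
  power of its word fixes two distinct states as singletons, but no relation of the semigroup does.
\<close>

section \<open>The catalogue graph\<close>

text \<open>All finite checks are carried out by the simplifier through \<open>code_simp\<close>, so
  the concrete computations have to be small and symbolic. This shapes the proof: results are stated
  and verified rather than searched for. Rankings are claimed lists whose neighbours are compared,
  components are lists in which each edge is adjacent to an earlier one, and the semigroup is
  confirmed by testing closure under right multiplication by the 22 blocks. The 110 digests (55
  edges, two controls) are computed on lists of Booleans, and only their leading 32-bit words are
  compared, as these never tie. The behavioural quotient is never computed: the states that must be
  told apart already differ in whether some block has an arc leaving them, which separates them
  after one refinement step.\<close>

fun bindings :: "trm \<Rightarrow> trm \<Rightarrow> trm list option" where
  "bindings TA t = (if t = TA then Some [] else None)"
| "bindings TV t = Some [t]"
| "bindings (TP p q) (TP s t) =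
     (case (bindings p s, bindings q t) of (Some xs, Some ys) \<Rightarrow> Some (xs @ ys) | _ \<Rightarrow> None)"
| "bindings (TR p q) (TR s t) =
     (case (bindings p s, bindings q t) of (Some xs, Some ys) \<Rightarrow> Some (xs @ ys) | _ \<Rightarrow> None)"
| "bindings _ _ = None"

text \<open>\<open>bindings\<close> lists the terms met at the occurrences of the placeholder
  without comparing them; consistent binding is exactly the condition that all entries equal
  \<open>x\<close>. A pattern without placeholder gives the empty list, which is consistent with
  every \<open>x\<close>.\<close>

lemma inst_eq_iff: "inst x p = t \<longleftrightarrow> (\<exists>bs. bindings p t = Some bs \<and> set bs \<subseteq> {x})"
  by (induction p t rule: bindings.induct) (auto split: option.splits)

lemma bindings_has_V: "bindings p t = Some bs \<Longrightarrow> bs = [] \<longleftrightarrow> \<not> has_V p"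
  by (induction p t arbitrary: bs rule: bindings.induct) (auto split: option.splits if_splits)

lemma inst_no_V: "\<not> has_V q \<Longrightarrow> inst x q = q"
  by (induction q) auto

text \<open>In the case \<open>Some []\<close> the left side has no placeholder, so for a rule of a
  valid state the right side has none either and is its own only instance.\<close>

definition root_rewritings :: "trm \<Rightarrow> trm \<Rightarrow> trm \<Rightarrow> trm list" where
  "root_rewritings p q t =
     (if t = TV then [] else case bindings p t of
        None \<Rightarrow> []
      | Some [] \<Rightarrow> [q]
      | Some (b # bs) \<Rightarrow> if list_all ((=) b) bs then [inst b q] else [])"

text \<open>The hypothesis is the validity of the rule. It makes the result independent of the
  binding when the left side has no placeholder; otherwise arbitrary terms could be introduced on
  the right.\<close>

lemma set_root_rewritings:
  assumes "has_V q \<longrightarrow> has_V p"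
  shows "t' \<in> set (root_rewritings p q t) \<longleftrightarrow> (\<exists>x. inst x p \<noteq> TV \<and> t = inst x p \<and> t' = inst x q)"
proof (cases "bindings p t")
  case None
  then show ?thesis using inst_eq_iff[of _ p t] by (auto simp: root_rewritings_def)
next
  case (Some bs)
  have *: "(\<exists>x. inst x p \<noteq> TV \<and> t = inst x p \<and> t' = inst x q) \<longleftrightarrow>
      t \<noteq> TV \<and> (\<exists>x. set bs \<subseteq> {x} \<and> t' = inst x q)"
  proof -
    have "inst x p = t \<longleftrightarrow> set bs \<subseteq> {x}" for x
      using inst_eq_iff[of x p t] Some by auto
    then show ?thesis by metis
  qed
  show ?thesis
  proof (cases bs)
    case Nil
    then have "inst x q = q" for x
      using bindings_has_V[OF Some] assms inst_no_V by auto
    then show ?thesis unfolding * by (simp add: root_rewritings_def Some Nil)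
  next
    case (Cons b cs)
    then show ?thesis unfolding * by (auto simp: root_rewritings_def Some list_all_iff)
  qed
qed

fun rewritings :: "trm \<Rightarrow> trm \<Rightarrow> trm \<Rightarrow> trm list" where
  "rewritings p q (TP s t) = root_rewritings p q (TP s t) @
     map (\<lambda>s'. TP s' t) (rewritings p q s) @ map (TP s) (rewritings p q t)"
| "rewritings p q (TR s t) = root_rewritings p q (TR s t) @
     map (\<lambda>s'. TR s' t) (rewritings p q s) @ map (TR s) (rewritings p q t)"
| "rewritings p q t = root_rewritings p q t"

lemma set_rewritings:
  assumes "has_V q \<longrightarrow> has_V p"
  shows "t' \<in> set (rewritings p q t) \<longleftrightarrow> rewrite p q t t'"
proof (induction t arbitrary: t')
  case (TP s t)
  show ?case
    by (subst rewrite.simps) (auto simp: set_root_rewritings[OF assms] TP.IH image_iff)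
next
  case (TR s t)
  show ?case
    by (subst rewrite.simps) (auto simp: set_root_rewritings[OF assms] TR.IH image_iff)
next
  case TA
  show ?case
    by (subst rewrite.simps) (auto simp: set_root_rewritings[OF assms])
next
  case TV
  show ?case
    by (subst rewrite.simps) (auto simp: set_root_rewritings[OF assms])
qed

fun rule_rewritings :: "trm \<Rightarrow> trm \<Rightarrow> trm list" where
  "rule_rewritings (TR p q) c = rewritings p q c"
| "rule_rewritings _ c = []"

definition state_succs :: "trm list \<Rightarrow> trm list list" where
  "state_succs xs =
     filter (list_all valid_component)
       (concat (map (\<lambda>r. concat (map (\<lambda>c.
          map (\<lambda>c'. c' # remove1 c xs) (filter (\<lambda>c'. tsize c' \<le> 255) (rule_rewritings r c))) xs)) xs))"

text \<open>Validity of the source state supplies the hypothesis of \<open>set_rewritings\<close>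
  for each represented rule. Rule and rewritten component range independently over the list, so a
  rule may rewrite itself.\<close>

lemma transition_mset:
  assumes "valid_state (mset xs)"
  shows "(mset xs, S') \<in> transition \<longleftrightarrow> S' \<in> mset ` set (state_succs xs)"
proof -
  have V: "has_V q \<longrightarrow> has_V p" if "TR p q \<in> set xs" for p q
    using assms that by (auto simp: valid_state_def)
  have 1: "add_mset c' (mset xs - {#c#}) = mset (c' # remove1 c xs)" for c c'
    by simp
  have 2: "c' \<in> set (rule_rewritings r c) \<longleftrightarrow> (\<exists>p q. r = TR p q \<and> rewrite p q c c')" if "r \<in> set xs" for r c c'
  proof (cases r)
    case (TR p q)
    then have "has_V q \<longrightarrow> has_V p" using V that by blast
    then show ?thesis using TR set_rewritings by simp
  qed simp_all
  have 3: "valid_state (mset ys) \<longleftrightarrow> list_all valid_component ys" for ys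
    by (simp add: valid_state_def list_all_iff)
  have mem: "ys \<in> set (state_succs xs) \<longleftrightarrow> valid_state (mset ys) \<and>
      (\<exists>r\<in>set xs. \<exists>c\<in>set xs. \<exists>c'\<in>set (rule_rewritings r c).
         tsize c' \<le> 255 \<and> ys = c' # remove1 c xs)" for ys
    unfolding 3 by (auto simp: state_succs_def)
  have "S' \<in> mset ` set (state_succs xs) \<longleftrightarrow>
      (\<exists>r\<in>set xs. \<exists>c\<in>set xs. \<exists>c'\<in>set (rule_rewritings r c). tsize c' \<le> 255 \<and>
         S' = mset (c' # remove1 c xs) \<and> valid_state S')"
    unfolding image_iff Bex_def[of "set (state_succs xs)"] mem by blast
  also have "\<dots> \<longleftrightarrow> (mset xs, S') \<in> transition" (is "?lhs \<longleftrightarrow> _")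
  proof
    assume ?lhs
    then obtain r c c' where r: "r \<in> set xs" "c \<in> set xs" "c' \<in> set (rule_rewritings r c)"
      "tsize c' \<le> 255" "S' = mset (c' # remove1 c xs)" "valid_state S'" by blast
    moreover obtain p q where "r = TR p q" "rewrite p q c c'" using 2 r(1,3) by blast
    ultimately show "(mset xs, S') \<in> transition"
      unfolding transition_def 1 mem_Collect_eq case_prod_conv set_mset_mset by blast
  next
    assume "(mset xs, S') \<in> transition"
    then obtain p q c c' where t: "TR p q \<in> set xs" "c \<in> set xs" "rewrite p q c c'"
      "tsize c' \<le> 255" "S' = mset (c' # remove1 c xs)" "valid_state S'"
      unfolding transition_def 1 mem_Collect_eq case_prod_conv set_mset_mset by blast
    then have "c' \<in> set (rule_rewritings (TR p q) c)" using 2 by blast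
    with t show ?lhs by blast
  qed
  finally show ?thesis by (rule sym)
qed

section \<open>Explicit lists of states and their successors\<close>

fun same_mset :: "'a list \<Rightarrow> 'a list \<Rightarrow> bool" where
  "same_mset [] ys \<longleftrightarrow> ys = []"
| "same_mset (x # xs) ys \<longleftrightarrow> List.member ys x \<and> same_mset xs (remove1 x ys)"

text \<open>Removing matched entries one by one decides equality of multisets by equality of terms
  alone, so no order on terms is required.\<close>

lemma same_mset: "same_mset xs ys \<longleftrightarrow> mset xs = mset ys"
proof (induction xs arbitrary: ys)
  case (Cons x xs)
  show ?case
  proof (cases "x \<in> set ys")
    case True
    then have "mset ys = add_mset x (mset (remove1 x ys))" by simp
    with True show ?thesis by (simp add: Cons.IH del: mset_remove1)
  next
    case False
    then show ?thesis using mset_eq_setD[of "x # xs" ys] by auto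
  qed
qed auto

text \<open>Listed in increasing order of canonical strings, so that the position of a state is its
  vertex number.\<close>

definition core_states :: "trm list list" where
  "core_states =
    [[TA, TR TA (TR TA TA), TR TV TA],
     [TA, TR TA (TR TA (TR TA TA)), TR TV TA],
     [TA, TR TA (TR TA (TR TA (TR TA (TR TA TA)))), TR TV TA],
     [TA, TR TA (TR TA (TR (TR TA (TR TA TA)) TA)), TR TV TA],
     [TA, TR TA (TR (TR TA TA) TA), TR TV TA],
     [TA, TR TA (TR (TR TA TA) (TR (TR TA TA) TA)), TR TV TA],
     [TA, TR TA (TR (TR TA (TR TA TA)) (TR TA TA)), TR TV TA],
     [TA, TR TA (TR (TR TA (TR (TR TA TA) TA)) TA), TR TV TA],
     [TA, TR TA (TR (TR (TR (TR TA TA) TA) TA) TA), TR TV TA],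
     [TA, TR (TR TA TA) (TR TA TA), TR TV TA],
     [TA, TR (TR TA (TR TA TA)) (TR TA (TR TA TA)), TR TV TA],
     [TA, TR (TR (TR TA TA) TA) (TR (TR TA TA) TA), TR TV TA],
     [TR TA TA, TR TA (TR TA TA), TR TV TA],
     [TR TA TA, TR TA (TR TA (TR TA TA)), TR TV TA],
     [TR TA TA, TR TA (TR (TR TA TA) TA), TR TV TA],
     [TR TA TA, TR (TR TA TA) (TR TA TA), TR TV TA],
     [TR TA (TR TA TA), TR TA (TR TA TA), TR TV TA],
     [TR TA (TR TA TA), TR TA (TR TA (TR TA TA)), TR TV TA],
     [TR TA (TR TA TA), TR (TR TA TA) TA, TR TV TA],
     [TR TA (TR (TR TA TA) TA), TR (TR TA TA) TA, TR TV TA]]"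

text \<open>The sources outside the core. The two states without a successor among the sources stand
  in front: \<open>{A;A;A}\<close> has no rule, and the next one can only produce states that are
  not sources.\<close>

definition rest_states :: "trm list list" where
  "rest_states =
    [[TA, TA, TA],
     [TA, TA, TR TA (TR TA (TR TA TA))],
     [TA, TA, TR TA TA],
     [TA, TA, TR TA (TR TA TA)],
     [TA, TA, TR TA (TR (TR TA TA) TA)],
     [TA, TA, TR (TR TA TA) (TR TA TA)],
     [TA, TA, TR TV TA],
     [TA, TR TA TA, TR TA (TR TA TA)],
     [TA, TR TA TA, TR TV TA],
     [TA, TR TA TA, TR TV (TR TA TA)],
     [TA, TR TA (TR TA TA), TR TV (TR TA TA)],
     [TA, TR TA (TR TA TA), TR TV (TR TA (TR TA TA))],
     [TA, TR TA (TR TA TA), TR TV (TR (TR TA TA) TA)],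
     [TA, TR TA (TR TA (TR TA TA)), TR TV (TR TA TA)],
     [TA, TR TA (TR TA (TR TA TA)), TR TV (TR TA (TR TA TA))],
     [TA, TR TA (TR (TR TA TA) TA), TR TV (TR TA TA)],
     [TA, TR TA (TR (TR TA TA) TA), TR TV (TR (TR TA TA) TA)],
     [TA, TR (TR TA TA) TA, TR TV TA],
     [TA, TR (TR TA TA) (TR TA TA), TR TV (TR TA TA)],
     [TR TA TA, TR TA TA, TR TV TA],
     [TR TA TA, TR TA (TR TA TA), TR TV (TR TA TA)]]"

definition edges226 :: "(nat \<times> nat) list" where
  "edges226 =
    [(0, 1), (0, 4), (0, 9), (0, 12), (1, 0), (1, 2), (1, 3), (1, 6), (1, 10), (1, 17), (2, 0),
     (2, 1), (3, 0), (3, 1), (4, 0), (4, 5), (4, 7), (4, 8), (4, 11), (4, 19), (5, 4), (6, 1),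
     (7, 0), (7, 4), (8, 0), (8, 4), (9, 0), (10, 1), (11, 4), (12, 0), (12, 13), (12, 14),
     (12, 15), (12, 16), (12, 18), (13, 1), (13, 12), (14, 4), (14, 12), (15, 9), (15, 12), (16, 0),
     (16, 12), (16, 17), (17, 0), (17, 1), (17, 12), (17, 13), (17, 16), (18, 0), (18, 12),
     (18, 19), (19, 4), (19, 14), (19, 18)]"

definition mem_state :: "trm list \<Rightarrow> trm list list \<Rightarrow> bool" where
  "mem_state x ys \<longleftrightarrow> list_ex (same_mset x) ys"

lemma mem_state: "mem_state x ys \<longleftrightarrow> mset x \<in> mset ` set ys"
  by (auto simp: mem_state_def list_ex_iff same_mset)

definition near_states :: "trm list list" where
  "near_states = [TA, TR TA (TR TA TA), TR TV TA] # state_succs [TA, TR TA (TR TA TA), TR TV TA]"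

definition source_states :: "trm list list" where
  "source_states = near_states @ concat (map state_succs near_states)"

text \<open>The argument \<open>s\<close> pairs an index with the successor list of that state.
  Targets are visited in the order of \<open>ys\<close>, so that the concatenated result is
  literally the lexicographically sorted edge list.\<close>

definition indexed_succs :: "nat \<times> trm list list \<Rightarrow> (nat \<times> trm list) list \<Rightarrow> (nat \<times> nat) list" where
  "indexed_succs s ys = map (\<lambda>(j, y). (fst s, j)) (filter (\<lambda>(j, y). j \<noteq> fst s \<and> mem_state y (snd s)) ys)"

text \<open>The first two checks are the two inclusions between sources and listed states. The next
  two keep transitions from entering the core from outside and single out the two dead ends; the
  last one is the validity required by \<open>transition_mset\<close>.\<close>

lemma state_checks:
  "list_all (\<lambda>x. mem_state x (core_states @ rest_states)) source_states"
  "list_all (\<lambda>x. mem_state x source_states) (core_states @ rest_states)"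
  "list_all (\<lambda>x. list_all (\<lambda>y. \<not> mem_state y core_states) (state_succs x)) rest_states"
  "list_all (\<lambda>x. list_all (\<lambda>y. \<not> mem_state y (core_states @ rest_states)) (state_succs x)) (take 2 rest_states)"
  "list_all (list_all valid_component) (core_states @ rest_states)"
  by code_simp+

lemma edges226_check:
  "edges226 = concat (map (\<lambda>(i, x). indexed_succs (i, state_succs x) (List.enumerate 0 core_states)) (List.enumerate 0 core_states))"
  by code_simp

lemma canonical_core_states: "successively (<) (map (\<lambda>x. canonical (mset x)) core_states)"
  by code_simp

lemma transition_Image_mset:
  assumes "x \<in> set xs" "list_all (list_all valid_component) xs"
  shows "transition `` {mset x} = mset ` set (state_succs x)"
proof -
  have "valid_state (mset x)"
    using assms by (auto simp: valid_state_def list_all_iff)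
  then show ?thesis using transition_mset by blast
qed

lemma valid_state_succs:
  "list_all valid_component x \<Longrightarrow> list_all (list_all valid_component) (state_succs x)"
  by (auto simp: state_succs_def list_all_iff)

text \<open>Distance below 3 means a path of length 0, 1 or 2, hence the seed with its successors
  and, once more, the successors of these.\<close>

lemma explored_source_iff:
  "(\<exists>n<3. (seed226, S) \<in> transition ^^ n) \<longleftrightarrow> S \<in> mset ` set (core_states @ rest_states)"
proof -
  let ?s = "[TA, TR TA (TR TA TA), TR TV TA]"
  have vs: "list_all valid_component ?s" by simp
  then have vn: "list_all (list_all valid_component) near_states"
    using valid_state_succs[OF vs] unfolding near_states_def by (simp only: list.pred_inject simp_thms)
  have succ: "transition `` (mset ` set xs) = mset ` set (concat (map state_succs xs))"
    if "list_all (list_all valid_component) xs" for xs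
  proof -
    have "transition `` (mset ` set xs) = (\<Union>x\<in>set xs. transition `` {mset x})" by blast
    also have "\<dots> = (\<Union>x\<in>set xs. mset ` set (state_succs x))"
      using transition_Image_mset[OF _ that] by simp
    finally show ?thesis by (simp add: image_UN)
  qed
  have n: "mset ` set near_states = {seed226} \<union> transition `` {seed226}"
    using succ[of "[?s]"] vs by (simp add: near_states_def seed226_def)
  have lt3: "(\<exists>n<3. P n) \<longleftrightarrow> P 0 \<or> P 1 \<or> P 2" for P :: "nat \<Rightarrow> bool"
    by (auto simp: numeral_3_eq_3 numeral_2_eq_2 less_Suc_eq)
  have "(\<exists>n<3. (seed226, S) \<in> transition ^^ n) \<longleftrightarrow>
      S \<in> {seed226} \<union> transition `` {seed226} \<union> transition `` ({seed226} \<union> transition `` {seed226})"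
    unfolding lt3 by (auto simp: numeral_2_eq_2)
  also have "\<dots> \<longleftrightarrow> S \<in> mset ` set source_states"
    unfolding n[symmetric] succ[OF vn] source_states_def by (simp only: set_append image_Un)
  also have "mset ` set source_states = mset ` set (core_states @ rest_states)"
    using state_checks(1,2) unfolding list_all_iff mem_state by blast
  finally show ?thesis .
qed

lemma explored_transitions_iff:
  assumes "x \<in> set (core_states @ rest_states)"
  shows "(mset x, S') \<in> explored_transitions \<longleftrightarrow> S' \<in> mset ` set (state_succs x)"
proof -
  have "(mset x, S') \<in> explored_transitions \<longleftrightarrow> (mset x, S') \<in> transition"
    using explored_source_iff[of "mset x"] assms unfolding explored_transitions_def by blast
  then show ?thesis
    using transition_Image_mset[OF assms state_checks(5)] by blast
qed

lemma explored_transitions_source: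
  assumes "(S, S') \<in> explored_transitions"
  obtains x where "x \<in> set (core_states @ rest_states)" "S = mset x"
  using assms explored_source_iff[of S] unfolding explored_transitions_def by blast

lemma distinct_canonical_core: "sorted_wrt (<) (map (\<lambda>x. canonical (mset x)) core_states)"
  using canonical_core_states by (subst successively_iff_sorted_wrt_strong[symmetric]) (auto simp: transp_def)

lemma length_core_states: "length core_states = 20"
  by (simp add: core_states_def)

lemma edges226_iff:
  "(i, j) \<in> set edges226 \<longleftrightarrow> i < 20 \<and> j < 20 \<and> i \<noteq> j \<and>
     (mset (core_states ! i), mset (core_states ! j)) \<in> explored_transitions"
proof -
  let ?C = "List.enumerate 0 core_states"
  have indexed: "(k, l) \<in> set (indexed_succs s ys) \<longleftrightarrow>
      k = fst s \<and> l \<noteq> k \<and> (\<exists>y. (l, y) \<in> set ys \<and> mem_state y (snd s))" for k l s ys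
    by (auto simp: indexed_succs_def image_iff)
  have e: "(i, x) \<in> set ?C \<longleftrightarrow> i < 20 \<and> x = core_states ! i" for i x
    by (auto simp: in_set_enumerate_eq length_core_states)
  have "(i, j) \<in> set edges226 \<longleftrightarrow>
      (\<exists>x y. (i, x) \<in> set ?C \<and> (j, y) \<in> set ?C \<and> i \<noteq> j \<and> mem_state y (state_succs x))"
    unfolding edges226_check set_concat set_map by (simp add: indexed split_beta Bex_def split_paired_Ex) blast
  also have "\<dots> \<longleftrightarrow> i < 20 \<and> j < 20 \<and> i \<noteq> j \<and>
      mset (core_states ! j) \<in> mset ` set (state_succs (core_states ! i))"
    unfolding e mem_state by blast
  also have "\<dots> \<longleftrightarrow> i < 20 \<and> j < 20 \<and> i \<noteq> j \<and>
     (mset (core_states ! i), mset (core_states ! j)) \<in> explored_transitions"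
    using explored_transitions_iff[of "core_states ! i"] length_core_states by auto
  finally show ?thesis .
qed

text \<open>Precisely the entries in front of position \<open>i\<close> have smaller keys. Applied
  to canonical strings, this identifies \<open>vertex_number\<close> with the list position.\<close>

lemma card_less_strict_sorted:
  fixes f :: "'a \<Rightarrow> 'b :: linorder"
  assumes "sorted_wrt (<) (map f xs)" "i < length xs"
  shows "card {x \<in> set xs. f x < f (xs ! i)} = i"
proof -
  have less: "f (xs ! j) < f (xs ! k)" if "j < k" "k < length xs" for j k
    using sorted_wrt_nth_less[OF assms(1) that(1)] that by simp
  have *: "f (xs ! j) < f (xs ! k) \<longleftrightarrow> j < k" if "j < length xs" "k < length xs" for j k
    using less[of j k] less[of k j] that by (cases j k rule: linorder_cases) auto
  have "{x \<in> set xs. f x < f (xs ! i)} = (!) xs ` {..<i}"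
    using assms(2) by (auto simp: in_set_conv_nth *) (use less_trans in blast)
  moreover have "inj_on ((!) xs) {..<i}"
  proof (rule linorder_inj_onI)
    fix j k assume "j < k" "k \<in> {..<i}"
    then show "xs ! j \<noteq> xs ! k" using less[of j k] assms(2) by auto
  qed auto
  ultimately show ?thesis by (simp add: card_image)
qed

text \<open>Every vertex has an edge to 0 or to one of 1, 4 and 9, which in turn have an edge to
  0.\<close>

lemma core_reach_seed:
  assumes "i < 20"
  shows "(i, 0) \<in> (set edges226)\<^sup>*"
proof -
  have nxt: "{(1, 0), (2, 0), (3, 0), (4, 0), (5, 4), (6, 1), (7, 0), (8, 0), (9, 0), (10, 1), (11, 4), (12, 0), (13, 1), (14, 4), (15, 9), (16, 0), (17, 0), (18, 0), (19, 4)} \<subseteq> set edges226"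
    by (simp add: edges226_def)
  have "i = 0 \<or> i = 1 \<or> i = 2 \<or> i = 3 \<or> i = 4 \<or> i = 5 \<or> i = 6 \<or> i = 7 \<or> i = 8 \<or> i = 9 \<or> 
      i = 10 \<or> i = 11 \<or> i = 12 \<or> i = 13 \<or> i = 14 \<or> i = 15 \<or> i = 16 \<or> i = 17 \<or> i = 18 \<or> i = 19"
    using assms by presburger
  then have "i = 0 \<or> (i, 0) \<in> set edges226 \<or> (\<exists>j\<in>{1, 4, 9}. (i, j) \<in> set edges226)"
    using nxt by (elim disjE) simp_all
  moreover have "(j, 0) \<in> set edges226" if "j \<in> {1, 4, 9}" for j
    using nxt that by auto
  ultimately show ?thesis by (blast intro: converse_rtrancl_into_rtrancl)
qed

section \<open>Strong components of the explored graph\<close>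

definition core_set :: "state set" where
  "core_set = mset ` set core_states"

text \<open>On a path of length below 3 from the seed, each earlier state has a shorter path, so all
  transitions of the path are explored as well.\<close>

lemma seed_reach_source:
  assumes "(S, T) \<in> explored_transitions"
  shows "(seed226, S) \<in> explored_transitions\<^sup>*"
proof -
  have "n < 3 \<Longrightarrow> (seed226, S) \<in> transition ^^ n \<Longrightarrow> (seed226, S) \<in> explored_transitions\<^sup>*" for n S
  proof (induction n arbitrary: S)
    case (Suc n)
    then obtain T where T: "(seed226, T) \<in> transition ^^ n" "(T, S) \<in> transition" by auto
    then have "(T, S) \<in> explored_transitions"
      using Suc.prems unfolding explored_transitions_def by (auto intro: exI[of _ n])
    then show ?case using Suc.IH[OF _ T(1)] Suc.prems by (simp add: rtrancl.rtrancl_into_rtrancl)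
  qed simp
  then show ?thesis using assms unfolding explored_transitions_def by blast
qed

text \<open>Library reachability is confined to the vertex set; ends of explored transitions are
  vertices, so only the starting point has to be assumed to be one.\<close>

lemma reachable_explored:
  assumes "u \<in> pverts explored_graph"
  shows "u \<rightarrow>\<^sup>*\<^bsub>with_proj explored_graph\<^esub> v \<longleftrightarrow> (u, v) \<in> explored_transitions\<^sup>*"
proof
  assume "u \<rightarrow>\<^sup>*\<^bsub>with_proj explored_graph\<^esub> v"
  then show "(u, v) \<in> explored_transitions\<^sup>*"
    using reachable_rtranclI by (fastforce simp: explored_graph_def)
next
  assume "(u, v) \<in> explored_transitions\<^sup>*"
  then show "u \<rightarrow>\<^sup>*\<^bsub>with_proj explored_graph\<^esub> v"
    using assms unfolding reachable_def
    by (induction rule: rtrancl_induct)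
      (auto simp: explored_graph_def Field_def intro: rtrancl_on_into_rtrancl_on)
qed

lemma core_set_eq: "core_set = (\<lambda>i. mset (core_states ! i)) ` {..<20}"
proof -
  have "set core_states = (!) core_states ` {..<20}"
    using length_core_states by (metis nth_image order_refl take_all lessThan_atLeast0)
  then show ?thesis by (simp add: core_set_def image_image)
qed

lemma card_core_set: "card core_set = 20"
proof -
  have "distinct (map canonical (map mset core_states))"
    using distinct_canonical_core by (simp add: strict_sorted_iff o_def)
  then have "distinct (map mset core_states)" by (rule distinct_map[THEN iffD1, THEN conjunct1])
  then show ?thesis
    using distinct_card length_core_states by (fastforce simp: core_set_def)
qed

text \<open>A core state other than the seed reaches the seed, hence has an outgoing explored
  transition, hence is a source and is reached from the seed. So paths towards the seed suffice for
  both directions.\<close>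

lemma core_set_reach:
  assumes "S \<in> core_set"
  shows "(S, seed226) \<in> explored_transitions\<^sup>*" "(seed226, S) \<in> explored_transitions\<^sup>*"
proof -
  obtain i where i: "i < 20" "S = mset (core_states ! i)" using assms core_set_eq by auto
  have 0: "mset (core_states ! 0) = seed226" by (simp add: core_states_def seed226_def)
  have "(i, 0) \<in> (set edges226)\<^sup>*" using i(1) by (rule core_reach_seed)
  then have "(mset (core_states ! i), mset (core_states ! 0)) \<in> explored_transitions\<^sup>*"
    by induction (auto simp: edges226_iff intro: rtrancl_into_rtrancl)
  then show r: "(S, seed226) \<in> explored_transitions\<^sup>*" using i(2) 0 by simp
  show "(seed226, S) \<in> explored_transitions\<^sup>*"
  proof (cases "S = seed226")
    case False
    then obtain T where "(S, T) \<in> explored_transitions"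
      using r by (meson converse_rtranclE)
    then show ?thesis by (rule seed_reach_source)
  qed simp
qed

text \<open>A state with an outgoing explored transition is a source, so outside the core it is one
  of \<open>rest_states\<close>, whose successors avoid the core. States that are not sources cannot
  be left at all.\<close>

lemma rest_closed:
  assumes "S \<notin> core_set" "(S, T) \<in> explored_transitions\<^sup>*"
  shows "T \<notin> core_set"
  using assms(2,1)
proof induction
  case (step T U)
  then have "T \<notin> core_set" by simp
  obtain x where x: "x \<in> set (core_states @ rest_states)" "T = mset x"
    using step.hyps(2) by (rule explored_transitions_source)
  then have "x \<in> set rest_states" using \<open>T \<notin> core_set\<close> by (auto simp: core_set_def)
  then have "\<forall>y\<in>set (state_succs x). mset y \<notin> core_set"
    using state_checks(3) unfolding list_all_iff mem_state core_set_def by blast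
  then show ?case
    using explored_transitions_iff[OF x(1), of U] step.hyps(2) x(2) by auto
qed simp

lemma qualifying_core_set: "qualifying_core core_set"
proof -
  have seed: "seed226 \<in> core_set" "seed226 \<in> pverts explored_graph"
    by (simp_all add: core_set_def core_states_def seed226_def explored_graph_def)
  have verts: "S \<in> pverts explored_graph" if "S \<in> core_set" for S
    using core_set_reach(2)[OF that] by (cases rule: rtranclE) (auto simp: explored_graph_def Field_def)
  \<comment> \<open>This is vertex 12. The rule \<open>R(A,R(A,A))\<close> turns the data component
    \<open>A\<close> of the seed into the rule \<open>R(A,A)\<close>, so one internal transition
    changes both signatures.\<close>
  let ?S = "mset [TR TA TA, TR TA (TR TA TA), TR TV TA]"
  have "core_states ! 0 = [TA, TR TA (TR TA TA), TR TV TA]" "core_states ! 12 = [TR TA TA, TR TA (TR TA TA), TR TV TA]"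
    by (simp_all add: core_states_def)
  moreover have "(0, 12) \<in> set edges226" by (simp add: edges226_def)
  ultimately have t: "(seed226, ?S) \<in> explored_transitions"
    using edges226_iff[of 0 12] by (simp add: seed226_def)
  have S: "?S \<in> core_set"
    unfolding core_set_def by (rule imageI) (simp add: core_states_def)
  have sig: "rule_signature seed226 \<noteq> rule_signature ?S" "data_signature seed226 \<noteq> data_signature ?S"
    unfolding seed226_def by code_simp+
  have card2: "2 \<le> card (f ` core_set)" if "f seed226 \<noteq> f ?S" for f :: "state \<Rightarrow> string list"
  proof -
    have "card {f seed226, f ?S} \<le> card (f ` core_set)"
      using seed(1) S by (intro card_mono) (auto simp: core_set_def)
    then show ?thesis using that by simp
  qed
  have "core_set \<in> pre_digraph.sccs_verts (with_proj explored_graph)"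
    unfolding pre_digraph.sccs_verts_def
  proof (intro CollectI conjI ballI allI impI)
    show "core_set \<noteq> {}" using seed by auto
  next
    fix u v assume "u \<in> core_set" "v \<in> core_set"
    then show "u \<rightarrow>\<^sup>*\<^bsub>with_proj explored_graph\<^esub> v"
      using core_set_reach verts by (simp add: reachable_explored) (meson rtrancl_trans)
  next
    fix u v assume "u \<in> core_set" "v \<notin> core_set"
    then have "\<not> v \<rightarrow>\<^sup>*\<^bsub>with_proj explored_graph\<^esub> u"
      using rest_closed reachable_explored reachable_in_vertsE[of "with_proj explored_graph" v u]
      by (metis with_proj_simps(1))
    then show "\<not> u \<rightarrow>\<^sup>*\<^bsub>with_proj explored_graph\<^esub> v \<or> \<not> v \<rightarrow>\<^sup>*\<^bsub>with_proj explored_graph\<^esub> u" ..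
  qed
  moreover have "seed226 \<rightarrow>\<^sup>+\<^bsub>with_proj explored_graph\<^esub> seed226"
    using t core_set_reach(1)[OF S] by (auto simp: explored_graph_def intro: rtrancl_into_trancl2)
  ultimately show ?thesis
    unfolding qualifying_core_def using seed S t sig card2 by blast
qed

text \<open>Two rule signatures force at least two states, so every state of \<open>D\<close> has a
  successor in \<open>D\<close>, which again has one. Hence both ends of the first step are sources;
  this excludes the core and the two dead ends and leaves at most 19 states.\<close>

lemma qualifying_core_bound:
  assumes D: "qualifying_core D" and neq: "D \<noteq> core_set"
  shows "card D < 20"
proof -
  have D1: "u \<rightarrow>\<^sup>*\<^bsub>with_proj explored_graph\<^esub> v" if "u \<in> D" "v \<in> D" for u v
    using D that unfolding qualifying_core_def pre_digraph.sccs_verts_def by blast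
  have D2: "v \<in> D" if "u \<in> D" "u \<rightarrow>\<^sup>*\<^bsub>with_proj explored_graph\<^esub> v" "v \<rightarrow>\<^sup>*\<^bsub>with_proj explored_graph\<^esub> u" for u v
    using D that unfolding qualifying_core_def pre_digraph.sccs_verts_def by blast
  have C: "core_set \<in> pre_digraph.sccs_verts (with_proj explored_graph)"
    using qualifying_core_set by (simp add: qualifying_core_def)
  have "D \<in> pre_digraph.sccs_verts (with_proj explored_graph)"
    using D by (simp add: qualifying_core_def)
  with C neq have disj: "D \<inter> core_set = {}"
    unfolding pre_digraph.sccs_verts_def by safe meson+
  have reach: "(u, v) \<in> explored_transitions\<^sup>*" if "u \<in> D" "v \<in> D" for u v
    using D1[OF that] reachable_explored by (metis reachable_in_vertsE with_proj_simps(1))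
  have step: "\<exists>T\<in>D. (S, T) \<in> explored_transitions" if S: "S \<in> D" for S
  proof -
    have "card (rule_signature ` D) \<noteq> card {rule_signature S}"
      using D unfolding qualifying_core_def by auto
    then have "D \<noteq> {S}" by auto
    then obtain S' where S': "S' \<in> D" "S' \<noteq> S" using S by blast
    then obtain T where T: "(S, T) \<in> explored_transitions" "(T, S') \<in> explored_transitions\<^sup>*"
      using reach[OF S S'(1)] by (metis converse_rtranclE)
    have "S \<in> pverts explored_graph" "T \<in> pverts explored_graph"
      using T(1) by (auto simp: explored_graph_def Field_def)
    then have "T \<in> D"
      using D2[OF S] T reach[OF S'(1) S] reachable_explored by (meson r_into_rtrancl rtrancl_trans)
    with T(1) show ?thesis by blast
  qed
  let ?sinks = "take 2 rest_states"
  have "D \<subseteq> mset ` set (drop 2 rest_states)"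
  proof
    fix S assume S: "S \<in> D"
    then obtain T U where T: "T \<in> D" "(S, T) \<in> explored_transitions" "(T, U) \<in> explored_transitions"
      using step by blast
    obtain x where x: "x \<in> set (core_states @ rest_states)" "S = mset x"
      using T(2) by (rule explored_transitions_source)
    obtain y where y: "y \<in> set (core_states @ rest_states)" "T = mset y"
      using T(3) by (rule explored_transitions_source)
    have "x \<notin> set ?sinks"
    proof
      assume "x \<in> set ?sinks"
      then have "\<forall>z\<in>set (state_succs x). mset z \<notin> mset ` set (core_states @ rest_states)"
        using state_checks(4) unfolding list_all_iff mem_state by blast
      moreover have "T \<in> mset ` set (state_succs x)"
        using explored_transitions_iff[OF x(1)] T(2) x(2) by blast
      ultimately show False using y by blast
    qed
    moreover have "x \<notin> set core_states" using S x(2) disj by (auto simp: core_set_def)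
    ultimately have "x \<in> set (drop 2 rest_states)"
      using x(1) by (metis Un_iff append_take_drop_id set_append)
    then show "S \<in> mset ` set (drop 2 rest_states)" using x(2) by blast
  qed
  then have "card D \<le> card (mset ` set (drop 2 rest_states))"
    by (intro card_mono) auto
  also have "\<dots> \<le> length (drop 2 rest_states)"
    by (metis card_image_le card_length List.finite_set order_trans)
  also have "\<dots> < 20" by (simp add: rest_states_def)
  finally show ?thesis .
qed

lemma core226_eq: "core226 = core_set"
  unfolding core226_def
proof (rule the_equality)
  show "qualifying_core core_set \<and> (\<forall>D. qualifying_core D \<and> D \<noteq> core_set \<longrightarrow> card D < card core_set)"
    using qualifying_core_set qualifying_core_bound card_core_set by auto
next
  fix C assume C: "qualifying_core C \<and> (\<forall>D. qualifying_core D \<and> D \<noteq> C \<longrightarrow> card D < card C)"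
  then show "C = core_set"
    using qualifying_core_set qualifying_core_bound[of C] card_core_set by (metis less_asym)
qed

lemma vertex_number: "i < 20 \<Longrightarrow> vertex_number (mset (core_states ! i)) = i"
  using card_less_strict_sorted[of canonical "map mset core_states" i] distinct_canonical_core length_core_states
  by (simp add: vertex_number_def core226_eq core_set_def o_def)

lemma G226: "pverts G226 = {..<20}" "parcs G226 = set edges226"
proof -
  have inj: "mset (core_states ! i) \<noteq> mset (core_states ! j)" if "i < 20" "j < 20" "i \<noteq> j" for i j
    using vertex_number that by metis
  show "pverts G226 = {..<20}"
    unfolding G226_def core226_eq core_set_eq by (auto simp: vertex_number image_iff)
  have "parcs G226 = {(vertex_number S, vertex_number S') | S S'.
                  S \<in> core_set \<and> S' \<in> core_set \<and> S \<noteq> S' \<and> (S, S') \<in> explored_transitions}"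
    by (simp add: G226_def core226_eq)
  also have "\<dots> = {(i, j). i < 20 \<and> j < 20 \<and> i \<noteq> j \<and> 
     (mset (core_states ! i), mset (core_states ! j)) \<in> explored_transitions}"
    (is "?L = ?R")
  proof (intro equalityI subsetI)
    fix e assume "e \<in> ?L"
    then obtain S S' where e: "e = (vertex_number S, vertex_number S')" "S \<in> core_set" "S' \<in> core_set"
      "S \<noteq> S'" "(S, S') \<in> explored_transitions" by blast
    moreover from e obtain i j where "i < 20" "j < 20"
      "S = mset (core_states ! i)" "S' = mset (core_states ! j)"
      by (auto simp: core_set_eq)
    ultimately show "e \<in> ?R" by (auto simp: vertex_number)
  next
    fix e assume "e \<in> ?R"
    then obtain i j where "e = (i, j)" "i < 20" "j < 20" "i \<noteq> j"
      "(mset (core_states ! i), mset (core_states ! j)) \<in> explored_transitions" by auto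
    then show "e \<in> ?L"
      using inj by (intro CollectI exI[of _ "mset (core_states ! i)"] exI[of _ "mset (core_states ! j)"])
        (simp add: vertex_number core_set_eq)
  qed
  also have "\<dots> = set edges226"
    using edges226_iff by auto
  finally show "parcs G226 = set edges226" .
qed

section \<open>SHA-256 on lists of bits\<close>

text \<open>Least significant bit first: carries then run along the list, and rotating a word to the
  right is \<open>rotate\<close> on the list.\<close>

definition bits_word :: "bool list \<Rightarrow> word32" where
  "bits_word bs = horner_sum of_bool 2 bs"

lemma bits_word_simps [simp]:
  "bits_word [] = 0"
  "bits_word (b # bs) = of_bool b + 2 * bits_word bs"
  by (simp_all add: bits_word_def)

lemma bit_bits_word: "bit (bits_word bs) n \<longleftrightarrow> n < 32 \<and> n < length bs \<and> bs ! n"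
  by (auto simp: bits_word_def bit_horner_sum_bit_word_iff)

text \<open>Three-fold exclusive or is the iterated equivalence, because the two negations
  cancel.\<close>

fun bits_xor3 :: "bool list \<Rightarrow> bool list \<Rightarrow> bool list \<Rightarrow> bool list" where
  "bits_xor3 (a # as) (b # bs) (c # cs) = (a = (b = c)) # bits_xor3 as bs cs"
| "bits_xor3 _ _ _ = []"

fun bits_ch :: "bool list \<Rightarrow> bool list \<Rightarrow> bool list \<Rightarrow> bool list" where
  "bits_ch (a # as) (b # bs) (c # cs) = (if a then b else c) # bits_ch as bs cs"
| "bits_ch _ _ _ = []"

fun bits_maj :: "bool list \<Rightarrow> bool list \<Rightarrow> bool list \<Rightarrow> bool list" where
  "bits_maj (a # as) (b # bs) (c # cs) = (if b = c then b else a) # bits_maj as bs cs"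
| "bits_maj _ _ _ = []"

text \<open>A ripple-carry adder: the sum bit is the exclusive or of three bits, the new carry their
  majority, and the carry out of the last position is dropped.\<close>

fun bits_add :: "bool \<Rightarrow> bool list \<Rightarrow> bool list \<Rightarrow> bool list" where
  "bits_add c (a # as) (b # bs) = (c = (a = b)) # bits_add (if a = b then a else c) as bs"
| "bits_add _ _ _ = []"

text \<open>Here and in the next three lemmas truth tables become code equations: with constructor
  patterns every bit costs one rewrite step and no conditional is evaluated. They cover lists of
  equal length, the only case that occurs.\<close>

lemma bits_xor3_code [code]:
  "bits_xor3 (False # as) (False # bs) (False # cs) = False # bits_xor3 as bs cs"
  "bits_xor3 (False # as) (False # bs) (True # cs) = True # bits_xor3 as bs cs"
  "bits_xor3 (False # as) (True # bs) (False # cs) = True # bits_xor3 as bs cs"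
  "bits_xor3 (False # as) (True # bs) (True # cs) = False # bits_xor3 as bs cs"
  "bits_xor3 (True # as) (False # bs) (False # cs) = True # bits_xor3 as bs cs"
  "bits_xor3 (True # as) (False # bs) (True # cs) = False # bits_xor3 as bs cs"
  "bits_xor3 (True # as) (True # bs) (False # cs) = False # bits_xor3 as bs cs"
  "bits_xor3 (True # as) (True # bs) (True # cs) = True # bits_xor3 as bs cs"
  "bits_xor3 [] bs cs = []"
  by simp_all

lemma bits_ch_code [code]:
  "bits_ch (False # as) (b # bs) (c # cs) = c # bits_ch as bs cs"
  "bits_ch (True # as) (b # bs) (c # cs) = b # bits_ch as bs cs"
  "bits_ch [] bs cs = []"
  by simp_all

lemma bits_maj_code [code]:
  "bits_maj (a # as) (False # bs) (False # cs) = False # bits_maj as bs cs"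
  "bits_maj (a # as) (False # bs) (True # cs) = a # bits_maj as bs cs"
  "bits_maj (a # as) (True # bs) (False # cs) = a # bits_maj as bs cs"
  "bits_maj (a # as) (True # bs) (True # cs) = True # bits_maj as bs cs"
  "bits_maj [] bs cs = []"
  by simp_all

lemma bits_add_code [code]:
  "bits_add False (False # as) (False # bs) = False # bits_add False as bs"
  "bits_add False (False # as) (True # bs) = True # bits_add False as bs"
  "bits_add False (True # as) (False # bs) = True # bits_add False as bs"
  "bits_add False (True # as) (True # bs) = False # bits_add True as bs"
  "bits_add True (False # as) (False # bs) = True # bits_add False as bs"
  "bits_add True (False # as) (True # bs) = False # bits_add True as bs"
  "bits_add True (True # as) (False # bs) = False # bits_add True as bs"
  "bits_add True (True # as) (True # bs) = True # bits_add True as bs"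
  "bits_add c [] bs = []"
  by simp_all

definition bits_Sigma0 :: "bool list \<Rightarrow> bool list" where
  "bits_Sigma0 bs = bits_xor3 (rotate 2 bs) (rotate 13 bs) (rotate 22 bs)"

definition bits_Sigma1 :: "bool list \<Rightarrow> bool list" where
  "bits_Sigma1 bs = bits_xor3 (rotate 6 bs) (rotate 11 bs) (rotate 25 bs)"

definition bits_sigma0 :: "bool list \<Rightarrow> bool list" where
  "bits_sigma0 bs = bits_xor3 (rotate 7 bs) (rotate 18 bs) (drop 3 bs @ replicate 3 False)"

definition bits_sigma1 :: "bool list \<Rightarrow> bool list" where
  "bits_sigma1 bs = bits_xor3 (rotate 17 bs) (rotate 19 bs) (drop 10 bs @ replicate 10 False)"

text \<open>The rotations of a list of 32 bits are written out, so that this function and its three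
  companions rearrange the bits in a single rewrite step.\<close>

lemma bits_Sigma0_code [code]:
  "bits_Sigma0 [b0, b1, b2, b3, b4, b5, b6, b7, b8, b9, b10, b11, b12, b13, b14, b15, b16, b17, b18, b19, b20,
     b21, b22, b23, b24, b25, b26, b27, b28, b29, b30, b31] =
     bits_xor3
       [b2, b3, b4, b5, b6, b7, b8, b9, b10, b11, b12, b13, b14, b15, b16, b17, b18, b19, b20, b21,
       b22, b23, b24, b25, b26, b27, b28, b29, b30, b31, b0, b1]
       [b13, b14, b15, b16, b17, b18, b19, b20, b21, b22, b23, b24, b25, b26, b27, b28, b29, b30,
       b31, b0, b1, b2, b3, b4, b5, b6, b7, b8, b9, b10, b11, b12]
       [b22, b23, b24, b25, b26, b27, b28, b29, b30, b31, b0, b1, b2, b3, b4, b5, b6, b7, b8, b9,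
       b10, b11, b12, b13, b14, b15, b16, b17, b18, b19, b20, b21]"
  by (simp add: bits_Sigma0_def rotate_def rotate1_def numeral_eq_Suc)

lemma bits_Sigma1_code [code]:
  "bits_Sigma1 [b0, b1, b2, b3, b4, b5, b6, b7, b8, b9, b10, b11, b12, b13, b14, b15, b16, b17, b18, b19, b20,
     b21, b22, b23, b24, b25, b26, b27, b28, b29, b30, b31] =
     bits_xor3
       [b6, b7, b8, b9, b10, b11, b12, b13, b14, b15, b16, b17, b18, b19, b20, b21, b22, b23, b24,
       b25, b26, b27, b28, b29, b30, b31, b0, b1, b2, b3, b4, b5]
       [b11, b12, b13, b14, b15, b16, b17, b18, b19, b20, b21, b22, b23, b24, b25, b26, b27, b28,
       b29, b30, b31, b0, b1, b2, b3, b4, b5, b6, b7, b8, b9, b10]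
       [b25, b26, b27, b28, b29, b30, b31, b0, b1, b2, b3, b4, b5, b6, b7, b8, b9, b10, b11, b12,
       b13, b14, b15, b16, b17, b18, b19, b20, b21, b22, b23, b24]"
  by (simp add: bits_Sigma1_def rotate_def rotate1_def numeral_eq_Suc)

lemma bits_sigma0_code [code]:
  "bits_sigma0 [b0, b1, b2, b3, b4, b5, b6, b7, b8, b9, b10, b11, b12, b13, b14, b15, b16, b17, b18, b19, b20,
     b21, b22, b23, b24, b25, b26, b27, b28, b29, b30, b31] =
     bits_xor3
       [b7, b8, b9, b10, b11, b12, b13, b14, b15, b16, b17, b18, b19, b20, b21, b22, b23, b24, b25,
       b26, b27, b28, b29, b30, b31, b0, b1, b2, b3, b4, b5, b6]
       [b18, b19, b20, b21, b22, b23, b24, b25, b26, b27, b28, b29, b30, b31, b0, b1, b2, b3, b4,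
       b5, b6, b7, b8, b9, b10, b11, b12, b13, b14, b15, b16, b17]
       [b3, b4, b5, b6, b7, b8, b9, b10, b11, b12, b13, b14, b15, b16, b17, b18, b19, b20, b21, b22,
       b23, b24, b25, b26, b27, b28, b29, b30, b31, False, False, False]"
  by (simp add: bits_sigma0_def rotate_def rotate1_def numeral_eq_Suc)

lemma bits_sigma1_code [code]:
  "bits_sigma1 [b0, b1, b2, b3, b4, b5, b6, b7, b8, b9, b10, b11, b12, b13, b14, b15, b16, b17, b18, b19, b20,
     b21, b22, b23, b24, b25, b26, b27, b28, b29, b30, b31] =
     bits_xor3
       [b17, b18, b19, b20, b21, b22, b23, b24, b25, b26, b27, b28, b29, b30, b31, b0, b1, b2, b3,
       b4, b5, b6, b7, b8, b9, b10, b11, b12, b13, b14, b15, b16]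
       [b19, b20, b21, b22, b23, b24, b25, b26, b27, b28, b29, b30, b31, b0, b1, b2, b3, b4, b5, b6,
       b7, b8, b9, b10, b11, b12, b13, b14, b15, b16, b17, b18]
       [b10, b11, b12, b13, b14, b15, b16, b17, b18, b19, b20, b21, b22, b23, b24, b25, b26, b27,
       b28, b29, b30, b31, False, False, False, False, False, False, False, False, False, False]"
  by (simp add: bits_sigma1_def rotate_def rotate1_def numeral_eq_Suc)

lemma length_bits_ops:
  "length (bits_xor3 as bs cs) = min (length as) (min (length bs) (length cs))"
  "length (bits_ch as bs cs) = min (length as) (min (length bs) (length cs))"
  "length (bits_maj as bs cs) = min (length as) (min (length bs) (length cs))"
  "length (bits_add c as bs) = min (length as) (length bs)"
     apply (induction as bs cs rule: bits_xor3.induct; simp)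
    apply (induction as bs cs rule: bits_ch.induct; simp)
   apply (induction as bs cs rule: bits_maj.induct; simp)
  apply (induction c as bs rule: bits_add.induct; simp)
  done

lemma length_bits_ops_eq [simp]:
  "length as = n \<Longrightarrow> length bs = n \<Longrightarrow> length cs = n \<Longrightarrow> length (bits_xor3 as bs cs) = n"
  "length as = n \<Longrightarrow> length bs = n \<Longrightarrow> length cs = n \<Longrightarrow> length (bits_ch as bs cs) = n"
  "length as = n \<Longrightarrow> length bs = n \<Longrightarrow> length cs = n \<Longrightarrow> length (bits_maj as bs cs) = n"
  "length as = n \<Longrightarrow> length bs = n \<Longrightarrow> length (bits_add c as bs) = n"
  by (simp_all add: length_bits_ops)

lemma nth_bits_ops:
  "n < length as \<Longrightarrow> n < length bs \<Longrightarrow> n < length cs \<Longrightarrow>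
     bits_xor3 as bs cs ! n \<longleftrightarrow> as ! n = (bs ! n = cs ! n)"
  "n < length as \<Longrightarrow> n < length bs \<Longrightarrow> n < length cs \<Longrightarrow>
     bits_ch as bs cs ! n \<longleftrightarrow> (if as ! n then bs ! n else cs ! n)"
  "n < length as \<Longrightarrow> n < length bs \<Longrightarrow> n < length cs \<Longrightarrow>
     bits_maj as bs cs ! n \<longleftrightarrow> (if bs ! n = cs ! n then bs ! n else as ! n)"
    apply (induction as bs cs arbitrary: n rule: bits_xor3.induct; simp add: nth_Cons split: nat.splits)
   apply (induction as bs cs arbitrary: n rule: bits_ch.induct; simp add: nth_Cons split: nat.splits)
  apply (induction as bs cs arbitrary: n rule: bits_maj.induct; simp add: nth_Cons split: nat.splits)
  done

lemma bits_word_rotate: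
  assumes "length bs = 32" "n < 32"
  shows "bits_word (rotate n bs) = word_rotr n (bits_word bs)"
  using assms by (intro bit_eqI) (auto simp: bit_bits_word bit_word_rotr_iff nth_rotate add.commute)

lemma bits_word_drop_bit:
  assumes "length bs = 32"
  shows "bits_word (drop n bs @ replicate n False) = drop_bit n (bits_word bs)"
  using assms by (intro bit_eqI) (auto simp: bit_bits_word bit_drop_bit_eq nth_append)

lemma bits_word_xor3:
  assumes "length as = 32" "length bs = 32" "length cs = 32"
  shows "bits_word (bits_xor3 as bs cs) = bits_word as XOR bits_word bs XOR bits_word cs"
  using assms by (intro bit_eqI) (auto simp: bit_bits_word bit_xor_iff nth_bits_ops)

lemma bits_word_ch:
  assumes "length as = 32" "length bs = 32" "length cs = 32"
  shows "bits_word (bits_ch as bs cs) = sha_ch (bits_word as) (bits_word bs) (bits_word cs)"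
  using assms unfolding sha_ch_def
  by (intro bit_eqI) (auto simp: bit_bits_word bit_xor_iff bit_and_iff bit_not_iff nth_bits_ops)

lemma bits_word_maj:
  assumes "length as = 32" "length bs = 32" "length cs = 32"
  shows "bits_word (bits_maj as bs cs) = sha_maj (bits_word as) (bits_word bs) (bits_word cs)"
  using assms unfolding sha_maj_def
  by (intro bit_eqI) (auto simp: bit_bits_word bit_xor_iff bit_and_iff nth_bits_ops)

text \<open>The lost carry \<open>d\<close> is part of the statement so that the induction goes
  through; at length 32 its weight is 0 modulo \<open>2 ^ 32\<close>.\<close>

lemma bits_word_add_carry:
  "length as = length bs \<Longrightarrow>
   \<exists>d. bits_word as + bits_word bs + of_bool c =
     bits_word (bits_add c as bs) + 2 ^ length as * of_bool d"
proof (induction c as bs rule: bits_add.induct)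
  case (1 c a as b bs)
  then obtain d where d: "bits_word as + bits_word bs + of_bool (if a = b then a else c) =
     bits_word (bits_add (if a = b then a else c) as bs) + 2 ^ length as * of_bool d" by auto
  have "bits_word (a # as) + bits_word (b # bs) + of_bool c =
    of_bool (c = (a = b)) + 2 * (bits_word as + bits_word bs + of_bool (if a = b then a else c))"
    by (cases a; cases b; cases c) (simp_all add: algebra_simps)
  then show ?case unfolding d by (intro exI[of _ d]) (simp add: algebra_simps)
qed auto

lemma bits_word_add:
  assumes "length as = 32" "length bs = 32"
  shows "bits_word (bits_add False as bs) = bits_word as + bits_word bs"
proof -
  have "(2 :: word32) ^ 32 = 0"
    using word_pow_0[where 'a=32] by simp
  then show ?thesis using bits_word_add_carry[of as bs False] assms by auto
qed

lemma bits_word_Sigma: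
  assumes "length bs = 32"
  shows "bits_word (bits_Sigma0 bs) = sha_Sigma0 (bits_word bs)"
    "bits_word (bits_Sigma1 bs) = sha_Sigma1 (bits_word bs)"
    "bits_word (bits_sigma0 bs) = sha_sigma0 (bits_word bs)"
    "bits_word (bits_sigma1 bs) = sha_sigma1 (bits_word bs)"
  using assms
  by (simp_all add: bits_Sigma0_def bits_Sigma1_def bits_sigma0_def bits_sigma1_def
      sha_Sigma0_def sha_Sigma1_def sha_sigma0_def sha_sigma1_def
      bits_word_xor3 bits_word_rotate bits_word_drop_bit)

lemma length_bits_Sigma [simp]:
  "length bs = 32 \<Longrightarrow> length (bits_Sigma0 bs) = 32"
  "length bs = 32 \<Longrightarrow> length (bits_Sigma1 bs) = 32"
  "length bs = 32 \<Longrightarrow> length (bits_sigma0 bs) = 32"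
  "length bs = 32 \<Longrightarrow> length (bits_sigma1 bs) = 32"
  by (simp_all add: bits_Sigma0_def bits_Sigma1_def bits_sigma0_def bits_sigma1_def)

type_synonym bits_state = "bool list \<times> bool list \<times> bool list \<times> bool list \<times>
  bool list \<times> bool list \<times> bool list \<times> bool list"

definition word_bits :: "word32 \<Rightarrow> bool list" where
  "word_bits w = map (bit w) [0..<32]"

lemma word_bits [simp]: "bits_word (word_bits w) = w" "length (word_bits w) = 32"
  by (auto intro!: bit_eqI simp: word_bits_def bit_bits_word)

fun state_map :: "('a \<Rightarrow> 'b) \<Rightarrow> 'a \<times> 'a \<times> 'a \<times> 'a \<times> 'a \<times> 'a \<times> 'a \<times> 'a \<Rightarrow>
  'b \<times> 'b \<times> 'b \<times> 'b \<times> 'b \<times> 'b \<times> 'b \<times> 'b" where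
  "state_map m (a, b, c, d, e, f, g, h) = (m a, m b, m c, m d, m e, m f, m g, m h)"

fun bits_state32 :: "bits_state \<Rightarrow> bool" where
  "bits_state32 (a, b, c, d, e, f, g, h) \<longleftrightarrow>
     (\<forall>x\<in>{a, b, c, d, e, f, g, h}. length x = 32)"

text \<open>The auxiliary sums are passed as arguments so that the simplifier evaluates them once.\<close>

fun bits_shift :: "bool list \<Rightarrow> bool list \<Rightarrow> bits_state \<Rightarrow> bits_state" where
  "bits_shift s t (a, b, c, d, e, f, g, h) =
     (bits_add False s t, a, b, c, bits_add False d s, e, f, g)"

fun bits_round :: "bool list \<Rightarrow> bool list \<Rightarrow> bits_state \<Rightarrow> bits_state" where
  "bits_round k w (a, b, c, d, e, f, g, h) =
     bits_shift
       (bits_add False (bits_add False (bits_add False (bits_add False h (bits_Sigma1 e))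
          (bits_ch e f g)) k) w)
       (bits_add False (bits_Sigma0 a) (bits_maj a b c))
       (a, b, c, d, e, f, g, h)"

lemma bits_round:
  assumes "length k = 32" "length w = 32" "bits_state32 s"
  shows "state_map bits_word (bits_round k w s) =
      sha_round (bits_word k, bits_word w) (state_map bits_word s)"
    and "bits_state32 (bits_round k w s)"
  using assms
  by (induction s rule: bits_state32.induct;
      simp add: bits_word_add bits_word_Sigma bits_word_ch bits_word_maj Let_def)+

section \<open>The message schedule as a sliding window of sixteen words\<close>

definition sha_next :: "word32 list \<Rightarrow> word32 list" where
  "sha_next W = tl W @ [sha_sigma1 (W ! 14) + W ! 9 + sha_sigma0 (W ! 1) + W ! 0]"

definition bits_next :: "bool list list \<Rightarrow> bool list list" where
  "bits_next W = tl W @ [bits_add False (bits_add False (bits_add False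
     (bits_sigma1 (W ! 14)) (W ! 9)) (bits_sigma0 (W ! 1))) (W ! 0)]"

lemma bits_next_code [code]:
  "bits_next [w0, w1, w2, w3, w4, w5, w6, w7, w8, w9, w10, w11, w12, w13, w14, w15] =
     [w1, w2, w3, w4, w5, w6, w7, w8, w9, w10, w11, w12, w13, w14, w15,
      bits_add False (bits_add False (bits_add False (bits_sigma1 w14) w9) (bits_sigma0 w1)) w0]"
  by (simp add: bits_next_def)

lemma bits_next:
  assumes "length W = 16" "\<forall>w\<in>set W. length w = 32"
  shows "map bits_word (bits_next W) = sha_next (map bits_word W)"
    and "length (bits_next W) = 16" and "\<forall>w\<in>set (bits_next W). length w = 32"
proof -
  have "length (W ! i) = 32" if "i < 16" for i using assms that by simp
  then show "map bits_word (bits_next W) = sha_next (map bits_word W)"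
    and "length (bits_next W) = 16" and "\<forall>w\<in>set (bits_next W). length w = 32"
    using assms by (auto simp: bits_next_def sha_next_def map_tl bits_word_add bits_word_Sigma
        dest: list.set_sel(2)[rotated])
qed

lemma length_sha_next_funpow: "length W = 16 \<Longrightarrow> length ((sha_next ^^ n) W) = 16"
  by (induction n) (auto simp: sha_next_def)

text \<open>The first \<open>16 - n\<close> entries of the \<open>n\<close>-th window are untouched
  message words.\<close>

lemma hd_sha_next_funpow:
  assumes "length W = 16" "n < 16"
  shows "hd ((sha_next ^^ n) W) = W ! n"
proof -
  have "n \<le> 16 \<Longrightarrow> take (16 - n) ((sha_next ^^ n) W) = drop n W" for n
  proof (induction n)
    case (Suc n)
    let ?V = "(sha_next ^^ n) W"
    have "take (16 - Suc n) (sha_next ?V) = tl (take (16 - n) ?V)"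
      using Suc.prems length_sha_next_funpow[OF assms(1), of n]
      by (cases ?V) (auto simp: sha_next_def take_Cons' split: nat.splits)
    with Suc show ?case by (simp add: tl_drop drop_Suc)
  qed (use assms in simp)
  from this[of n] assms have "hd (take (16 - n) ((sha_next ^^ n) W)) = hd (drop n W)"
    by simp
  with assms show ?thesis by (simp add: hd_drop_conv_nth)
qed

lemma sha_next_funpow_unfold:
  assumes "length W = m" "m = 16"
  shows "map (\<lambda>t. hd ((sha_next ^^ t) W)) [0..<n] @ (sha_next ^^ n) W =
    map (\<lambda>t. hd ((sha_next ^^ t) W)) [0..<n + m]"
proof -
  have V: "length ((sha_next ^^ n) W) = 16"
    using assms length_sha_next_funpow by blast
  have "(sha_next ^^ n) W = map (\<lambda>t. hd ((sha_next ^^ (t + n)) W)) [0..<m]"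
    using assms(2) V by (intro nth_equalityI) (simp_all add: funpow_add hd_sha_next_funpow)
  also have "\<dots> = map (\<lambda>t. hd ((sha_next ^^ t) W)) (map (\<lambda>t. t + n) [0..<m])"
    by simp
  also have "map (\<lambda>t. t + n) [0..<m] = [n..<n + m]"
    by (simp add: map_add_upt add.commute)
  finally show ?thesis
    using upt_add_eq_append[of 0 n m] by simp
qed

text \<open>After \<open>n\<close> extension steps the growing list consists of the heads of the
  first \<open>n\<close> windows followed by the current window, so the schedule is the sequence of
  heads and can be produced round by round.\<close>

lemma sha_schedule_eq:
  assumes "length W = 16"
  shows "sha_schedule W = map (\<lambda>t. hd ((sha_next ^^ t) W)) [0..<64]"
proof -
  let ?f = "\<lambda>t W. W @ [sha_sigma1 (W ! (t - 2)) + W ! (t - 7) + sha_sigma0 (W ! (t - 15)) + W ! (t - 16)]"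
  have *: "fold ?f [16..<16 + n] W = map (\<lambda>t. hd ((sha_next ^^ t) W)) [0..<n] @ (sha_next ^^ n) W" for n
  proof (induction n)
    case (Suc n)
    let ?V = "(sha_next ^^ n) W"
    have V: "length ?V = 16" by (rule length_sha_next_funpow[OF assms])
    then have "?V \<noteq> []" by auto
    have 1: "(16 + n - i) = n + (16 - i)" if "i \<le> 16" for i using that by simp
    have "[16..<16 + Suc n] = [16..<16 + n] @ [16 + n]"
      by (simp only: add_Suc_right upt_Suc_append le_add1)
    then have "fold ?f [16..<16 + Suc n] W = ?f (16 + n) (fold ?f [16..<16 + n] W)"
      by (simp only: fold_append fold_simps comp_apply)
    also have "\<dots> = map (\<lambda>t. hd ((sha_next ^^ t) W)) [0..<n] @ (hd ?V # sha_next ?V)"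
      unfolding Suc using V \<open>?V \<noteq> []\<close>
      by (simp add: nth_append sha_next_def 1)
    finally show ?case by simp
  qed simp
  \<comment> \<open>There are 64 - 16 = 48 extension steps; the last window contributes the
    remaining 16 heads.\<close>
  show ?thesis
    using *[of 48] sha_next_funpow_unfold[OF assms refl, of 48]
    unfolding sha_schedule_def by (simp only: numeral_plus_numeral semiring_norm assms)
qed

fun bits_rounds :: "bool list list \<Rightarrow> bool list list \<Rightarrow> bits_state \<Rightarrow> bits_state" where
  "bits_rounds [] W s = s"
| "bits_rounds (k # ks) W s = bits_rounds ks (bits_next W) (bits_round k (hd W) s)"

lemma map_funpow_upt_Suc:
  "map (\<lambda>t. g ((f ^^ t) x)) [0..<Suc n] = g x # map (\<lambda>t. g ((f ^^ t) (f x))) [0..<n]"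
proof -
  have "[0..<Suc n] = 0 # map Suc [0..<n]"
    by (simp add: map_Suc_upt upt_conv_Cons)
  then show ?thesis by (simp add: o_def funpow_swap1 del: upt_Suc)
qed

lemma bits_rounds:
  assumes "length W = 16" "\<forall>w\<in>set W. length w = 32" "\<forall>k\<in>set ks. length k = 32" "bits_state32 s"
  shows "state_map bits_word (bits_rounds ks W s) =
      fold sha_round
        (zip (map bits_word ks) (map (\<lambda>t. hd ((sha_next ^^ t) (map bits_word W))) [0..<length ks]))
        (state_map bits_word s) \<and> bits_state32 (bits_rounds ks W s)"
  using assms
proof (induction ks arbitrary: W s)
  case Nil
  then show ?case by (simp del: bits_state32.simps)
next
  case (Cons k ks)
  have hd: "hd (map bits_word W) = bits_word (hd W)" "length (hd W) = 32"
    using Cons.prems(1,2) by (cases W; simp)+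
  note n = bits_next[OF Cons.prems(1,2)]
  have k: "length k = 32" "\<forall>k\<in>set ks. length k = 32" using Cons.prems(3) by auto
  note r = bits_round[of k "hd W" s, OF k(1) hd(2) Cons.prems(4)]
  note IH = Cons.IH[OF n(2,3) k(2) r(2)]
  show ?case
    using IH unfolding n(1) r(1)
    by (simp only: bits_rounds.simps list.map list.size add_Suc_right add_0_right
        map_funpow_upt_Suc zip_Cons_Cons fold_simps hd comp_apply simp_thms)
qed

lemma fst_sha_add: "fst (sha_add s t) = fst s + fst t"
  by (induction s t rule: sha_add.induct) simp

lemma fst_state_map: "fst (state_map m s) = m (fst s)"
  by (induction m s rule: state_map.induct) simp

lemma length_fst_bits_state32: "bits_state32 s \<Longrightarrow> length (fst s) = 32"
  by (induction s rule: bits_state32.induct) simp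

text \<open>All eight registers take part in the rounds, but only the first word of the digest is
  extracted: it decides every comparison in the two rankings.\<close>

lemma bits_compress:
  assumes "length W = 16" "\<forall>w\<in>set W. length w = 32"
  shows "fst (sha_compress (map bits_word W) sha_init) =
    bits_word (bits_add False (word_bits (fst sha_init))
      (fst (bits_rounds (map word_bits sha_K) W (state_map word_bits sha_init))))"
proof -
  let ?s = "state_map word_bits sha_init"
  have "state_map bits_word (state_map word_bits t) = t" "bits_state32 (state_map word_bits t)" for t
    by (induction word_bits t rule: state_map.induct; simp)+
  note s = this[of sha_init]
  have K: "map bits_word (map word_bits sha_K) = sha_K"
    by (simp add: o_def)
  have len: "length sha_K = 64"
    by (simp add: sha_K_def)
  have k: "\<forall>k\<in>set (map word_bits sha_K). length k = 32" by simp
  define r where "r = bits_rounds (map word_bits sha_K) W ?s"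
  have r: "state_map bits_word r = fold sha_round (zip sha_K (sha_schedule (map bits_word W))) sha_init"
    "bits_state32 r"
    using bits_rounds[OF assms k s(2)] assms(1) unfolding s(1) K r_def
    by (simp_all add: sha_schedule_eq len del: bits_state32.simps)
  have "fst (sha_compress (map bits_word W) sha_init) = fst sha_init + bits_word (fst r)"
    unfolding sha_compress_def r(1)[symmetric] fst_sha_add fst_state_map ..
  then show ?thesis
    using length_fst_bits_state32[OF r(2)] unfolding r_def[symmetric]
    by (simp add: bits_word_add)
qed

section \<open>Messages that fit into one block\<close>

fun char_bits :: "char \<Rightarrow> bool list" where
  "char_bits (Char b0 b1 b2 b3 b4 b5 b6 b7) = [b0, b1, b2, b3, b4, b5, b6, b7]"

text \<open>Bytes of a word are big-endian in the message while bits are listed from the least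
  significant one; hence the last character of each group of four comes first.\<close>

fun string_words :: "string \<Rightarrow> bool list list" where
  "string_words (a # b # c # d # cs) =
     (char_bits d @ char_bits c @ char_bits b @ char_bits a) # string_words cs"
| "string_words _ = []"

lemma length_char_bits [simp]: "length (char_bits c) = 8"
  by (cases c) simp

lemma bits_word_char_bits: "bits_word (char_bits c) = word_of_nat (of_char c)"
  by (cases c) (simp add: bits_word_def of_char_def)

lemma bits_word_append: "bits_word (xs @ ys) = bits_word xs + 2 ^ length xs * bits_word ys"
  by (induction xs) (simp_all add: algebra_simps)

lemma string_words:
  "map bits_word (string_words s) = sha_words (map of_char s)"
  "length (string_words s) = length s div 4"
  "\<forall>w\<in>set (string_words s). length w = 32"
  by (induction s rule: string_words.induct)
    (simp_all add: bits_word_append bits_word_char_bits algebra_simps)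

text \<open>Padding for at most 55 characters. The 64-bit length field starts with six zero bytes,
  since the bit length is at most 440; together with the \<open>55 - length s\<close> fill bytes
  they are the \<open>61 - length s\<close> zeros.\<close>

definition pad_string :: "string \<Rightarrow> string" where
  "pad_string s = s @ [CHR 0x80] @ replicate (61 - length s) (CHR 0x00) @
     [char_of (8 * length s div 256), char_of (8 * length s mod 256)]"

definition pad_tail :: "nat \<Rightarrow> string" where
  "pad_tail n = CHR 0x80 # replicate (61 - n) (CHR 0x00) @
     [char_of (8 * n div 256), char_of (8 * n mod 256)]"

text \<open>The four tabulated cases are the lengths that control messages with index 0 or 50 can
  have.\<close>

lemma pad_tail_code [code]:
  "pad_tail n =
     (if n = 52 then 
        [CHR 0x80, CHR 0x00, CHR 0x00, CHR 0x00, CHR 0x00, CHR 0x00, CHR 0x00, CHR 0x00, CHR 0x00, CHR 0x00, CHR 0x01, CHR 0xA0]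
      else if n = 53 then 
        [CHR 0x80, CHR 0x00, CHR 0x00, CHR 0x00, CHR 0x00, CHR 0x00, CHR 0x00, CHR 0x00, CHR 0x00, CHR 0x01, CHR 0xA8]
      else if n = 54 then 
        [CHR 0x80, CHR 0x00, CHR 0x00, CHR 0x00, CHR 0x00, CHR 0x00, CHR 0x00, CHR 0x00, CHR 0x01, CHR 0xB0]
      else if n = 55 then 
        [CHR 0x80, CHR 0x00, CHR 0x00, CHR 0x00, CHR 0x00, CHR 0x00, CHR 0x00, CHR 0x01, CHR 0xB8]
      else CHR 0x80 # replicate (61 - n) (CHR 0x00) @ [char_of (8 * n div 256), char_of (8 * n mod 256)])"
proof -
  have "replicate 6 c = [c, c, c, c, c, c]" "replicate 7 c = [c, c, c, c, c, c, c]"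
    "replicate 8 c = [c, c, c, c, c, c, c, c]" "replicate 9 c = [c, c, c, c, c, c, c, c, c]" for c :: char
    by (simp_all add: numeral_eq_Suc)
  then show ?thesis by (simp add: pad_tail_def char_of_def bit_0)
qed

lemma pad_string_code [code]: "pad_string s = s @ pad_tail (length s)"
  by (simp add: pad_string_def pad_tail_def)

lemma sha_pad_string:
  assumes "length s \<le> 55"
  shows "sha_pad (map of_char s) = map of_char (pad_string s)" and "length (pad_string s) = 64"
proof -
  \<comment> \<open>119 is 64 + 55, which keeps the subtraction of natural numbers from being cut
    off at 0.\<close>
  have 1: "(119 - length s mod 64) mod 64 = 55 - length s"
  proof -
    have "119 - length s mod 64 = 64 + (55 - length s)" using assms by simp
    then show ?thesis using assms by (simp only: mod_add_self1 mod_less)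
  qed
  have 2: "61 - length s = (55 - length s) + 6" using assms by simp
  have 3: "8 * length s div 256 ^ n mod 256 = 0" if "2 \<le> n" for n
  proof -
    have "(256::nat) ^ 2 \<le> 256 ^ n" using that by (intro power_increasing) auto
    then show ?thesis using assms by simp
  qed
  have "map (\<lambda>i. 8 * length s div 256 ^ (7 - i) mod 256) [0..<6] = map (\<lambda>_. 0) [0..<6]"
    by (intro map_cong refl) (simp add: 3)
  moreover have "[0..<8] = [0..<6] @ [6, 7 :: nat]"
    by (simp add: upt_rec)
  ultimately have bytes: "map (\<lambda>i. 8 * length s div 256 ^ (7 - i) mod 256) [0..<8] =
     replicate 6 0 @ [8 * length s div 256, 8 * length s mod 256]"
    using assms by (simp add: map_replicate_const)
  then show "sha_pad (map of_char s) = map of_char (pad_string s)" 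
    unfolding sha_pad_def pad_string_def 2 replicate_add length_map 1 bytes
    using assms by simp
  show "length (pad_string s) = 64" using assms by (simp add: pad_string_def)
qed

lemma fst_sha256:
  assumes "length s \<le> 55"
  shows "fst (sha256 (map of_char s)) =
    bits_word (bits_add False (word_bits (fst sha_init))
      (fst (bits_rounds (map word_bits sha_K) (string_words (pad_string s)) (state_map word_bits sha_init))))"
proof -
  let ?W = "string_words (pad_string s)"
  have W: "length ?W = 16" using sha_pad_string(2)[OF assms] string_words(2)[of "pad_string s"] by simp
  have "sha256 (map of_char s) = sha_compress (map bits_word ?W) sha_init"
    unfolding sha256_def sha_pad_string(1)[OF assms] string_words(1)[symmetric]
    using W by (simp add: sha_blocks_def)
  then show ?thesis using bits_compress[OF W string_words(3)] by simp
qed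

section \<open>Comparing digests and ranking edges\<close>

fun bits_less :: "bool \<Rightarrow> bool list \<Rightarrow> bool list \<Rightarrow> bool" where
  "bits_less c (x # xs) (y # ys) = bits_less (if x = y then c else y) xs ys"
| "bits_less c _ _ = c"

lemma bits_less:
  assumes "length xs = length ys" "length ys \<le> 32"
  shows "bits_less False xs ys \<longleftrightarrow> bits_word xs < bits_word ys"
proof -
  let ?n = "\<lambda>xs. horner_sum of_bool 2 xs :: nat"
  have "bits_less c xs ys \<longleftrightarrow> ?n xs < ?n ys \<or> c \<and> ?n xs = ?n ys" for c
    using assms(1)
  proof (induction c xs ys rule: bits_less.induct)
    case (1 c x xs y ys)
    then have "bits_less c (x # xs) (y # ys) \<longleftrightarrow>
        ?n xs < ?n ys \<or> (if x = y then c else y) \<and> ?n xs = ?n ys"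
      by simp
    then show ?case by (cases x; cases y) auto
  qed simp_all
  moreover have "unat (bits_word zs) = ?n zs" if "length zs \<le> 32" for zs
  proof -
    have "?n zs < 2 ^ length zs"
      by (rule horner_sum_of_bool_2_less)
    also have "\<dots> \<le> 2 ^ 32"
      using that by (rule power_increasing) simp
    finally have "unat (word_of_nat (?n zs) :: word32) = ?n zs"
      by (simp add: unsigned_of_nat take_bit_nat_eq_self)
    moreover have "bits_word zs = word_of_nat (?n zs)"
      by (induction zs) simp_all
    ultimately show ?thesis by simp
  qed
  ultimately show ?thesis
    using assms by (simp add: word_less_nat_alt)
qed

lemma length_show_nat:
  assumes "n < 100"
  shows "length (show_nat n) \<le> 2"
proof (cases "n < 10")
  case False
  then have "n div 10 < 10" "n div 10 \<noteq> 0" using assms by auto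
  then show ?thesis using False by (simp add: show_nat.simps[of n] show_nat.simps[of "n div 10"])
qed (simp add: show_nat.simps[of n])

text \<open>The fixed part has 49 characters and each of the three numbers at most two digits, so
  the bound 55 for a single block is just met.\<close>

lemma length_control_message:
  assumes "k < 100" "fst e < 100" "snd e < 100"
  shows "length (control_message k e) \<le> 55"
  using assms[THEN length_show_nat]
  by (simp add: control_message_def json_string_def sigma226_def)

fun num_bits :: "nat \<Rightarrow> num \<Rightarrow> bool list" where
  "num_bits 0 n = []"
| "num_bits (Suc k) num.One = True # replicate k False"
| "num_bits (Suc k) (num.Bit0 n) = False # num_bits k n"
| "num_bits (Suc k) (num.Bit1 n) = True # num_bits k n"

text \<open>The binary representation of a numeral already is its list of bits, so the constants of
  the hash function are turned into explicit lists before any digest is evaluated.\<close>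

lemma word_bits_numeral: "word_bits (numeral n) = num_bits 32 n"
proof -
  have "map (bit (numeral n :: int)) [0..<k] = num_bits k n" for k
    by (induction k n rule: num_bits.induct)
      (simp_all add: upt_conv_Cons bit_0 bit_Suc map_replicate_trivial map_Suc_upt[symmetric] o_def del: upt_Suc)
  moreover have "word_bits (numeral n) = map (bit (numeral n :: int)) [0..<32]"
    unfolding word_bits_def by (intro map_cong refl) (simp only: bit_numeral_word_iff, simp)
  ultimately show ?thesis by simp
qed

lemma num_bits_numeral [simp]:
  "num_bits (numeral k) num.One = True # replicate (pred_numeral k) False"
  "num_bits (numeral k) (num.Bit0 n) = False # num_bits (pred_numeral k) n"
  "num_bits (numeral k) (num.Bit1 n) = True # num_bits (pred_numeral k) n"
  by (simp_all add: numeral_eq_Suc)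

definition sha_K_bits :: "bool list list" where
  "sha_K_bits = map word_bits sha_K"

lemmas sha_K_bits_code [code] =
  sha_K_bits_def[unfolded sha_K_def list.map word_bits_numeral, simplified]
definition sha_init_bits :: bits_state where
  "sha_init_bits = state_map word_bits sha_init"

lemmas sha_init_bits_code [code] =
  sha_init_bits_def[unfolded sha_init_def state_map.simps word_bits_numeral, simplified]

definition edge_bits :: "nat \<Rightarrow> nat \<times> nat \<Rightarrow> bool list" where
  "edge_bits k e = bits_add False (fst sha_init_bits)
     (fst (bits_rounds sha_K_bits (string_words (pad_string (control_message k e))) sha_init_bits))"

lemma edge_bits:
  assumes "k < 100" "fst e < 100" "snd e < 100"
  shows "fst (edge_digest k e) = bits_word (edge_bits k e)" "length (edge_bits k e) = 32"
proof -
  let ?s = "control_message k e"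
  have len: "length ?s \<le> 55"
    using assms(1-3) by (rule length_control_message)
  have W: "length (string_words (pad_string ?s)) = 16"
    using sha_pad_string(2)[OF len] by (simp add: string_words(2))
  have init: "bits_state32 (state_map word_bits sha_init)" "fst (state_map word_bits sha_init) = word_bits (fst sha_init)"
    by (simp_all add: sha_init_def fst_state_map)
  show "fst (edge_digest k e) = bits_word (edge_bits k e)"
    unfolding edge_bits_def sha_K_bits_def sha_init_bits_def edge_digest_def fst_sha256[OF len] init(2) ..
  show "length (edge_bits k e) = 32"
    using length_fst_bits_state32[OF conjunct2[OF bits_rounds[OF W string_words(3) _ init(1)]], of "map word_bits sha_K"]
    by (simp add: edge_bits_def sha_K_bits_def sha_init_bits_def init(2))
qed

text \<open>For an injective key a list has only one sorted arrangement, so it suffices to exhibit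
  it.\<close>

lemma sort_key_eqI:
  assumes "mset ys = mset xs" "distinct xs" "inj_on f (set xs)" "sorted (map f ys)"
  shows "sort_key f xs = ys"
proof -
  have "set ys = set xs" "distinct ys"
    using assms(1,2) mset_eq_setD mset_eq_imp_distinct_iff by blast+
  with assms have "map f (sort_key f xs) = map f ys"
    by (intro sorted_distinct_set_unique) (auto simp: distinct_map)
  moreover have "inj_on f (set (sort_key f xs) \<union> set ys)"
    using assms(3) \<open>set ys = set xs\<close> by simp
  ultimately show ?thesis by (rule map_inj_on)
qed

text \<open>Strict increase of the leading digest words between neighbours already decides every
  comparison of keys, so the claimed list is verified in place and nothing is sorted. The bound 100
  keeps all numbers at two digits.\<close>

lemma ranked_edges_eqI:
  assumes L: "distinct L" "set L = E" "\<forall>e\<in>set L. fst e < 100 \<and> snd e < 100" and k: "k < 100"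
    and *: "successively (bits_less False)
      (map (edge_bits k) L)"
  shows "ranked_edges k E = L"
proof -
  let ?f = "\<lambda>e. (edge_digest k e, e)"
  have "successively (\<lambda>x y. ?f x \<le> ?f y) L"
    using *[unfolded successively_map]
  proof (rule successively_mono)
    fix x y assume "x \<in> set L" "y \<in> set L" and
      less: "bits_less False (edge_bits k x)
        (edge_bits k y)"
    then have "fst (edge_digest k x) < fst (edge_digest k y)"
      using L(3) k by (simp add: edge_bits bits_less)
    then show "?f x \<le> ?f y" by (auto simp: less_eq_prod_def less_prod_def)
  qed
  then have "sorted (map ?f L)"
    unfolding sorted_map by (subst successively_iff_sorted_wrt_strong[symmetric]) (auto simp: transp_def)
  moreover have "mset L = mset (sorted_list_of_set E)"
    using L by (metis List.finite_set mset_set_set sorted_list_of_mset_set mset_sorted_list_of_multiset)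
  ultimately show ?thesis
    unfolding ranked_edges_def using L by (intro sort_key_eqI) (auto simp: inj_on_def)
qed

section \<open>Words, the behavioural quotient and certificates\<close>

lemma equiv_kernel: "equiv A {(u, v) \<in> A \<times> A. \<forall>C\<in>B. f C u = f C v}"
  by (auto intro!: equivI refl_onI symI transI)

locale block_system =
  fixes G :: "'v pair_pre_digraph" and \<P> :: "'v rel set"
  assumes finite_verts: "finite (pverts G)"
    and blocks: "C \<in> \<P> \<Longrightarrow> C \<subseteq> pverts G \<times> pverts G"
begin

declare quot.simps(2) [simp del]

lemma equiv_quot: "equiv (pverts G) (quot G \<P> t)"
proof (cases t)
  case (Suc n)
  show ?thesis unfolding Suc quot.simps(2) by (rule equiv_kernel)
qed (auto intro!: equivI refl_onI symI transI)

text \<open>If two sets of states meet the same finer classes, they meet the same coarser ones; so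
  once the classes of one level refine those of the previous level, the same holds one level
  further.\<close>

lemma quot_antimono: "quot G \<P> (Suc t) \<subseteq> quot G \<P> t"
proof (induction t)
  case (Suc t)
  let ?k = "\<lambda>t w. quot G \<P> t `` {w}"
  have refine: "?k t ` A = ?k t ` B" if "?k (Suc t) ` A = ?k (Suc t) ` B" "A \<subseteq> pverts G" "B \<subseteq> pverts G" for A B
  proof -
    have coarse: "?k t w = ?k t w'" if "?k (Suc t) w = ?k (Suc t) w'" "w \<in> pverts G" "w' \<in> pverts G" for w w'
    proof -
      have "(w, w') \<in> quot G \<P> (Suc t)"
        using eq_equiv_class[OF that(1) equiv_quot that(3)] .
      then show ?thesis using Suc.IH equiv_quot[of t] by (meson equiv_class_eq subsetD)
    qed
    have sub: "?k t ` A \<subseteq> ?k t ` B" if "?k (Suc t) ` A = ?k (Suc t) ` B" "A \<subseteq> pverts G" "B \<subseteq> pverts G" for A B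
    proof (rule image_subsetI)
      fix a assume a: "a \<in> A"
      then have "?k (Suc t) a \<in> ?k (Suc t) ` B" using that(1) by blast
      then obtain b where "b \<in> B" "?k (Suc t) a = ?k (Suc t) b" by blast
      moreover have "a \<in> pverts G" "b \<in> pverts G" using a \<open>b \<in> B\<close> that(2,3) by auto
      ultimately show "?k t a \<in> ?k t ` B"
        using coarse[of a b] by blast
    qed
    show ?thesis using sub[OF that] sub[OF that(1)[symmetric] that(3,2)] by simp
  qed
  have "C `` {u} \<subseteq> pverts G" if "C \<in> \<P>" for C u
    using blocks[OF that] by auto
  note img = this
  show ?case
  proof (rule subrelI)
    fix u v assume uv: "(u, v) \<in> quot G \<P> (Suc (Suc t))"
    then have V: "u \<in> pverts G" "v \<in> pverts G"
      by (auto simp: quot.simps(2)[of _ _ "Suc t"])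
    have "?k t ` (C `` {u}) = ?k t ` (C `` {v})" if "C \<in> \<P>" for C
      using uv that by (intro refine img) (auto simp only: quot.simps(2)[of _ _ "Suc t"])
    then show "(u, v) \<in> quot G \<P> (Suc t)"
      using V by (simp add: quot.simps(2)[of _ _ t])
  qed
qed (auto simp: quot.simps(2))

text \<open>A strictly decreasing chain of finite relations would run out of pairs, so a stable
  index exists. The stable relation is given as a successor level because only there the condition
  on blocks can be unfolded.\<close>

lemma stable_quot_unfold: "\<exists>t. stable_quot G \<P> = quot G \<P> (Suc t)"
proof -
  have "finite (quot G \<P> 0)" using finite_verts by simp
  then have fin: "finite (quot G \<P> t)" for t
    using quot_antimono by (induction t) (auto intro: finite_subset)
  have "\<exists>t. quot G \<P> (Suc t) = quot G \<P> t"
  proof (rule ccontr)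
    assume "\<not> ?thesis"
    then have less: "card (quot G \<P> (Suc t)) < card (quot G \<P> t)" for t
      using quot_antimono fin by (intro psubset_card_mono) blast+
    have "card (quot G \<P> t) + t \<le> card (quot G \<P> 0)" for t
    proof (induction t)
      case (Suc t)
      then show ?case using less[of t] by linarith
    qed simp
    from this[of "Suc (card (quot G \<P> 0))"] show False by linarith
  qed
  then have "quot G \<P> (Suc t) = quot G \<P> t" if "t = (LEAST t. quot G \<P> (Suc t) = quot G \<P> t)" for t
    unfolding that by (rule LeastI_ex)
  from this[OF refl] show ?thesis
    unfolding stable_quot_def by (intro exI) (rule sym)
qed

lemma equiv_stable_quot: "equiv (pverts G) (stable_quot G \<P>)"
  using stable_quot_unfold equiv_quot by auto

text \<open>Separates classes without computing the quotient: the empty set of classes differs from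
  a nonempty one at any level.\<close>

lemma kap_neqI:
  assumes "C \<in> \<P>" "u \<in> pverts G" "v \<in> pverts G" "C `` {u} = {}" "C `` {v} \<noteq> {}"
  shows "kap G \<P> u \<noteq> kap G \<P> v"
proof
  assume eq: "kap G \<P> u = kap G \<P> v"
  obtain t where t: "stable_quot G \<P> = quot G \<P> (Suc t)" using stable_quot_unfold by blast
  then have "(u, v) \<in> quot G \<P> (Suc t)"
    using eq eq_equiv_class[OF _ equiv_quot assms(3)] unfolding kap_def by simp
  then have "(\<lambda>w. quot G \<P> t `` {w}) ` (C `` {u}) = (\<lambda>w. quot G \<P> t `` {w}) ` (C `` {v})"
    using assms(1) by (simp add: quot.simps(2))
  then show False using assms(4,5) by simp
qed

lemma kap_self: "v \<in> pverts G \<Longrightarrow> v \<in> kap G \<P> v"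
  using equiv_stable_quot unfolding kap_def by (rule equiv_class_self)

lemma kap_eqI: "v \<in> kap G \<P> u \<Longrightarrow> kap G \<P> v = kap G \<P> u"
  using equiv_class_eq[OF equiv_stable_quot] unfolding kap_def by blast

lemma word_rel_subset: "w \<in> lists \<P> \<Longrightarrow> word_rel G w \<subseteq> pverts G \<times> pverts G"
  by (induction w) (use blocks in auto)

lemma word_rel_append:
  assumes "v \<in> lists \<P>" "w \<in> lists \<P>"
  shows "word_rel G (v @ w) = word_rel G v O word_rel G w"
  using assms(1)
proof (induction v)
  case Nil
  then show ?case using word_rel_subset[OF assms(2)] by auto
qed (auto simp: O_assoc)

lemma word_rel_single: "C \<in> \<P> \<Longrightarrow> word_rel G [C] = C"
  using blocks by auto

lemma relation_semigroup_base: "C \<in> \<P> \<Longrightarrow> C \<in> relation_semigroup G \<P>"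
  unfolding relation_semigroup_def nonempty_word_def
  by (intro CollectI exI[of _ "[C]"]) (simp del: word_rel.simps add: word_rel_single)

lemma relation_semigroup_step:
  assumes "T \<in> relation_semigroup G \<P>" "C \<in> \<P>"
  shows "T O C \<in> relation_semigroup G \<P>"
proof -
  obtain w where w: "T = word_rel G w" "w \<in> lists \<P>" "w \<noteq> []"
    using assms(1) unfolding relation_semigroup_def nonempty_word_def by blast
  then have "T O C = word_rel G (w @ [C])"
    using word_rel_append[of w "[C]"] assms(2) word_rel_single by simp
  then show ?thesis
    using w assms(2) unfolding relation_semigroup_def nonempty_word_def
    by (intro CollectI exI[of _ "w @ [C]"]) auto
qed

text \<open>Words are extended at the right end, so closure under right multiplication by single
  blocks is enough.\<close>

lemma relation_semigroup_least:
  assumes "\<P> \<subseteq> X" "\<And>T C. T \<in> X \<Longrightarrow> C \<in> \<P> \<Longrightarrow> T O C \<in> X"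
  shows "relation_semigroup G \<P> \<subseteq> X"
proof -
  have "w \<in> lists \<P> \<Longrightarrow> w \<noteq> [] \<Longrightarrow> word_rel G w \<in> X" for w
  proof (induction w rule: rev_induct)
    case (snoc C w)
    then have C: "C \<in> \<P>" "w \<in> lists \<P>" by auto
    show ?case
    proof (cases "w = []")
      case True
      then show ?thesis using C assms(1) word_rel_single[of C] by auto
    next
      case False
      then have "word_rel G (w @ [C]) = word_rel G w O C"
        using word_rel_append[OF C(2), of "[C]"] C(1) word_rel_single[of C] by simp
      then show ?thesis using snoc.IH C False assms(2) by simp
    qed
  qed simp
  then show ?thesis unfolding relation_semigroup_def nonempty_word_def by blast
qed

text \<open>A persistent pair orbit is eventually periodic; along one period, a power of the word
  fixes two distinct states.\<close>

lemma persistent_fixed_pair: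
  assumes z: "nonempty_word \<P> z"
    and orbit: "\<And>n. \<exists>a b. pair_iter (word_rel G z) x n = Some (a, b) \<and> a \<noteq> b"
  shows "\<exists>T\<in>relation_semigroup G \<P>. \<exists>a b. a \<noteq> b \<and> T `` {a} = {a} \<and> T `` {b} = {b}"
proof -
  let ?T = "word_rel G z"
  obtain a b where ab: "pair_iter ?T x n = Some (a n, b n)" "a n \<noteq> b n" for n
    using orbit by metis
  have step: "?T `` {a n} = {a (Suc n)}" "?T `` {b n} = {b (Suc n)}" for n
    using ab(1)[of n] ab(1)[of "Suc n"] by (auto split: if_splits simp: is_singleton_the_elem)
  have zl: "z \<in> lists \<P>" "z \<noteq> []" using z by (auto simp: nonempty_word_def)
  \<comment> \<open>The orbit is shifted by one step since its start is arbitrary, whereas images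
    under \<open>?T\<close> are vertices.\<close>
  have "(a (Suc n), b (Suc n)) \<in> pverts G \<times> pverts G" for n
    using step[of n] word_rel_subset[OF zl(1)] by blast
  then have "range (\<lambda>n. (a (Suc n), b (Suc n))) \<subseteq> pverts G \<times> pverts G" by auto
  then have "finite (range (\<lambda>n. (a (Suc n), b (Suc n))))"
    using finite_verts by (meson finite_SigmaI finite_subset)
  then have "\<not> inj (\<lambda>n. (a (Suc n), b (Suc n)))"
    using finite_imageD infinite_UNIV_nat by blast
  then obtain m n where "m \<noteq> n" "a (Suc m) = a (Suc n)" "b (Suc m) = b (Suc n)"
    unfolding inj_def by blast
  then obtain m k where mk: "a (m + Suc k) = a m" "b (m + Suc k) = b m"
  proof (induction m n rule: linorder_wlog)
    case (le m n)
    then have "n = m + Suc (n - m - 1)" by simp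
    then show ?case using le by (metis add_Suc)
  next
    case (sym m n)
    then show ?case by metis
  qed
  have pow: "word_rel G (concat (replicate (Suc k) z)) `` {c m} = {c (m + Suc k)}"
    if "\<And>n. ?T `` {c n} = {c (Suc n)}" for c :: "nat \<Rightarrow> 'v" and m k
  proof (induction k arbitrary: m)
    case 0
    then show ?case using that by simp
  next
    case (Suc k)
    have "concat (replicate (Suc k) z) \<in> lists \<P>" using zl(1) by (induction k) auto
    then have "word_rel G (concat (replicate (Suc (Suc k)) z)) = ?T O word_rel G (concat (replicate (Suc k) z))"
      using word_rel_append[OF zl(1)] by simp
    then show ?case using that[of m] Suc[of "Suc m"] by (simp add: relcomp_Image)
  qed
  let ?w = "concat (replicate (Suc k) z)"
  have "?w \<in> lists \<P>" "?w \<noteq> []" using zl by (induction k) auto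
  then have "word_rel G ?w \<in> relation_semigroup G \<P>"
    unfolding relation_semigroup_def nonempty_word_def by blast
  moreover have "word_rel G ?w `` {a m} = {a m}" "word_rel G ?w `` {b m} = {b m}"
    using pow[of a, OF step(1), of k m] pow[of b, OF step(2), of k m] mk by simp_all
  ultimately show ?thesis using ab(2)[of m] by blast
qed

text \<open>Entries in different classes are different states, so the persistence condition alone
  provides the orbit needed for \<open>persistent_fixed_pair\<close>.\<close>

lemma no_wpu_certificate:
  assumes "\<And>T a b. T \<in> relation_semigroup G \<P> \<Longrightarrow> T `` {a} = {a} \<Longrightarrow> T `` {b} = {b} \<Longrightarrow> a = b"
  shows "\<not> wpu_certificate G \<P> c"
proof
  assume "wpu_certificate G \<P> c"
  then have "persistent G \<P> c" by (simp add: wpu_certificate_def)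
  then have "nonempty_word \<P> (c_z c)"
    "\<exists>a b. pair_iter (word_rel G (c_z c)) (c_p c, c_q c) n = Some (a, b) \<and> a \<noteq> b" for n
    unfolding persistent_def Let_def by (simp, metis)
  from persistent_fixed_pair[OF this] assms show False by blast
qed

end

text \<open>Record systems are nonempty families of certificates; without certificates only the
  empty family of systems remains, and it violates \<open>E1\<close>.\<close>

lemma H_eq_0:
  assumes "\<And>c. \<not> wpu_certificate G \<P> c"
  shows "H G \<P> = 0"
proof -
  have "\<not> record_system G \<P> X K" for X K
    using assms unfolding record_system_def by blast
  then have "\<not> E1 F" if "\<forall>X\<in>F. record_system G \<P> X {pr X 0, pr X 1}" for F and pr :: "'a rsystem \<Rightarrow> nat \<Rightarrow> 'a set"
    using that by (auto simp: E1_def)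
  then show ?thesis unfolding H_def by auto
qed

section \<open>A swapped pair of states yields the property H\<close>

context block_system
begin

context
  fixes a b :: 'v and z :: "'v rel list"
  assumes ab: "a \<in> pverts G" "b \<in> pverts G" "kap G \<P> a \<noteq> kap G \<P> b"
    and z: "nonempty_word \<P> z"
      "word_rel G z `` {a} = {b}" "word_rel G z `` {b} = {a}"
begin

text \<open>The empty offload word makes the forked states themselves the pair
  \<open>(p, q)\<close>, and the exchanging word serves both as orbit word and as use word.\<close>

abbreviation swap_certificate :: "'v \<Rightarrow> 'v rel \<Rightarrow> 'v rel \<Rightarrow> 'v \<Rightarrow> 'v \<Rightarrow> 'v certificate" where
  "swap_certificate s A B l r \<equiv>
     \<lparr>c_s = s, c_A = A, c_B = B, c_l = l, c_r = r, c_o = [], c_p = l, c_q = r, c_z = z, c_u = z\<rparr>"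

lemma swap_pair_iter:
  assumes "word_rel G z `` {l} = {l'}" "word_rel G z `` {r} = {r'}" "(l', r') \<in> {(a, b), (b, a)}"
  shows "pair_iter (word_rel G z) (l, r) n =
    Some (if n = 0 then (l, r) else if odd n then (l', r') else (r', l'))"
  by (induction n) (use assms z in auto)

text \<open>The pair may lie on the 2-cycle or enter it after one step. The last hypothesis serves
  the use condition: the class of \<open>l\<close> is replaced by a different one, so
  \<open>z\<close> does not merely reproduce the class pair.\<close>

lemma swap_wpu_certificate:
  assumes "s \<in> pverts G" "l \<in> pverts G" "r \<in> pverts G" "A \<in> \<P>" "B \<in> \<P>" "(s, l) \<in> A" "(s, r) \<in> B"
    and "\<forall>C\<in>{A, B}. C `` {l} \<noteq> {} \<longleftrightarrow> C `` {r} \<noteq> {}"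
    and "kap G \<P> l \<noteq> kap G \<P> r"
    and w: "word_rel G z `` {l} = {l'}" "word_rel G z `` {r} = {r'}" "(l', r') \<in> {(a, b), (b, a)}"
    and "kap G \<P> l' \<noteq> kap G \<P> l"
  shows "wpu_certificate G \<P> (swap_certificate s A B l r)"
proof -
  have "a \<noteq> b" using ab by auto
  have id: "word_rel G z \<noteq> Id_on (pverts G)"
  proof
    assume "word_rel G z = Id_on (pverts G)"
    then show False using z(2) ab(1) \<open>a \<noteq> b\<close> by auto
  qed
  note iter = swap_pair_iter[OF w]
  have "pair_iter (word_rel G z) (l, r) (Suc 1) \<noteq> pair_iter (word_rel G z) (l, r) 1"
    unfolding iter using w(3) \<open>a \<noteq> b\<close> by auto
  moreover have "\<exists>u v. pair_iter (word_rel G z) (l, r) n = Some (u, v) \<and> kap G \<P> u \<noteq> kap G \<P> v" for n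
    unfolding iter using w(3) ab(3) assms(9) by auto
  ultimately have "persistent G \<P> (swap_certificate s A B l r)"
    unfolding persistent_def Let_def certificate.simps using z(1) id by blast
  moreover have "usable G \<P> (swap_certificate s A B l r)"
    unfolding usable_def beta_def using z(1) id w assms(13) ab(3) by auto
  moreover have "offload G \<P> (swap_certificate s A B l r)"
    using assms by (auto simp: offload_def)
  moreover have "fork G \<P> (swap_certificate s A B l r)"
    using assms by (auto simp: fork_def)
  ultimately show ?thesis by (simp add: wpu_certificate_def)
qed

lemma swap_op_support:
  assumes "word_rel G z `` {l} = {l'}" "word_rel G z `` {r} = {r'}" "(l', r') \<in> {(a, b), (b, a)}"
  shows "op_support G (swap_certificate s A B l r) = {l, r, a, b}"
proof -
  note o = pair_orbit_def[of G "swap_certificate s A B l r", simplified, unfolded swap_pair_iter[OF assms]]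
  have "{l, r, a, b} \<subseteq> op_support G (swap_certificate s A B l r)"
    unfolding op_support_def o using assms(3)
    by (auto intro: exI[of _ 0] exI[of _ 1])
  moreover have "op_support G (swap_certificate s A B l r) \<subseteq> {l, r, a, b}"
    unfolding op_support_def o using assms(3) by auto
  ultimately show ?thesis by blast
qed

lemma eventual_period_alternating:
  fixes f :: "nat \<Rightarrow> 'c"
  assumes "\<And>n. f n = (if even n then x else y)" "x \<noteq> y"
  shows "eventual_period f = 2" "preperiod f = 0"
proof -
  show p: "eventual_period f = 2"
    unfolding eventual_period_def
  proof (rule Least_equality)
    show "0 < (2::nat) \<and> (\<exists>N. \<forall>i\<ge>N. f (i + 2) = f i)" using assms(1) by simp
  next
    fix m assume "0 < m \<and> (\<exists>N. \<forall>i\<ge>N. f (i + m) = f i)"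
    then obtain N where "0 < m" "f (N + m) = f N" by auto
    then have "even (N + m) \<longleftrightarrow> even N" using assms by (auto split: if_splits)
    then show "2 \<le> m" using \<open>0 < m\<close> by (cases "m = 1") auto
  qed
  show "preperiod f = 0"
    unfolding preperiod_def p using assms(1) by (intro Least_equality) auto
qed

text \<open>\<open>X\<close> and its mirror image \<open>X'\<close> share support and class pair and
  differ in orientation; both are present because translations and \<open>E4\<close> require
  distinct systems. Between them \<open>z\<close> translates both ways, and it sends the alternating
  orbit of period 2 to states of alternating classes. \<open>Y\<close> starts from
  \<open>(a, e)\<close>, which \<open>z\<close> sends to \<open>(b, a)\<close>; its support
  \<open>{a, b, e}\<close> strictly contains \<open>{a, b}\<close> and gives
  \<open>E3\<close>.\<close>

lemma H_swap:
  assumes s: "s \<in> pverts G" "A \<in> \<P>" "B \<in> \<P>" "(s, a) \<in> A" "(s, b) \<in> B"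
      "\<forall>C\<in>{A, B}. C `` {a} \<noteq> {} \<longleftrightarrow> C `` {b} \<noteq> {}"
    and e: "e \<in> pverts G" "e \<noteq> b" "kap G \<P> a \<noteq> kap G \<P> e" "word_rel G z `` {e} = {a}"
    and s': "s' \<in> pverts G" "A' \<in> \<P>" "B' \<in> \<P>" "(s', a) \<in> A'" "(s', e) \<in> B'"
      "\<forall>C\<in>{A', B'}. C `` {a} \<noteq> {} \<longleftrightarrow> C `` {e} \<noteq> {}"
  shows "H G \<P> = 1"
proof -
  let ?k = "kap G \<P>"
  define X where "X = {swap_certificate s A B a b}"
  define X' where "X' = {swap_certificate s B A b a}"
  define Y where "Y = {swap_certificate s' A' B' a e}"
  \<comment> \<open>In all three systems the class of \<open>a\<close> is presented first, also for
    \<open>X'\<close>, whose certificate has \<open>p = b\<close>. Hence between \<open>X\<close>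
    and \<open>X'\<close> the word \<open>z\<close> acts by the transposition, of odd gain, and
    \<open>z @ z\<close> by the identity.\<close>
  define pr where "pr S i = (if i = 0 then ?k a else if S = Y then ?k e else ?k b)" for S and i :: nat
  have ne: "a \<noteq> b" "a \<noteq> e" using ab e by auto
  have XY: "X \<noteq> X'" "X \<noteq> Y" "X' \<noteq> Y"
    using ne e(2) by (auto simp: X_def X'_def Y_def)
  have supp: "sys_support G X = {a, b}" "sys_support G X' = {a, b}" "sys_support G Y = {a, b, e}"
    unfolding sys_support_def X_def X'_def Y_def
    using swap_op_support[OF z(2,3)] swap_op_support[OF z(3,2)] swap_op_support[OF z(2) e(4)] by auto
  have notin: "b \<notin> ?k a" "a \<notin> ?k b"
    using kap_eqI ab(3) by metis+
  have rep: "representatives G S (?k a) = {a}" "representatives G S (?k b) = {b}" if "S \<in> {X, X'}" for S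
    using that supp notin kap_self ab by (auto simp: representatives_def)
  have certX: "wpu_certificate G \<P> (swap_certificate s A B a b)"
    using s ab z by (intro swap_wpu_certificate[where l' = b and r' = a]) auto
  have certX': "wpu_certificate G \<P> (swap_certificate s B A b a)"
    using s ab z by (intro swap_wpu_certificate[where l' = a and r' = b]) auto
  have certY: "wpu_certificate G \<P> (swap_certificate s' A' B' a e)"
    using s' e ab z by (intro swap_wpu_certificate[where l' = b and r' = a]) auto
  have rs: "record_system G \<P> S {pr S 0, pr S 1}" if "S \<in> {X, X', Y}" for S
  proof -
    have "record_system G \<P> X {?k a, ?k b}" "record_system G \<P> X' {?k a, ?k b}"
      using rep certX certX' by (auto simp: record_system_def class_pair_def X_def X'_def)
    moreover have "representatives G Y (?k a) \<noteq> {}" "representatives G Y (?k e) \<noteq> {}"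
      using supp kap_self ab e by (auto simp: representatives_def)
    then have "record_system G \<P> Y {?k a, ?k e}"
      using certY by (auto simp: record_system_def class_pair_def Y_def)
    ultimately show ?thesis using that XY by (auto simp: pr_def)
  qed
  have zz: "nonempty_word \<P> (z @ z)" "word_rel G (z @ z) `` {a} = {a}" "word_rel G (z @ z) `` {b} = {b}"
    using z word_rel_append[of z z] by (auto simp: nonempty_word_def relcomp_Image)
  have swap: "translation G \<P> pr S z (transpose 0 1) S'" if "S \<in> {X, X'}" "S' \<in> {X, X'}" "S \<noteq> S'" for S S'
    unfolding translation_def
    using that z rep[OF that(1)] supp XY by (auto simp: pr_def permutes_swap_id)
  have keep: "translation G \<P> pr X' (z @ z) id X"
    unfolding translation_def
    using zz rep[of X'] supp XY by (auto simp: pr_def permutes_id)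
  let ?F = "{X, X', Y}"
  have "E1 ?F" using XY by (simp add: E1_def)
  moreover have "E2 G \<P> pr ?F"
    unfolding E2_def using swap[of X X'] swap[of X' X] XY by blast
  moreover have "E3 G ?F"
  proof -
    have "{a, b} \<subset> {a, b, e}" using ne e(2) by auto
    then show ?thesis
      unfolding E3_def strictly_nested_def by (intro bexI[of _ X] bexI[of _ Y]) (simp_all add: supp)
  qed
  moreover have "E4 G \<P> pr ?F"
  proof -
    let ?c = "swap_certificate s A B a b"
    have "pair_orbit G ?c n = (if even n then (a, b) else (b, a))" for n
      unfolding pair_orbit_def using swap_pair_iter[OF z(2,3)] by auto
    note orbit = this eventual_period_alternating[OF this]
    have lt2: "h < 2 \<longleftrightarrow> h = 0 \<or> h = 1" for h :: nat by auto
    have "\<forall>h<2. word_rel G z `` {fst (pair_orbit G ?c (0 + h))} = {if h = 0 then b else a} \<and>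
        (if h = 0 then b else a) \<in> sys_support G X' \<and> ?k (if h = 0 then b else a) \<in> {pr X' 0, pr X' 1}"
      unfolding lt2 orbit(1) using z supp XY by (auto simp: pr_def)
    moreover have "\<exists>h<2. \<exists>h'<2. ?k (if h = (0 :: nat) then b else a) \<noteq> ?k (if h' = (0 :: nat) then b else a)"
      using ab(3) by (intro exI[of _ 0] exI[of _ 1] conjI) auto
    ultimately show ?thesis
      unfolding E4_def Let_def using XY(1) z(1) ne(1)
      by (intro bexI[of _ X] bexI[of _ X'] conjI bexI[of _ ?c] bexI[of _ fst] exI[of _ z]
          exI[of _ "\<lambda>h. if h = 0 then b else a"]) (auto simp: orbit X_def)
  qed
  moreover have "E5 G \<P> pr ?F"
    unfolding E5_def
  proof (intro exI conjI)
    show "pre_digraph.awalk (translation_graph G \<P> pr ?F) X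
        [(X, z, transpose 0 1, X'), (X', z @ z, id, X)] X"
      using swap[of X X'] keep XY
      by (simp add: pre_digraph.awalk_def pre_digraph.cas.simps translation_graph_def)
    show "sum_list (map arc_gain [(X, z, transpose 0 1, X'), (X', z @ z, id, X)]) = 1"
      by (simp add: gain_def evenperm_swap evenperm_id)
  qed
  ultimately have "\<exists>F pr. finite F \<and> (\<forall>X\<in>F. record_system G \<P> X {pr X 0, pr X 1}) \<and>
     E1 F \<and> E2 G \<P> pr F \<and> E3 G F \<and> E4 G \<P> pr F \<and> E5 G \<P> pr F"
    using rs by (intro exI[of _ ?F] exI[of _ pr]) auto
  then show ?thesis unfolding H_def by simp
qed

end

end

section \<open>The relation semigroup of the control partition 50\<close>

text \<open>The intended form lists the domain in ascending order, each state with the ascending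
  list of its images, without empty rows. Equal relations are then equal lists, so membership tests
  are literal comparisons.\<close>

type_synonym rows = "(nat \<times> nat list) list"

definition rows_rel :: "rows \<Rightarrow> nat rel" where
  "rows_rel e = {(v, w). \<exists>R. (v, R) \<in> set e \<and> w \<in> set R}"

fun merge :: "nat list \<Rightarrow> nat list \<Rightarrow> nat list" where
  "merge [] ys = ys"
| "merge (x # xs) [] = x # xs"
| "merge (x # xs) (y # ys) =
     (if x = y then x # merge xs ys else if x < y then x # merge xs (y # ys) else y # merge (x # xs) ys)"

lemma set_merge [simp]: "set (merge xs ys) = set xs \<union> set ys"
  by (induction xs ys rule: merge.induct) auto

fun row_image :: "rows \<Rightarrow> nat list \<Rightarrow> nat list" where
  "row_image [] R = []"
| "row_image ((v, S) # g) R = (if List.member R v then merge S (row_image g R) else row_image g R)"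

lemma set_row_image: "set (row_image g R) = rows_rel g `` set R"
  by (induction g R rule: row_image.induct) (auto simp: rows_rel_def)

definition rows_comp :: "rows \<Rightarrow> rows \<Rightarrow> rows" where
  "rows_comp e g = filter (\<lambda>(v, R). R \<noteq> []) (map (\<lambda>(v, R). (v, row_image g R)) e)"

lemma rows_rel_comp: "rows_rel (rows_comp e g) = rows_rel e O rows_rel g"
proof -
  have "R \<noteq> []" if "w \<in> set R" for w :: nat and R using that by auto
  then have "rows_rel (rows_comp e g) = {(v, w). \<exists>R. (v, R) \<in> set e \<and> w \<in> set (row_image g R)}"
    by (force simp: rows_rel_def rows_comp_def)
  then show ?thesis unfolding set_row_image by (auto simp: rows_rel_def)
qed

definition to_rows :: "(nat \<times> nat) list \<Rightarrow> rows" where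
  "to_rows B = map (\<lambda>v. (v, filter (\<lambda>w. List.member B (v, w)) [0..<20]))
     (filter (\<lambda>v. List.member (map fst B) v) [0..<20])"

lemma rows_rel_to_rows: "set B \<subseteq> {..<20} \<times> {..<20} \<Longrightarrow> rows_rel (to_rows B) = set B"
  by (force simp: rows_rel_def to_rows_def)

definition constant_rows :: "rows \<Rightarrow> bool" where
  "constant_rows e \<longleftrightarrow> list_all (\<lambda>(v, R). R = snd (hd e)) e"

definition strict_ascending :: "nat list \<Rightarrow> bool" where
  "strict_ascending xs \<longleftrightarrow> xs \<noteq> [] \<and> successively (<) xs"

definition known_rows :: "nat list list \<Rightarrow> nat list list \<Rightarrow> rows list \<Rightarrow> rows \<Rightarrow> bool" where
  "known_rows Ds Rs es e \<longleftrightarrow> e = [] \<or>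
     constant_rows e \<and> List.member Ds (map fst e) \<and> List.member Rs (snd (hd e)) \<or> List.member es e"

definition canonical_rows :: "rows \<Rightarrow> bool" where
  "canonical_rows e \<longleftrightarrow> strict_ascending (map fst e) \<and> list_all (\<lambda>(v, R). strict_ascending R) e"

text \<open>The first three lines test closure: generators are known, ranges are mapped to known
  ranges or to nothing, and products of exceptional relations with generators are known. Rectangles
  need only the second test. The next two lines ensure that every relation is counted once, and the
  last bounds by one the number of states fixed as singletons.\<close>

definition semigroup_check :: "rows list \<Rightarrow> nat list list \<Rightarrow> nat list list \<Rightarrow> rows list \<Rightarrow> bool" where
  "semigroup_check gs Ds Rs es \<longleftrightarrow>
     list_all (known_rows Ds Rs es) gs \<and>
     list_all (\<lambda>g. list_all (\<lambda>R. row_image g R = [] \<or> List.member Rs (row_image g R)) Rs) gs \<and>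
     list_all (\<lambda>g. list_all (\<lambda>e. known_rows Ds Rs es (rows_comp e g)) es) gs \<and>
     distinct Ds \<and> list_all strict_ascending Ds \<and> distinct Rs \<and> list_all strict_ascending Rs \<and>
     distinct es \<and> list_all canonical_rows es \<and> list_all (\<lambda>e. \<not> constant_rows e) es \<and>
     list_all (\<lambda>e. length (filter (\<lambda>(v, R). R = [v]) e) \<le> 1) es"

text \<open>The empty word gets the empty relation as a default value; the words used below are
  nonempty.\<close>

fun word_rows :: "rows list \<Rightarrow> nat list \<Rightarrow> rows" where
  "word_rows gs [] = []"
| "word_rows gs (i # w) = foldl (\<lambda>e j. rows_comp e (gs ! j)) (gs ! i) w"

definition word_image :: "rows list \<Rightarrow> nat list \<Rightarrow> nat list" where
  "word_image gs w = foldl (\<lambda>R j. row_image (gs ! j) R) [0] w"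

text \<open>Blocks and the edges in them stand in the order of their digests, so that the
  concatenation is the ranked edge list.\<close>

definition blocks50 :: "(nat \<times> nat) list list" where
  "blocks50 =
     [[(1, 3), (0, 12), (18, 12), (12, 0), (3, 1), (6, 1), (12, 18), (8, 0), (1, 0), (1, 2),
      (16, 0), (7, 4), (5, 4), (12, 15), (0, 1), (14, 4), (0, 9), (4, 7), (15, 12), (18, 0), (0, 4),
      (4, 0), (4, 5)],
      [(10, 1), (17, 1), (14, 12)],
      [(8, 4), (1, 6), (13, 1)],
      [(2, 0), (4, 19), (16, 12)],
      [(9, 0), (4, 11)],
      [(12, 14), (17, 12)],
      [(4, 8), (11, 4)],
      [(1, 17), (12, 16)],
      [(7, 0), (17, 0)],
      [(17, 16)],
      [(16, 17)],
      [(15, 9)],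
      [(13, 12)],
      [(1, 10)],
      [(18, 19)],
      [(2, 1)],
      [(17, 13)],
      [(19, 4)],
      [(3, 0)],
      [(19, 18)],
      [(12, 13)],
      [(19, 14)]]"

definition rows50 :: "rows list" where
  "rows50 = map to_rows blocks50"

text \<open>
  Words representing the relations of the semigroup that are not rectangles, words representing
  the rectangles with range \<open>{0}\<close>, and words carrying \<open>{0}\<close> to each range of a rectangle.
\<close>

definition exceptional_words :: "nat list list" where
  "exceptional_words =
     [[0], [1], [2], [3], [4], [5], [6], [7], [0, 0], [0, 3], [0, 4], [0, 7], [1, 0], [1, 7], [2,
     0], [3, 0], [5, 0], [6, 0], [0, 0, 0], [0, 0, 3], [1, 0, 0], [2, 0, 0], [3, 0, 0], [5, 0,
     0], [0, 0, 0, 0], [0, 0, 0, 3], [1, 0, 0, 0], [2, 0, 0, 0], [2, 0, 0, 3], [3, 0, 0, 0], [3,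
     0, 0, 3], [5, 0, 0, 0], [0, 0, 0, 0, 0], [0, 0, 0, 0, 3], [1, 0, 0, 0, 0], [1, 0, 0, 0, 3],
     [2, 0, 0, 0, 0], [2, 0, 0, 0, 3], [3, 0, 0, 0, 3], [5, 0, 0, 0, 0], [5, 0, 0, 0, 3], [0, 0,
     0, 0, 0, 3], [1, 0, 0, 0, 0, 3], [2, 0, 0, 0, 0, 0], [5, 0, 0, 0, 0, 0], [5, 0, 0, 0, 0, 3],
     [2, 0, 0, 0, 0, 0, 3]]"

definition domain_words :: "nat list list" where
  "domain_words =
     [[0, 0, 0, 0, 0, 0, 8], [0, 0, 0, 0, 0, 8], [0, 0, 0, 0, 8], [0, 0, 0, 8], [0, 0, 8], [0, 0,
     18], [0, 4, 0, 0, 3], [0, 7, 0], [0, 8], [0, 18], [1, 0, 0, 0, 8], [1, 0, 3], [1, 7, 0], [2,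
     0, 0, 0, 0, 0, 0, 8], [2, 0, 0, 0, 8], [2, 0, 3], [2, 0, 8], [3, 0, 0, 0, 0, 8], [4, 0, 0,
     3], [5, 0, 0, 0, 0, 8], [6, 0, 0, 0, 3], [6, 0, 8], [7, 0], [8], [9, 0], [10, 8], [11, 4],
     [14, 17, 0, 8], [15, 0, 3], [17, 0, 8], [18]]"

definition range_words :: "nat list list" where
  "range_words =
     [[], [0], [0, 0], [0, 0, 0], [0, 0, 0, 0], [0, 0, 0, 0, 3], [0, 0, 11], [0, 0, 15], [0, 0,
     15, 0], [0, 2], [0, 3], [0, 3, 17], [0, 3, 17, 0], [0, 3, 17, 4], [0, 3, 19], [0, 3, 19, 0],
     [0, 3, 19, 0, 0], [0, 4], [0, 5], [0, 5, 1], [0, 5, 1, 0], [0, 6], [0, 7], [0, 7, 9], [0, 7,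
     10], [0, 13], [0, 20]]"

definition domains50 :: "nat list list" where
  "domains50 = map (\<lambda>w. map fst (word_rows rows50 w)) domain_words"

definition ranges50 :: "nat list list" where
  "ranges50 = map (word_image rows50) range_words"

definition exceptional50 :: "rows list" where
  "exceptional50 = map (word_rows rows50) exceptional_words"

lemma semigroup_check50: "semigroup_check rows50 domains50 ranges50 exceptional50"
  by code_simp

text \<open>Facts for the lower bound on the semigroup: indices are in range, domain words give rows
  with the single image 0, and block 0 followed by block 1 is the empty relation.\<close>

lemma words_check50:
  "list_all (\<lambda>w. w \<noteq> [] \<and> list_all (\<lambda>i. i < 22) w) (exceptional_words @ domain_words)"
  "list_all (list_all (\<lambda>i. i < 22)) range_words"
  "list_all (\<lambda>w. list_all (\<lambda>(v, R). R = [0]) (word_rows rows50 w)) domain_words"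
  "word_rows rows50 [0, 1] = []"
  "length rows50 = 22"
  by code_simp+

section \<open>Relations in normal form\<close>

lemma strict_ascending_iff: "strict_ascending xs \<longleftrightarrow> xs \<noteq> [] \<and> sorted_wrt (<) xs"
  unfolding strict_ascending_def by (simp add: successively_iff_sorted_wrt_strong transp_def)

lemma strict_ascending_set_eq:
  "strict_ascending xs \<Longrightarrow> strict_ascending ys \<Longrightarrow> set xs = set ys \<Longrightarrow> xs = ys"
  using strict_sorted_equal unfolding strict_ascending_iff by blast

lemma rows_rel_eq_Times:
  assumes "\<And>v R'. (v, R') \<in> set e \<Longrightarrow> R' = R"
  shows "rows_rel e = set (map fst e) \<times> set R"
proof (intro equalityI subrelI)
  fix v w assume "(v, w) \<in> rows_rel e"
  then obtain R' where "(v, R') \<in> set e" "w \<in> set R'" by (auto simp: rows_rel_def)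
  moreover from this have "R' = R" using assms by blast
  ultimately show "(v, w) \<in> set (map fst e) \<times> set R" by force
next
  fix v w assume "(v, w) \<in> set (map fst e) \<times> set R"
  then obtain R' where "(v, R') \<in> set e" "w \<in> set R" by auto
  moreover from this have "R' = R" using assms by blast
  ultimately show "(v, w) \<in> rows_rel e" by (auto simp: rows_rel_def)
qed

lemma known_rows_rel:
  assumes "known_rows Ds Rs es e"
  shows "rows_rel e \<in> {{}} \<union> (\<lambda>(D, R). set D \<times> set R) ` (set Ds \<times> set Rs) \<union> rows_rel ` set es"
proof -
  consider "e = []" | "constant_rows e" "map fst e \<in> set Ds" "snd (hd e) \<in> set Rs" | "e \<in> set es"
    using assms by (auto simp: known_rows_def)
  then show ?thesis
  proof cases
    case 1
    then show ?thesis by (simp add: rows_rel_def)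
  next
    case 2
    then have "rows_rel e = set (map fst e) \<times> set (snd (hd e))"
      by (intro rows_rel_eq_Times) (auto simp: constant_rows_def list_all_iff)
    with 2 show ?thesis by blast
  next
    case 3
    then show ?thesis by simp
  qed
qed

lemma canonical_rows_Image:
  assumes "canonical_rows e" "(v, R) \<in> set e"
  shows "rows_rel e `` {v} = set R"
proof -
  have "distinct (map fst e)"
    using assms(1) by (simp add: canonical_rows_def strict_ascending_iff strict_sorted_iff)
  then have "R' = R" if "(v, R') \<in> set e" for R'
    using assms(2) that by (metis eq_key_imp_eq_value)
  then show ?thesis using assms(2) unfolding rows_rel_def by blast
qed

lemma canonical_rows_mem:
  "canonical_rows e \<Longrightarrow> (v, R) \<in> set e \<Longrightarrow> R \<noteq> [] \<and> strict_ascending R"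
  by (auto simp: canonical_rows_def list_all_iff strict_ascending_iff)

lemma canonical_rows_Domain:
  assumes "canonical_rows e"
  shows "Domain (rows_rel e) = set (map fst e)"
proof (intro equalityI subsetI)
  fix v assume "v \<in> set (map fst e)"
  then obtain R where R: "(v, R) \<in> set e" by auto
  then have "hd R \<in> set R" using canonical_rows_mem[OF assms R] by simp
  then show "v \<in> Domain (rows_rel e)" using R by (auto simp: rows_rel_def)
qed (force simp: rows_rel_def)

text \<open>The domain determines the first components and the image of each state its row; all
  these lists are strictly ascending, hence determined by their sets.\<close>

lemma canonical_rows_inj:
  assumes "canonical_rows e" "canonical_rows f" "rows_rel e = rows_rel f"
  shows "e = f"
proof -
  have fst: "map fst e = map fst f"
  proof (rule strict_ascending_set_eq)
    show "set (map fst e) = set (map fst f)"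
      using assms canonical_rows_Domain by metis
  qed (use assms in \<open>simp_all add: canonical_rows_def\<close>)
  have "e ! i = f ! i" if "i < length e" for i
  proof -
    have i: "i < length f" using that fst by (metis length_map)
    have "fst (e ! i) = fst (f ! i)"
      using arg_cong[OF fst, of "\<lambda>xs. xs ! i"] that i by simp
    moreover obtain v R where v: "e ! i = (v, R)" by fastforce
    ultimately obtain S where S: "f ! i = (v, S)" by (cases "f ! i") auto
    have mem: "(v, R) \<in> set e" "(v, S) \<in> set f"
      using nth_mem[OF that] nth_mem[OF i] v S by simp_all
    have "set R = set S"
      using canonical_rows_Image[OF assms(1) mem(1)] canonical_rows_Image[OF assms(2) mem(2)] assms(3)
      by simp
    then have "R = S"
      using canonical_rows_mem[OF assms(1) mem(1)] canonical_rows_mem[OF assms(2) mem(2)]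
        strict_ascending_set_eq by blast
    then show ?thesis using v S by simp
  qed
  moreover have "length e = length f" using fst by (metis length_map)
  ultimately show ?thesis by (rule nth_equalityI[rotated])
qed

text \<open>In a rectangle every state of the domain has the same image, hence all rows coincide.
  This keeps the exceptional relations apart from the rectangles in the count.\<close>

lemma nonconstant_rows_not_Times:
  assumes "canonical_rows e" "\<not> constant_rows e"
  shows "rows_rel e \<noteq> D \<times> R"
proof
  assume eq: "rows_rel e = D \<times> R"
  have range: "set S = R" if "(v, S) \<in> set e" for v S
  proof -
    have S: "rows_rel e `` {v} = set S" "S \<noteq> []"
      using canonical_rows_Image[OF assms(1) that] canonical_rows_mem[OF assms(1) that] by auto
    then have "hd S \<in> rows_rel e `` {v}" by simp
    then have "v \<in> D" unfolding eq by simp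
    then have "(D \<times> R) `` {v} = R" by auto
    then show ?thesis using S(1) unfolding eq by simp
  qed
  have "S = snd (hd e)" if S: "(v, S) \<in> set e" for v S
  proof -
    have "(fst (hd e), snd (hd e)) \<in> set e" using S by (cases e) auto
    then show ?thesis
      using S range canonical_rows_mem[OF assms(1)] strict_ascending_set_eq by blast
  qed
  then show False using assms(2) by (auto simp: constant_rows_def list_all_iff)
qed

text \<open>A state fixed as a singleton shows up as the row \<open>(c, [c])\<close>, and the filter
  finds at most one such row.\<close>

lemma canonical_rows_fixed:
  assumes "canonical_rows e" "length (filter (\<lambda>(v, R). R = [v]) e) \<le> 1"
    "rows_rel e `` {a} = {a}" "rows_rel e `` {b} = {b}"
  shows "a = b"
proof -
  let ?f = "filter (\<lambda>(v, R). R = [v]) e"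
  have *: "(c, [c]) \<in> set ?f" if c: "rows_rel e `` {c} = {c}" for c
  proof -
    obtain R where R: "(c, R) \<in> set e" using c by (auto simp: rows_rel_def)
    then have "set R = set [c]" "strict_ascending R"
      using canonical_rows_Image[OF assms(1) R] canonical_rows_mem[OF assms(1) R] c by auto
    then have "R = [c]" using strict_ascending_set_eq[of R "[c]"] by (simp add: strict_ascending_def)
    then show ?thesis using R by simp
  qed
  have "x = y" if "x \<in> set ?f" "y \<in> set ?f" for x y
    using that assms(2) by (cases ?f rule: list.exhaust) auto
  from this[OF *[OF assms(3)] *[OF assms(4)]] show ?thesis by simp
qed

section \<open>Closure, fixed states and number of the listed relations\<close>

context
  fixes gs Ds Rs es
  assumes check: "semigroup_check gs Ds Rs es"
begin

definition product_relations :: "nat rel set" where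
  "product_relations = (\<lambda>(D, R). set D \<times> set R) ` (set Ds \<times> set Rs)"

lemma check_facts:
  "\<forall>g\<in>set gs. known_rows Ds Rs es g"
  "\<forall>g\<in>set gs. \<forall>R\<in>set Rs. row_image g R = [] \<or> row_image g R \<in> set Rs"
  "\<forall>g\<in>set gs. \<forall>e\<in>set es. known_rows Ds Rs es (rows_comp e g)"
  "distinct Ds" "\<forall>D\<in>set Ds. strict_ascending D" "distinct Rs" "\<forall>R\<in>set Rs. strict_ascending R"
  "distinct es" "\<forall>e\<in>set es. canonical_rows e" "\<forall>e\<in>set es. \<not> constant_rows e"
  "\<forall>e\<in>set es. length (filter (\<lambda>(v, R). R = [v]) e) \<le> 1"
  using check unfolding semigroup_check_def list_all_iff List.member_iff by simp_all

abbreviation relations :: "nat rel set" where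
  "relations \<equiv> {{}} \<union> product_relations \<union> rows_rel ` set es"

text \<open>On a rectangle a generator acts on the range alone: the product is the same domain times
  the image of \<open>R\<close>, which is a listed range or empty.\<close>

lemma relations_comp:
  assumes "T \<in> relations" "g \<in> set gs"
  shows "T O rows_rel g \<in> relations"
proof -
  consider "T = {}" | D R where "T = set D \<times> set R" "D \<in> set Ds" "R \<in> set Rs"
    | e where "T = rows_rel e" "e \<in> set es"
    using assms(1) by (auto simp: product_relations_def)
  then show ?thesis
  proof cases
    case (2 D R)
    have "T O rows_rel g = set D \<times> set (row_image g R)"
      unfolding 2(1) set_row_image by auto
    moreover have "row_image g R = [] \<or> row_image g R \<in> set Rs"
      using check_facts(2) assms(2) 2 by blast
    ultimately show ?thesis using 2(2) by (auto simp: product_relations_def)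
  next
    case (3 e)
    have "rows_rel (rows_comp e g) \<in> relations"
      unfolding product_relations_def
      by (rule known_rows_rel) (use check_facts(3) assms(2) 3(2) in blast)
    then show ?thesis by (simp add: 3(1) rows_rel_comp)
  qed simp
qed

lemma relations_gens: "rows_rel ` set gs \<subseteq> relations"
  unfolding product_relations_def
  by (rule image_subsetI, rule known_rows_rel) (use check_facts(1) in blast)

text \<open>In a rectangle all states of the domain have the same image, so the singleton images
  \<open>{a}\<close> and \<open>{b}\<close> coincide; the exceptional relations are covered by the
  row count.\<close>

lemma relations_fixed:
  assumes "T \<in> relations" "T `` {a} = {a}" "T `` {b} = {b}"
  shows "a = b"
proof -
  consider "T = {}" | D R where "T = set D \<times> set R"
    | e where "T = rows_rel e" "e \<in> set es"
    using assms(1) by (auto simp: product_relations_def)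
  then show ?thesis
  proof cases
    case (2 D R)
    then show ?thesis using assms(2,3) by (auto split: if_splits)
  next
    case (3 e)
    then show ?thesis using canonical_rows_fixed check_facts(9,11) assms(2,3) by blast
  qed (use assms in auto)
qed

lemma card_relations: "card relations = 1 + length Ds * length Rs + length es"
proof -
  have inj: "inj_on (\<lambda>(D, R). set D \<times> set R) (set Ds \<times> set Rs)"
  proof (intro inj_onI, clarify)
    fix D R D' R' assume *: "D \<in> set Ds" "R \<in> set Rs" "D' \<in> set Ds" "R' \<in> set Rs"
      "set D \<times> set R = set D' \<times> set R'"
    then have sa: "strict_ascending D" "strict_ascending R" "strict_ascending D'" "strict_ascending R'"
      using check_facts by auto
    then have "set D \<noteq> {}" "set R \<noteq> {}" by (auto simp: strict_ascending_def)
    then have "set D = set D'" "set R = set R'" using *(5) by (auto simp: times_eq_iff)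
    then show "D = D' \<and> R = R'" using sa strict_ascending_set_eq by blast
  qed
  have c1: "card product_relations = length Ds * length Rs"
    unfolding product_relations_def card_image[OF inj] card_cartesian_product
    using check_facts(4,6) by (simp add: distinct_card)
  have c2: "card (rows_rel ` set es) = length es"
    using check_facts(8,9) canonical_rows_inj by (subst card_image) (auto simp: inj_on_def distinct_card)
  have d1: "{} \<notin> product_relations"
  proof -
    have "set D \<times> set R \<noteq> {}" if "D \<in> set Ds" "R \<in> set Rs" for D R
    proof -
      have "D \<noteq> []" "R \<noteq> []" using that check_facts(5,7) by (auto simp: strict_ascending_def)
      then show ?thesis by simp
    qed
    then show ?thesis unfolding product_relations_def by blast
  qed
  have d2: "T \<notin> rows_rel ` set es" if "T \<in> insert {} product_relations" for T
  proof
    assume "T \<in> rows_rel ` set es"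
    then obtain e where e: "e \<in> set es" "T = rows_rel e" by blast
    \<comment> \<open>The empty relation counts as a rectangle, so
      \<open>nonconstant_rows_not_Times\<close> excludes both kinds at once.\<close>
    have "T = {} \<times> {} \<or> (\<exists>D R. T = set D \<times> set R)"
      using that by (auto simp: product_relations_def)
    then show False
      using nonconstant_rows_not_Times[of e] check_facts(9,10) e by metis
  qed
  have "card relations = card (insert {} product_relations) + card (rows_rel ` set es)"
    using d2 by (subst card_Un_disjoint[symmetric]) (auto simp: product_relations_def)
  also have "card (insert {} product_relations) = Suc (length Ds * length Rs)"
    using d1 c1 by (simp add: product_relations_def)
  finally show ?thesis using c2 by simp
qed

end

lemma length_checks: "length domains50 = 31" "length ranges50 = 27" "length exceptional50 = 47"
  by (simp_all add: domains50_def ranges50_def exceptional50_def domain_words_def range_words_def exceptional_words_def)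

text \<open>Closure bounds the semigroup from above, and explicit words produce every listed
  relation. The count is \<open>1 + 31 * 27 + 47 = 885\<close>.\<close>

lemma semigroup_rows50:
  assumes "block_system G (rows_rel ` set rows50)"
  shows "card (relation_semigroup G (rows_rel ` set rows50)) = 885"
    and "\<not> wpu_certificate G (rows_rel ` set rows50) c"
proof -
  interpret block_system G "rows_rel ` set rows50" by fact
  let ?S = "relation_semigroup G (rows_rel ` set rows50)"
  let ?P = "product_relations domains50 ranges50"
  let ?X = "{{}} \<union> ?P \<union> rows_rel ` set exceptional50"
  have gen: "rows_rel (rows50 ! i) \<in> rows_rel ` set rows50" if "i < 22" for i
    using that words_check50(5) by simp
  have word: "rows_rel (word_rows rows50 w) \<in> ?S" if w: "w \<noteq> []" "\<forall>i\<in>set w. i < 22" for w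
  proof -
    obtain i v where v: "w = i # v" using w(1) by (cases w) auto
    have "\<forall>j\<in>set v. j < 22 \<Longrightarrow>
      rows_rel (foldl (\<lambda>e j. rows_comp e (rows50 ! j)) (rows50 ! i) v) \<in> ?S" for v
      using relation_semigroup_base relation_semigroup_step gen w(2) v
      by (induction v rule: rev_induct) (auto simp: rows_rel_comp)
    then show ?thesis using v w(2) by simp
  qed
  have image: "D \<times> set (word_image rows50 w) \<in> ?S" if "D \<times> {0} \<in> ?S" "\<forall>i\<in>set w. i < 22" for D w
    using that(2)
  proof (induction w rule: rev_induct)
    case Nil
    then show ?case using that(1) by (simp add: word_image_def)
  next
    case (snoc i w)
    let ?R = "word_image rows50 w"
    have "D \<times> set ?R O rows_rel (rows50 ! i) \<in> ?S"
      using snoc gen by (intro relation_semigroup_step) auto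
    moreover have "D \<times> set ?R O rows_rel (rows50 ! i) = D \<times> set (word_image rows50 (w @ [i]))"
      by (auto simp: word_image_def set_row_image)
    ultimately show ?case by simp
  qed
  have "{} \<in> ?S"
    using word[of "[0, 1]"] words_check50(4) by (simp add: rows_rel_def)
  moreover have "rows_rel ` set exceptional50 \<subseteq> ?S"
    using word words_check50(1) by (auto simp: exceptional50_def list_all_iff)
  moreover have "set D \<times> set R \<in> ?S" if D: "D \<in> set domains50" and R: "R \<in> set ranges50" for D R
  proof -
    obtain w where w: "w \<in> set domain_words" "D = map fst (word_rows rows50 w)"
      using D by (auto simp: domains50_def)
    then have "\<forall>(v, R)\<in>set (word_rows rows50 w). R = [0]"
      using words_check50(3) unfolding list_all_iff by blast
    then have "rows_rel (word_rows rows50 w) = set D \<times> {0}"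
      using rows_rel_eq_Times[of "word_rows rows50 w" "[0]"] w(2) by auto
    then have "set D \<times> {0} \<in> ?S"
      using word[of w] w(1) words_check50(1) by (auto simp: list_all_iff)
    moreover obtain v where "v \<in> set range_words" "R = word_image rows50 v"
      using R by (auto simp: ranges50_def)
    ultimately show ?thesis using image words_check50(2) by (auto simp: list_all_iff)
  qed
  then have "?P \<subseteq> ?S"
    unfolding product_relations_def[OF semigroup_check50] by auto
  moreover have "?S \<subseteq> ?X"
  proof (rule relation_semigroup_least)
    fix T C assume T: "T \<in> ?X" and "C \<in> rows_rel ` set rows50"
    then obtain g where "g \<in> set rows50" "C = rows_rel g" by blast
    then show "T O C \<in> ?X" using relations_comp[OF semigroup_check50 T] by simp
  qed (rule relations_gens[OF semigroup_check50])
  ultimately have S: "?S = ?X" by blast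
  show "card ?S = 885"
    unfolding S card_relations[OF semigroup_check50] by (simp add: length_checks)
  show "\<not> wpu_certificate G (rows_rel ` set rows50) c"
  proof (rule no_wpu_certificate)
    fix T a b assume "T \<in> ?S" and fixed: "T `` {a} = {a}" "T `` {b} = {b}"
    then have "T \<in> ?X" by (simp only: S)
    then show "a = b" using fixed by (rule relations_fixed[OF semigroup_check50])
  qed
qed

section \<open>Blocks of the partitions\<close>

lemma cut_concat: "cut (map length Bs) (concat Bs) = map set Bs"
  by (induction Bs) auto

text \<open>The head of a block occurs in no later block, since the concatenation is distinct; so no
  block is repeated and the multiplicities of sizes are preserved.\<close>

lemma profile_blocks:
  assumes "distinct (concat Bs)" "[] \<notin> set Bs"
  shows "profile (set (map set Bs)) = mset (map length Bs)"
proof -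
  have "distinct (map set Bs) \<and> mset (map card (map set Bs)) = mset (map length Bs)"
    using assms
  proof (induction Bs)
    case (Cons B Bs)
    have hd: "hd B \<in> set B" using Cons.prems(2) by (cases B) auto
    moreover have "set B \<inter> set (concat Bs) = {}" using Cons.prems(1) by simp
    ultimately have "hd B \<notin> set B'" if "B' \<in> set Bs" for B'
      using that by auto
    with hd have "set B \<notin> set ` set Bs" by blast
    then show ?case using Cons by (simp add: distinct_card)
  qed simp
  moreover from this have "mset_set (set (map set Bs)) = mset (map set Bs)"
    by (intro mset_set_set) blast
  ultimately show ?thesis
    unfolding profile_def by (simp only: mset_map)
qed

section \<open>Opposite pairs and their connected components\<close>

definition successors :: "(nat \<times> nat) list \<Rightarrow> nat \<Rightarrow> nat list" where
  "successors es x = map snd (filter (\<lambda>(u, v). u = x) es)"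

lemma set_successors: "set (successors es x) = {y. (x, y) \<in> set es}"
  by (force simp: successors_def)

text \<open>Only one of the two opposite pairs is recorded for each pattern; the other comes from
  the pattern with \<open>a\<close> and \<open>b\<close> exchanged.\<close>

definition diamond_pairs :: "(nat \<times> nat) list \<Rightarrow> ((nat \<times> nat) \<times> (nat \<times> nat)) list" where
  "diamond_pairs es = concat (map (\<lambda>(x, a). concat (map (\<lambda>b. map (\<lambda>y. ((x, a), (b, y)))
     (filter (\<lambda>y. distinct [x, a, b, y] \<and> List.member (successors es a) y) (successors es b)))
     (successors es x))) es)"

lemma set_diamond_pairs:
  "((x, a), (b, y)) \<in> set (diamond_pairs es) \<longleftrightarrow>
     distinct [x, a, b, y] \<and> {(x, a), (x, b), (a, y), (b, y)} \<subseteq> set es"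
  by (auto simp: diamond_pairs_def set_successors split_beta image_iff)

lemma Omega_adj_eq:
  assumes "parcs G = set es"
  shows "Omega_adj G = set (diamond_pairs es) \<union> (set (diamond_pairs es))\<inverse>"
proof -
  have d: "diamond_pattern G x a b y \<longleftrightarrow> ((x, a), (b, y)) \<in> set (diamond_pairs es)" for x a b y
    unfolding set_diamond_pairs diamond_pattern_def assms by simp
  have sym: "diamond_pattern G x a b y \<longleftrightarrow> diamond_pattern G x b a y" for x a b y
    unfolding diamond_pattern_def by auto
  have "(e, f) \<in> Omega_adj G \<longleftrightarrow>
      (\<exists>x a b y. diamond_pattern G x a b y \<and> (e = (x, a) \<and> f = (b, y) \<or> f = (x, a) \<and> e = (b, y)))" for e f
    unfolding Omega_adj_def opposite_pairs_def mem_Collect_eq case_prod_conv insert_iff empty_iff doubleton_eq_iff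
    using sym by blast
  then show ?thesis unfolding d by (auto; metis surj_pair)
qed

text \<open>A witness of connectedness: each element is related, in one direction or the other, to
  an earlier one.\<close>

fun chained :: "('a \<times> 'a) list \<Rightarrow> 'a list \<Rightarrow> 'a list \<Rightarrow> bool" where
  "chained D seen [] \<longleftrightarrow> True"
| "chained D seen (e # es) \<longleftrightarrow>
     list_ex (\<lambda>f. List.member D (f, e) \<or> List.member D (e, f)) seen \<and> chained D (e # seen) es"

lemma chained_reach:
  assumes "chained D seen es" "\<forall>f\<in>set seen. (r, f) \<in> (set D \<union> (set D)\<inverse>)\<^sup>*" "e \<in> set es"
  shows "(r, e) \<in> (set D \<union> (set D)\<inverse>)\<^sup>*"
  using assms
proof (induction D seen es rule: chained.induct)
  case (2 D seen d es)
  let ?R = "set D \<union> (set D)\<inverse>"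
  obtain f where "f \<in> set seen" "(f, d) \<in> ?R"
    using 2(2) by (auto simp: list_ex_iff)
  then have d: "(r, d) \<in> ?R\<^sup>*" using 2(3) by (meson rtrancl.rtrancl_into_rtrancl)
  show ?case
  proof (cases "e = d")
    case False
    then show ?thesis using 2 d by auto
  qed (use d in simp)
qed simp

definition component_check :: "('a \<times> 'a) list \<Rightarrow> 'a list list \<Rightarrow> bool" where
  "component_check D Bs \<longleftrightarrow>
     list_all (\<lambda>B. list_all (\<lambda>(e, f). List.member B e = List.member B f) D \<and> B \<noteq> [] \<and>
       chained D [hd B] (tl B)) Bs"

text \<open>No pair crosses the border of a block, so classes stay inside blocks; chaining from the
  head connects each block.\<close>

lemma quotient_components:
  assumes check: "component_check D Bs" and E: "E = set (concat Bs)"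
  shows "E // {(e, f) \<in> E \<times> E. (e, f) \<in> (set D \<union> (set D)\<inverse>)\<^sup>*} = set (map set Bs)"
proof -
  let ?R = "set D \<union> (set D)\<inverse>"
  let ?Q = "{(e, f) \<in> E \<times> E. (e, f) \<in> ?R\<^sup>*}"
  have sym: "(e, f) \<in> ?R\<^sup>* \<Longrightarrow> (f, e) \<in> ?R\<^sup>*" for e f
    by (rule symD[OF sym_rtrancl]) (auto intro: symI)
  have cls: "?Q `` {e} = set B" if "B \<in> set Bs" "e \<in> set B" for B e
  proof -
    have B: "\<forall>(e, f)\<in>set D. e \<in> set B \<longleftrightarrow> f \<in> set B" "B \<noteq> []" "chained D [hd B] (tl B)"
      using check that(1) by (auto simp: component_check_def list_all_iff)
    have hd: "(hd B, f) \<in> ?R\<^sup>*" if "f \<in> set B" for f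
      using chained_reach[OF B(3), of "hd B" f] that B(2) by (cases B) auto
    have "f \<in> set B" if "(e, f) \<in> ?R\<^sup>*" for f
      using that by induction (use B(1) \<open>e \<in> set B\<close> in auto)
    moreover have "(e, f) \<in> ?R\<^sup>*" if "f \<in> set B" for f
      using sym[OF hd[OF \<open>e \<in> set B\<close>]] hd[OF that] by (rule rtrancl_trans)
    moreover have "set B \<subseteq> E" using that(1) E by auto
    ultimately show ?thesis using that(2) by auto
  qed
  have ne: "hd B \<in> set B" if "B \<in> set Bs" for B
    using check that by (auto simp: component_check_def list_all_iff)
  show ?thesis
  proof (intro equalityI subsetI)
    fix Z assume "Z \<in> E // ?Q"
    then obtain e where e: "e \<in> E" "Z = ?Q `` {e}" by (rule quotientE)
    then obtain B where "B \<in> set Bs" "e \<in> set B" using E by auto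
    then show "Z \<in> set (map set Bs)" using cls e(2) by auto
  next
    fix Z assume "Z \<in> set (map set Bs)"
    then obtain B where B: "B \<in> set Bs" "Z = set B" by auto
    then have Z: "Z = ?Q `` {hd B}" using cls ne by blast
    have "hd B \<in> E" using B(1) ne E by auto
    then show "Z \<in> E // ?Q" unfolding Z by (rule quotientI)
  qed
qed

section \<open>The concrete partitions and their evaluation\<close>

definition together :: "'a \<Rightarrow> 'a \<Rightarrow> 'a set set \<Rightarrow> bool" where
  "together e f \<P> \<longleftrightarrow> (\<exists>B\<in>\<P>. e \<in> B \<and> f \<in> B)"

lemma together_blocks:
  "together e f (set (map set Bs)) \<longleftrightarrow> list_ex (\<lambda>B. List.member B e \<and> List.member B f) Bs"
  by (auto simp: together_def list_ex_iff)

text \<open>Sizes are nonincreasing, and inside a block each edge after the head is opposite to an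
  earlier one in some pattern.\<close>

definition star_blocks :: "(nat \<times> nat) list list" where
  "star_blocks =
     [[(0, 1), (12, 13), (16, 17), (17, 13), (0, 12), (12, 0), (16, 12), (1, 17), (17, 16), (13, 1),
      (14, 4), (15, 9), (17, 1), (17, 0), (2, 0), (3, 0), (1, 0), (13, 12), (16, 0), (1, 2), (1, 3),
      (17, 12), (12, 18)],
      [(0, 4), (12, 14), (18, 19)],
      [(4, 0), (14, 12), (19, 18)],
      [(12, 16), (18, 0), (19, 4)],
      [(0, 9), (12, 15)],
      [(4, 7), (8, 0)],
      [(4, 8), (7, 0)],
      [(9, 0), (15, 12)],
      [(18, 12), (19, 14)],
      [(1, 6)],
      [(1, 10)],
      [(2, 1)],
      [(3, 1)],
      [(4, 5)],
      [(4, 11)],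
      [(4, 19)],
      [(5, 4)],
      [(6, 1)],
      [(7, 4)],
      [(8, 4)],
      [(10, 1)],
      [(11, 4)]]"

text \<open>In digest order, like \<open>blocks50\<close>.\<close>

definition blocks0 :: "(nat \<times> nat) list list" where
  "blocks0 =
     [[(19, 18), (0, 4), (15, 12), (16, 0), (0, 12), (6, 1), (17, 16), (13, 12), (1, 6), (15, 9),
      (19, 14), (12, 13), (13, 1), (14, 4), (0, 1), (7, 4), (1, 17), (7, 0), (18, 19), (8, 0),
      (4, 19), (10, 1), (2, 1)],
      [(12, 0), (4, 7), (18, 12)],
      [(17, 13), (9, 0), (3, 1)],
      [(16, 17), (12, 15), (8, 4)],
      [(1, 10), (1, 2)],
      [(4, 8), (19, 4)],
      [(1, 3), (2, 0)],
      [(4, 11), (12, 14)],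
      [(17, 12), (1, 0)],
      [(4, 0)],
      [(14, 12)],
      [(0, 9)],
      [(11, 4)],
      [(12, 18)],
      [(18, 0)],
      [(4, 5)],
      [(17, 1)],
      [(17, 0)],
      [(12, 16)],
      [(5, 4)],
      [(3, 0)],
      [(16, 12)]]"

lemma star_check: "component_check (diamond_pairs edges226) star_blocks"
  by code_simp

definition covers :: "(nat \<times> nat) list list \<Rightarrow> bool" where
  "covers Bs \<longleftrightarrow> distinct (concat Bs) \<and> list_all (List.member edges226) (concat Bs) \<and>
     list_all (List.member (concat Bs)) edges226 \<and> list_all (\<lambda>B. B \<noteq> []) Bs"

definition block_image :: "'a list \<Rightarrow> ('a \<times> 'a) list \<Rightarrow> 'a list" where
  "block_image xs B = remdups (map snd (filter (\<lambda>(u, v). List.member xs u) B))"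

definition enabled :: "(nat \<times> nat) list \<Rightarrow> nat \<Rightarrow> bool" where
  "enabled B u \<longleftrightarrow> list_ex (\<lambda>(v, w). v = u) B"

definition fork_check :: "(nat \<times> nat) list \<Rightarrow> (nat \<times> nat) list \<Rightarrow> nat \<Rightarrow> nat \<Rightarrow> nat \<Rightarrow> bool" where
  "fork_check A B s l r \<longleftrightarrow> List.member A (s, l) \<and> List.member B (s, r) \<and>
     enabled A l = enabled A r \<and> enabled B l = enabled B r"

text \<open>Blocks enter by index: \<open>A\<close>, \<open>B\<close> and \<open>A'\<close>,
  \<open>B'\<close> for the two forks, \<open>C\<close> and \<open>C'\<close> to separate the class
  of \<open>a\<close> from those of \<open>b\<close> and \<open>e\<close>.\<close>

definition swap_check where
  "swap_check Bs z a b e A B s A' B' s' C C' \<longleftrightarrow>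
     z \<noteq> [] \<and> list_all (\<lambda>i. i < length Bs) z \<and>
     list_all (\<lambda>i. i < length Bs) [A, B, A', B', C, C'] \<and> list_all (\<lambda>i. i < 20) [a, b, e, s, s'] \<and>
     e \<noteq> b \<and>
     foldl block_image [a] (map ((!) Bs) z) = [b] \<and>
     foldl block_image [b] (map ((!) Bs) z) = [a] \<and>
     foldl block_image [e] (map ((!) Bs) z) = [a] \<and>
     fork_check (Bs ! A) (Bs ! B) s a b \<and> fork_check (Bs ! A') (Bs ! B') s' a e \<and>
     \<not> enabled (Bs ! C) a \<and> enabled (Bs ! C) b \<and> \<not> enabled (Bs ! C') a \<and> enabled (Bs ! C') e"

lemma block_checks:
  "covers star_blocks" "covers blocks0" "covers blocks50"
  "map length blocks0 = map length star_blocks" "map length blocks50 = map length star_blocks"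
  "rev (sort (map length star_blocks)) = map length star_blocks"
  "list_all (\<lambda>(u, v). u < 20 \<and> v < 20) edges226"
  "list_ex (\<lambda>B. List.member B (4, 0) \<and> List.member B (14, 12)) star_blocks"
  "\<not> list_ex (\<lambda>B. List.member B (4, 0) \<and> List.member B (14, 12)) blocks0"
  "\<not> list_ex (\<lambda>B. List.member B (4, 0) \<and> List.member B (14, 12)) blocks50"
  by code_simp+

text \<open>For \<open>star_blocks\<close> the surviving paths are 0, 12, 15, 12 and 12, 0, 9, 0 and
  2, 0, 9, 0; for \<open>blocks0\<close> they are 0, 1, 17, 12 and 12, 13, 1, 0 and 1, 6, 1, 0. All
  other branches die out.\<close>

lemma swap_checks:
  "swap_check star_blocks [0, 4, 7] 0 12 2 0 0 16 0 0 1 3 11"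
  "swap_check blocks0 [0, 0, 8] 0 12 1 0 21 16 20 2 3 1 4"
  by code_simp+

lemma ranked_checks:
  "successively (bits_less False) (map (edge_bits 0) (concat blocks0))"
  "successively (bits_less False) (map (edge_bits 50) (concat blocks50))"
  by code_simp+

lemma covers_iff:
  "covers Bs \<longleftrightarrow> distinct (concat Bs) \<and> set (concat Bs) = set edges226 \<and> [] \<notin> set Bs"
  unfolding covers_def list_all_iff List.member_iff by blast

lemma edges226_less: "(u, v) \<in> set edges226 \<Longrightarrow> u < 20 \<and> v < 20"
  using block_checks(7) by (auto simp: list_all_iff)

lemma Pi_star_eq: "Pi_star = set (map set star_blocks)"
proof -
  have E: "set (concat star_blocks) = set edges226"
    using block_checks(1) unfolding covers_iff by blast
  show ?thesis
    unfolding Pi_star_def opp_partition_def Omega_adj_eq[OF G226(2)] G226(2)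
    by (rule quotient_components[OF star_check E[symmetric]])
qed

lemma profile_covers: "covers Bs \<Longrightarrow> profile (set (map set Bs)) = mset (map length Bs)"
  unfolding covers_iff by (intro profile_blocks) blast+

text \<open>The lengths of \<open>star_blocks\<close> are already nonincreasing, so they are the
  cutting sequence, and cutting a concatenation at its block lengths returns the blocks.\<close>

lemma control_partition_eq:
  assumes "covers Bs" "map length Bs = map length star_blocks" "k < 100"
    and "successively (bits_less False) (map (edge_bits k) (concat Bs))"
  shows "control_partition k = set (map set Bs)"
proof -
  have Bs: "distinct (concat Bs)" "set (concat Bs) = set edges226"
    using assms(1) unfolding covers_iff by blast+
  have "\<forall>e\<in>set (concat Bs). fst e < 100 \<and> snd e < 100"
    unfolding Bs(2) using edges226_less by fastforce
  then have "ranked_edges k (parcs G226) = concat Bs"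
    unfolding G226(2) using ranked_edges_eqI[OF Bs _ assms(3,4)] by blast
  moreover have "rev (sorted_list_of_multiset (profile Pi_star)) = map length Bs"
    unfolding Pi_star_eq profile_covers[OF block_checks(1)] sorted_list_of_multiset_mset assms(2)
    by (rule block_checks(6))
  ultimately show ?thesis
    by (simp only: control_partition_def cut_concat)
qed

lemma control_partitions:
  "control_partition 0 = set (map set blocks0)" "control_partition 50 = set (map set blocks50)"
  by (rule control_partition_eq block_checks ranked_checks | simp)+

lemma block_system_covers:
  assumes "covers Bs"
  shows "block_system G226 (set (map set Bs))"
proof
  show "finite (pverts G226)" by (simp add: G226)
  fix C assume "C \<in> set (map set Bs)"
  then have "C \<subseteq> set (concat Bs)" by auto
  then have "C \<subseteq> set edges226" using assms unfolding covers_iff by blast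
  then show "C \<subseteq> pverts G226 \<times> pverts G226"
    using edges226_less by (auto simp: G226)
qed

lemma set_block_image: "set (block_image xs B) = set B `` set xs"
  by (force simp: block_image_def)

lemma enabled_iff: "enabled B u \<longleftrightarrow> set B `` {u} \<noteq> {}"
  by (force simp: enabled_def list_ex_iff)

lemma word_rel_foldl:
  assumes "block_system G \<P>" "set (map set Cs) \<subseteq> \<P>" "Cs \<noteq> []"
  shows "word_rel G (map set Cs) `` set xs = set (foldl block_image xs Cs)"
  using assms(3,2)
proof (induction Cs arbitrary: xs rule: list_nonempty_induct)
  case (single C)
  then have "word_rel G [set C] = set C"
    using block_system.word_rel_single[OF assms(1)] by simp
  then show ?case by (simp add: set_block_image)
next
  case (cons C Cs)
  then show ?case by (simp add: relcomp_Image flip: set_block_image)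
qed

lemma H_swap_check:
  assumes "covers Bs" and check: "swap_check Bs z a b e A B s A' B' s' C C'"
  shows "H G226 (set (map set Bs)) = 1"
proof -
  interpret block_system G226 "set (map set Bs)" using assms(1) by (rule block_system_covers)
  let ?z = "map set (map ((!) Bs) z)"
  have mem: "set (Bs ! i) \<in> set (map set Bs)" if "i < length Bs" for i
    using that by simp
  have idx: "A < length Bs" "B < length Bs" "A' < length Bs" "B' < length Bs" "C < length Bs" "C' < length Bs"
    and verts: "a \<in> pverts G226" "b \<in> pverts G226" "e \<in> pverts G226" "s \<in> pverts G226" "s' \<in> pverts G226"
    and images: "foldl block_image [a] (map ((!) Bs) z) = [b]" "foldl block_image [b] (map ((!) Bs) z) = [a]"
      "foldl block_image [e] (map ((!) Bs) z) = [a]"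
    and forks: "fork_check (Bs ! A) (Bs ! B) s a b" "fork_check (Bs ! A') (Bs ! B') s' a e"
    and "e \<noteq> b" "z \<noteq> []" and zs: "\<forall>i\<in>set z. i < length Bs"
    and en: "\<not> enabled (Bs ! C) a" "enabled (Bs ! C) b" "\<not> enabled (Bs ! C') a" "enabled (Bs ! C') e"
    using check by (simp_all add: swap_check_def G226 list_all_iff)
  have zP: "set (map set (map ((!) Bs) z)) \<subseteq> set (map set Bs)"
    using zs mem by auto
  then have "nonempty_word (set (map set Bs)) ?z"
    using \<open>z \<noteq> []\<close> by (auto simp: nonempty_word_def)
  moreover have "word_rel G226 ?z `` {x} = {y}" if "foldl block_image [x] (map ((!) Bs) z) = [y]" for x y
    using word_rel_foldl[OF block_system_axioms zP, of "[x]"] \<open>z \<noteq> []\<close> that by simp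
  moreover have "kap G226 (set (map set Bs)) a \<noteq> kap G226 (set (map set Bs)) b"
    "kap G226 (set (map set Bs)) a \<noteq> kap G226 (set (map set Bs)) e"
    using kap_neqI[OF mem[OF idx(5)] verts(1,2)] kap_neqI[OF mem[OF idx(6)] verts(1,3)] en
    by (simp_all add: enabled_iff)
  ultimately show ?thesis
    using H_swap[of a b ?z s "set (Bs ! A)" "set (Bs ! B)" e s' "set (Bs ! A')" "set (Bs ! B')"]
      verts mem[OF idx(1)] mem[OF idx(2)] mem[OF idx(3)] mem[OF idx(4)] images forks \<open>e \<noteq> b\<close>
    by (simp add: fork_check_def enabled_iff)
qed

lemma rows_rel_rows50: "rows_rel ` set rows50 = set (map set blocks50)"
proof -
  have "rows_rel (to_rows B) = set B" if "B \<in> set blocks50" for B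
  proof (rule rows_rel_to_rows)
    have "set B \<subseteq> set edges226"
      using that block_checks(3) unfolding covers_iff by auto
    then show "set B \<subseteq> {..<20} \<times> {..<20}" using edges226_less by auto
  qed
  then show ?thesis by (auto simp: rows50_def image_iff)
qed

text \<open>The edges \<open>(4, 0)\<close> and \<open>(14, 12)\<close> are opposite in the pattern
  \<open>(14, 4, 12, 0)\<close>, so they share a block of \<open>Pi_star\<close>.\<close>

lemma Pi_star_neq:
  assumes "\<not> list_ex (\<lambda>B. List.member B (4, 0) \<and> List.member B (14, 12)) Bs"
  shows "set (map set Bs) \<noteq> Pi_star"
  using assms block_checks(8) unfolding Pi_star_eq together_blocks[symmetric] by metis

theorem theorem8p1:
  shows "H G226 Pi_star = 1 \<and> H G226 (control_partition 0) = 1 \<and> H G226 (control_partition 50) = 0 \<and>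
    control_partition 0 \<noteq> Pi_star \<and> profile (control_partition 0) = profile Pi_star \<and>
    control_partition 50 \<noteq> Pi_star \<and> profile (control_partition 50) = profile Pi_star \<and>
    card (relation_semigroup G226 (control_partition 50)) = 885 \<and>
    \<not> (\<exists>c. wpu_certificate G226 (control_partition 50) c)"
proof -
  have "block_system G226 (rows_rel ` set rows50)"
    unfolding rows_rel_rows50 using block_checks(3) by (rule block_system_covers)
  note S = semigroup_rows50[OF this, unfolded rows_rel_rows50]
  have profiles: "profile (set (map set Bs)) = profile Pi_star"
    if "covers Bs" "map length Bs = map length star_blocks" for Bs
    unfolding Pi_star_eq profile_covers[OF that(1)] profile_covers[OF block_checks(1)] that(2) ..
  show ?thesis
    unfolding control_partitions
    using H_swap_check[OF block_checks(1) swap_checks(1)] H_swap_check[OF block_checks(2) swap_checks(2)]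
      H_eq_0[OF S(2)] S profiles[OF block_checks(2,4)] profiles[OF block_checks(3,5)]
      Pi_star_neq[OF block_checks(9)] Pi_star_neq[OF block_checks(10)] Pi_star_eq
    by metis
qed

end
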